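(* There is a polynomial-time algorithm that solves Any-Strict Undirected Reachability Graph Realizability on input digraphs $D$ whose solid graph is a tree.
   Context: An undirected temporal graph is a pair $(G,\lambda)$ with $G=(V,E)$ a simple undirected graph and $\lambda:E\to 2^{\mathbb{N}}$ assigning each edge a finite, possibly empty, set of labels. A strict temporal path from $u$ to $v$ is a sequence $(e_1,t_1),\dots,(e_\ell,t_\ell)$, $t_j\in\lambda(e_j)$, such that $e_1,\dots,e_\ell$ form a $u$-$v$ path and $t_1<\dots<t_\ell$. The strict reachability graph is the digraph on $V$ with arc $(u,v)$, $u\neq v$, iff a strict temporal path from $u$ to $v$ exists. Any-Strict Undirected Reachability Graph Realizability: given a simple digraph $D=(V,A)$, decide whether some undirected temporal graph on $V$ has strict reachability graph equal to $D$. A solid edge of $D$ is a pair $\{u,v\}$ with $(u,v),(v,u)\in A$; the solid graph of $D$ is the undirected graph on $V$ formed by the solid edges. *)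

theory Defs
  imports "Graph_Theory.Pair_Digraph" "HOL-Computational_Algebra.Polynomial"
begin

section \<open>Undirected graphs and trees\<close>

text \<open>
  Undirected graphs are given by a vertex set and a set of two-element edges. The notion \<open>tree\<close> of
  \<open>Graph_Theory\<close> is not usable here: undirected graphs are symmetric digraphs there, in which every
  edge yields a cycle \<open>u, v, u\<close>.
\<close>

definition simple_graph :: "'a set \<Rightarrow> 'a set set \<Rightarrow> bool" where
  "simple_graph V E \<longleftrightarrow> finite V \<and> (\<forall>e\<in>E. e \<subseteq> V \<and> card e = 2)"

definition path_edges :: "'a list \<Rightarrow> 'a set list" where
  "path_edges vs = map2 (\<lambda>x y. {x, y}) vs (tl vs)"

definition undirected_path :: "'a set \<Rightarrow> 'a set set \<Rightarrow> 'a list \<Rightarrow> bool" where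
  "undirected_path V E vs \<longleftrightarrow>
     vs \<noteq> [] \<and> distinct vs \<and> set vs \<subseteq> V \<and> set (path_edges vs) \<subseteq> E"

definition undirected_cycle :: "'a set \<Rightarrow> 'a set set \<Rightarrow> 'a list \<Rightarrow> bool" where
  "undirected_cycle V E vs \<longleftrightarrow>
     length vs \<ge> 3 \<and> undirected_path V E vs \<and> {last vs, hd vs} \<in> E"

definition undirected_tree :: "'a set \<Rightarrow> 'a set set \<Rightarrow> bool" where
  "undirected_tree V E \<longleftrightarrow>
     simple_graph V E \<and> V \<noteq> {} \<and>
     (\<forall>u\<in>V. \<forall>v\<in>V. \<exists>vs. undirected_path V E vs \<and> hd vs = u \<and> last vs = v) \<and>
     (\<nexists>vs. undirected_cycle V E vs)"


section \<open>Temporal graphs and strict reachability\<close>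

definition temporal_graph :: "'a set \<Rightarrow> 'a set set \<Rightarrow> ('a set \<Rightarrow> nat set) \<Rightarrow> bool" where
  "temporal_graph V E lab \<longleftrightarrow> simple_graph V E \<and> (\<forall>e\<in>E. finite (lab e))"

definition strict_temporal_path ::
  "'a set \<Rightarrow> 'a set set \<Rightarrow> ('a set \<Rightarrow> nat set) \<Rightarrow> 'a \<Rightarrow> ('a set \<times> nat) list \<Rightarrow> 'a \<Rightarrow> bool" where
  "strict_temporal_path V E lab u p v \<longleftrightarrow>
     (\<exists>vs. undirected_path V E vs \<and> hd vs = u \<and> last vs = v \<and> map fst p = path_edges vs) \<and>
     (\<forall>(e, t)\<in>set p. t \<in> lab e) \<and>
     sorted_wrt (<) (map snd p)"

definition strict_reachability_graph ::
  "'a set \<Rightarrow> 'a set set \<Rightarrow> ('a set \<Rightarrow> nat set) \<Rightarrow> 'a pair_pre_digraph" where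
  "strict_reachability_graph V E lab =
     \<lparr>pverts = V,
      parcs = {(u, v). u \<in> V \<and> v \<in> V \<and> u \<noteq> v \<and> (\<exists>p. strict_temporal_path V E lab u p v)}\<rparr>"

definition any_strict_realizable :: "'a pair_pre_digraph \<Rightarrow> bool" where
  "any_strict_realizable D \<longleftrightarrow>
     (\<exists>E lab. temporal_graph (pverts D) E lab \<and> strict_reachability_graph (pverts D) E lab = D)"

definition solid_edges :: "'a pair_pre_digraph \<Rightarrow> 'a set set" where
  "solid_edges D = {{u, v} | u v. (u, v) \<in> parcs D \<and> (v, u) \<in> parcs D}"


section \<open>Polynomial time\<close>

text \<open>
  Random access machines with a read-only binary input and registers holding natural numbers, under
  the unit-cost measure. The only arithmetic is addition and truncated subtraction, so register
  contents grow by at most one bit per step and polynomial time on this machine coincides with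
  polynomial time on Turing machines.
\<close>

datatype instr =
    SetConst nat nat  \<comment> \<open>\<open>R[i] := c\<close>\<close>
  | Add nat nat nat   \<comment> \<open>\<open>R[i] := R[j] + R[k]\<close>\<close>
  | Sub nat nat nat   \<comment> \<open>\<open>R[i] := R[j] - R[k]\<close>, truncated\<close>
  | Load nat nat      \<comment> \<open>\<open>R[i] := R[R[j]]\<close>\<close>
  | Store nat nat     \<comment> \<open>\<open>R[R[i]] := R[j]\<close>\<close>
  | ReadBit nat nat   \<comment> \<open>\<open>R[i] :=\<close> input bit at position \<open>R[j]\<close>; 0 past the end of the input\<close>
  | JumpZero nat nat  \<comment> \<open>continue at instruction \<open>l\<close> if \<open>R[i] = 0\<close>\<close>

type_synonym config = "nat \<times> (nat \<Rightarrow> nat)"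

fun exec_instr :: "bool list \<Rightarrow> instr \<Rightarrow> config \<Rightarrow> config" where
  "exec_instr x (SetConst i c) (pc, R) = (Suc pc, R(i := c))"
| "exec_instr x (Add i j k) (pc, R) = (Suc pc, R(i := R j + R k))"
| "exec_instr x (Sub i j k) (pc, R) = (Suc pc, R(i := R j - R k))"
| "exec_instr x (Load i j) (pc, R) = (Suc pc, R(i := R (R j)))"
| "exec_instr x (Store i j) (pc, R) = (Suc pc, R(R i := R j))"
| "exec_instr x (ReadBit i j) (pc, R) =
     (Suc pc, R(i := (if R j < length x \<and> x ! R j then 1 else 0)))"
| "exec_instr x (JumpZero i l) (pc, R) = (if R i = 0 then l else Suc pc, R)"

text \<open>The machine halts when the program counter leaves the program; it accepts if \<open>R[0] \<noteq> 0\<close> then.\<close>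

definition halted :: "instr list \<Rightarrow> config \<Rightarrow> bool" where
  "halted P c \<longleftrightarrow> length P \<le> fst c"

definition step :: "instr list \<Rightarrow> bool list \<Rightarrow> config \<Rightarrow> config" where
  "step P x c = (if halted P c then c else exec_instr x (P ! fst c) c)"

definition config_after :: "instr list \<Rightarrow> bool list \<Rightarrow> nat \<Rightarrow> config" where
  "config_after P x t = (step P x ^^ t) (0, \<lambda>_. 0)"

definition accepting :: "config \<Rightarrow> bool" where
  "accepting c \<longleftrightarrow> snd c 0 \<noteq> 0"

text \<open>
  A single machine and a single polynomial in the length of the encoded input serve for all
  instances in \<open>I\<close>; nothing is required on other inputs.
\<close>

definition polynomial_time_solvable_on ::
  "'i set \<Rightarrow> ('i \<Rightarrow> bool list) \<Rightarrow> ('i \<Rightarrow> bool) \<Rightarrow> bool" where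
  "polynomial_time_solvable_on I enc Q \<longleftrightarrow>
     (\<exists>(P :: instr list) (q :: nat poly). \<forall>D\<in>I. \<exists>t \<le> poly q (length (enc D)).
        halted P (config_after P (enc D) t) \<and>
        (accepting (config_after P (enc D) t) \<longleftrightarrow> Q D))"


section \<open>Digraphs as inputs\<close>

definition input_digraphs :: "nat pair_pre_digraph set" where
  "input_digraphs = {D. pair_digraph D \<and> (\<exists>n. pverts D = {0..<n})}"

text \<open>The number of vertices in unary, followed by the adjacency matrix row by row.\<close>

definition encode_digraph :: "nat pair_pre_digraph \<Rightarrow> bool list" where
  "encode_digraph D =
     (let n = card (pverts D)
      in replicate n True @ False # map (\<lambda>a. a \<in> parcs D) (List.product [0..<n] [0..<n]))"

lemma length_encode_digraph:
  "length (encode_digraph D) = card (pverts D) + 1 + card (pverts D) * card (pverts D)"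
  by (simp add: encode_digraph_def Let_def)

lemma inj_on_encode_digraph: "inj_on encode_digraph input_digraphs"
proof (rule inj_onI)
  fix D D' assume D: "D \<in> input_digraphs" "D' \<in> input_digraphs"
    and eq: "encode_digraph D = encode_digraph D'"
  obtain n m where n: "pverts D = {0..<n}" "pverts D' = {0..<m}"
    using D by (auto simp: input_digraphs_def)
  have tw: "takeWhile (\<lambda>b. b) (replicate k True @ False # bs) = replicate k True" for k bs
    by (induction k) auto
  have "takeWhile (\<lambda>b. b) (encode_digraph D) = replicate n True"
    "takeWhile (\<lambda>b. b) (encode_digraph D') = replicate m True"
    using n by (simp_all add: encode_digraph_def Let_def tw)
  then have nm: "n = m"
    using eq by (metis length_replicate)
  have "map (\<lambda>a. a \<in> parcs D) (List.product [0..<n] [0..<n])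
      = map (\<lambda>a. a \<in> parcs D') (List.product [0..<n] [0..<n])"
    using eq n nm by (simp add: encode_digraph_def Let_def)
  then have *: "a \<in> parcs D \<longleftrightarrow> a \<in> parcs D'" if "a \<in> {0..<n} \<times> {0..<n}" for a
    using that by (auto simp: map_eq_conv)
  interpret D: pair_digraph D using D by (simp add: input_digraphs_def)
  interpret D': pair_digraph D' using D by (simp add: input_digraphs_def)
  have "parcs D \<subseteq> {0..<n} \<times> {0..<n}" "parcs D' \<subseteq> {0..<n} \<times> {0..<n}"
    using D.arc_fst_in_verts D.arc_snd_in_verts D'.arc_fst_in_verts D'.arc_snd_in_verts n nm
    by (auto simp: mem_Times_iff)
  with * have "parcs D = parcs D'" by blast
  with n nm show "D = D'" by simp
qed

end

(*
  Every label of a realization sits on a solid edge and every solid edge carries a label, so only the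
  label sets on the solid tree have to be found.  At a vertex v the arcs between its neighbours order
  the label sets of the edges at v: no arc between x and z means that vx and vz carry the same single
  label, and an arc from x to z means that all labels of xv are at most all labels of vz.  Beyond this
  order it only matters whether an edge has one, two or more labels and whether two consecutive label
  sets are tight, i.e. share a label.  A path of at least three edges all of whose consecutive pairs
  can be traversed fails exactly if it contains a stretch of tight pairs that starts and ends with a
  single-label edge and has two-label edges in between.  Hence an inclusion-minimal non-arc forces
  these properties along its path; closing the forced facts under the rules that hold at a vertex
  gives the least candidate, and D is realizable iff that candidate is consistent with D.  Labels are then intervals of length 0, 1
  or 2 whose positions are the values of a potential on the tree.  The least candidate is the least
  fixed point of a first-order formula, which a random access machine finds by chaotic iteration.
*)
theory Submission
  imports Defs
begin

section \<open>Structured programs for the random access machine\<close>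

text \<open>The obstacle is that a realization contains accidental facts, counts and tightness that
  hold without being forced. Two monotonicity properties remove the choice. The rules use facts only
  positively (negation is applied to arcs and vertex equality alone), and consistency uses them only
  negatively. The facts of a realization form a closed consistent set, so the least closed set lies
  below it and is consistent too. Conversely, whatever is not forced is resolved in favour of slack:
  three labels on an edge, a gap between label sets. Three suffice because a traversal delayed by a
  tight pair loses just the first label of the next edge, so a middle label ends the delay. The tree
  is used in three ways: paths are unique, so an arc speaks of one sequence of label sets; offsets
  chosen independently at the vertices integrate to one potential; without triangles, arcs between
  neighbours of a vertex go one way. First-order rules cannot speak of paths of arbitrary length;
  the facts tagged 0 and 4 carry this information along a path edge by edge. There are at most
  \<open>5 * n ^ 3\<close> facts, and as many passes suffice.\<close>

datatype cmd =
    Prim instr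
  | Seq cmd cmd (infixr ";;" 60)
  | When nat cmd
  | Loop nat cmd

fun compile :: "nat \<Rightarrow> cmd \<Rightarrow> instr list" where
  "compile a (Prim i) = [i]"
| "compile a (c ;; d) = (let p = compile a c in p @ compile (a + length p) d)"
| "compile a (When r c) = (let p = compile (a + 1) c in JumpZero r (a + 1 + length p) # p)"
| "compile a (Loop r c) =
     (let p = compile (a + 1) c
      in JumpZero r (a + 3 + length p) # p @ [SetConst 2 0, JumpZero 2 a])"

text \<open>
  Register 2 is overwritten by every loop: the machine has no unconditional jump, so the jump back
  tests a register that has just been set to 0.
\<close>

inductive exec :: "bool list \<Rightarrow> cmd \<Rightarrow> (nat \<Rightarrow> nat) \<Rightarrow> nat \<Rightarrow> (nat \<Rightarrow> nat) \<Rightarrow> bool" for x where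
  Prim: "(\<And>pc. exec_instr x i (pc, R) = (Suc pc, R')) \<Longrightarrow> exec x (Prim i) R 1 R'"
| Seq: "exec x c R s R1 \<Longrightarrow> exec x d R1 t R2 \<Longrightarrow> exec x (c ;; d) R (s + t) R2"
| When_zero: "R r = 0 \<Longrightarrow> exec x (When r c) R 1 R"
| When_pos: "R r \<noteq> 0 \<Longrightarrow> exec x c R t R' \<Longrightarrow> exec x (When r c) R (Suc t) R'"
| Loop_zero: "R r = 0 \<Longrightarrow> exec x (Loop r c) R 1 R"
| Loop_pos: "R r \<noteq> 0 \<Longrightarrow> exec x c R s R1 \<Longrightarrow> exec x (Loop r c) (R1(2 := 0)) t R2 \<Longrightarrow>
    exec x (Loop r c) R (s + t + 3) R2"

lemma step_at: "a = length p \<Longrightarrow> step (p @ i # q) x (a, R) = exec_instr x i (a, R)"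
  by (simp add: step_def halted_def)

lemma step_Suc_comp: "step P x c = c' \<Longrightarrow> (step P x ^^ t) c' = c'' \<Longrightarrow> (step P x ^^ Suc t) c = c''"
  by (simp add: funpow_swap1)

lemma step_add_comp:
  "(step P x ^^ s) c = c' \<Longrightarrow> (step P x ^^ t) c' = c'' \<Longrightarrow> (step P x ^^ (s + t)) c = c''"
  by (simp only: add.commute[of s t] funpow_add comp_apply)

text \<open>Jump targets are absolute, so code is compiled for an address \<open>a\<close>, and the
  induction must range over all surrounding code \<open>p\<close> and \<open>q\<close>. The three
  extra steps of a loop round are the test, the clearing of register 2 and the jump back.\<close>

lemma compile_correct:
  "exec x c R t R' \<Longrightarrow> P = p @ compile a c @ q \<Longrightarrow> a = length p \<Longrightarrow>
   (step P x ^^ t) (a, R) = (a + length (compile a c), R')"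
proof (induction arbitrary: p a q rule: exec.induct)
  case (Prim i R R')
  then show ?case by (simp add: step_at)
next
  case (Seq c R s R1 d t R2)
  let ?c = "compile a c"
  have "(step P x ^^ s) (a, R) = (a + length ?c, R1)"
    using Seq.IH(1)[of p a "compile (a + length ?c) d @ q"] Seq.prems by (simp add: Let_def)
  moreover have "(step P x ^^ t) (a + length ?c, R1) =
      (a + length ?c + length (compile (a + length ?c) d), R2)"
    using Seq.IH(2)[of "p @ ?c" "a + length ?c" q] Seq.prems by (simp add: Let_def)
  ultimately show ?case
    by (simp add: step_add_comp Let_def add.assoc)
next
  case (When_zero R r c)
  then show ?case by (simp add: step_at Let_def)
next
  case (When_pos R r c t R')
  let ?c = "compile (a + 1) c"
  have "step P x (a, R) = (a + 1, R)"
    using When_pos by (simp add: step_at Let_def)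
  moreover have "(step P x ^^ t) (a + 1, R) = (a + 1 + length ?c, R')"
    using When_pos.IH[of "p @ [JumpZero r (a + 1 + length ?c)]" "a + 1" q] When_pos.prems
    by (simp add: Let_def)
  ultimately show ?case
    by (metis (no_types, lifting) step_Suc_comp compile.simps(3) length_Cons add_Suc_right
        Suc_eq_plus1 add.commute add_Suc)
next
  case (Loop_zero R r c)
  then show ?case by (simp add: step_at Let_def)
next
  case (Loop_pos R r c s R1 t R2)
  let ?c = "compile (a + 1) c"
  let ?j = "JumpZero r (a + 3 + length ?c)"
  have P: "P = p @ ?j # ?c @ [SetConst 2 0, JumpZero 2 a] @ q"
    using Loop_pos.prems(1) by (simp add: Let_def)
  have a: "a = length p" by fact
  have 1: "step P x (a, R) = (a + 1, R)"
    unfolding P using Loop_pos.hyps(1) by (subst step_at[OF a]) simp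
  have 2: "(step P x ^^ s) (a + 1, R) = (a + 1 + length ?c, R1)"
    by (rule Loop_pos.IH(1)[of "p @ [?j]" "a + 1" "[SetConst 2 0, JumpZero 2 a] @ q"])
      (simp_all only: P append_assoc append_Cons append_Nil a length_append length_Cons list.size)
  have 3: "step P x (a + 1 + length ?c, R1) = (a + 2 + length ?c, R1(2 := 0))"
    using step_at[of "a + 1 + length ?c" "p @ ?j # ?c" "SetConst 2 0" "[JumpZero 2 a] @ q" x R1]
    unfolding P a by simp
  have 4: "step P x (a + 2 + length ?c, R1(2 := 0)) = (a, R1(2 := 0))"
    using step_at[of "a + 2 + length ?c" "p @ ?j # ?c @ [SetConst 2 0]" "JumpZero 2 a" q x "R1(2 := 0)"]
    unfolding P a by simp
  have 5: "(step P x ^^ t) (a, R1(2 := 0)) = (a + length (compile a (Loop r c)), R2)"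
    by (rule Loop_pos.IH(2)[OF Loop_pos.prems])
  have "(step P x ^^ (s + Suc (Suc t))) (a + 1, R) = (a + length (compile a (Loop r c)), R2)"
    by (rule step_add_comp[OF 2]) (rule step_Suc_comp[OF 3 step_Suc_comp[OF 4 5]])
  from step_Suc_comp[OF 1 this] show ?case
    by (simp add: numeral_eq_Suc)
qed

text \<open>The cost is only an upper bound, so that both outcomes of a test, and all rounds of a
  loop, can share one figure.\<close>

definition runs :: "bool list \<Rightarrow> cmd \<Rightarrow> (nat \<Rightarrow> nat) \<Rightarrow> nat \<Rightarrow> (nat \<Rightarrow> nat) \<Rightarrow> bool" where
  "runs x c R T R' \<longleftrightarrow> (\<exists>t\<le>T. exec x c R t R')"

lemma runs_Prim: "(\<And>pc. exec_instr x i (pc, R) = (Suc pc, R')) \<Longrightarrow> runs x (Prim i) R 1 R'"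
  unfolding runs_def using exec.Prim by blast

lemma runs_SetConst: "runs x (Prim (SetConst i c)) R 1 (R(i := c))"
  and runs_Add: "runs x (Prim (Add i j k)) R 1 (R(i := R j + R k))"
  and runs_Sub: "runs x (Prim (Sub i j k)) R 1 (R(i := R j - R k))"
  and runs_Load: "runs x (Prim (Load i j)) R 1 (R(i := R (R j)))"
  and runs_Store: "runs x (Prim (Store i j)) R 1 (R(R i := R j))"
  and runs_ReadBit: "runs x (Prim (ReadBit i j)) R 1
        (R(i := (if R j < length x \<and> x ! R j then 1 else 0)))"
  by (rule runs_Prim, simp)+

lemma runs_Seq: "runs x c R S R1 \<Longrightarrow> runs x d R1 T R2 \<Longrightarrow> runs x (c ;; d) R (S + T) R2"
  unfolding runs_def by (meson add_mono exec.Seq)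

lemma runs_mono: "runs x c R S R' \<Longrightarrow> S \<le> T \<Longrightarrow> runs x c R T R'"
  unfolding runs_def using order_trans by blast

lemma runs_When_zero: "R r = 0 \<Longrightarrow> runs x (When r c) R (Suc T) R"
  unfolding runs_def using exec.When_zero by (metis One_nat_def Suc_le_mono zero_le)

lemma runs_When_pos: "R r \<noteq> 0 \<Longrightarrow> runs x c R T R' \<Longrightarrow> runs x (When r c) R (Suc T) R'"
  unfolding runs_def using exec.When_pos by (metis Suc_le_mono)

lemma runs_Loop_zero: "R r = 0 \<Longrightarrow> runs x (Loop r c) R 1 R"
  unfolding runs_def using exec.Loop_zero by blast

lemma runs_Loop_pos:
  "R r \<noteq> 0 \<Longrightarrow> runs x c R S R1 \<Longrightarrow> runs x (Loop r c) (R1(2 := 0)) T R2 \<Longrightarrow>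
   runs x (Loop r c) R (S + T + 3) R2"
  unfolding runs_def by (meson add_mono exec.Loop_pos order_refl)

text \<open>Register 1 holds the number of vertices and register 3 the constant 1.\<close>

definition For :: "nat \<Rightarrow> cmd \<Rightarrow> cmd" where
  "For r c = Prim (SetConst 2 0) ;; Prim (Add r 1 2) ;; Loop r (Prim (Sub r r 3) ;; c)"

text \<open>The counter runs down, so \<open>I j\<close> describes the state in which the values
  from \<open>j\<close> on are done. Hypothesis \<open>indep\<close> says that the invariant ignores
  the two registers changed by the loop administration. A round adds one step for the decrement and
  three for the loop; the final 3 is the set-up and the last test.\<close>

lemma runs_For:
  assumes base: "\<And>j R. I j R \<Longrightarrow> R 1 = n \<and> R 3 = 1"
    and indep: "\<And>j R R'. I j R \<Longrightarrow> (\<forall>q. q \<noteq> r \<longrightarrow> q \<noteq> 2 \<longrightarrow> R' q = R q) \<Longrightarrow> I j R'"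
    and body: "\<And>j R. j < n \<Longrightarrow> I (Suc j) R \<Longrightarrow> R r = j \<Longrightarrow>
      \<exists>R'. runs x c R T R' \<and> I j R' \<and> R' r = j"
    and r: "r \<notin> {1, 2, 3}" and I: "I n R"
  shows "\<exists>R'. runs x (For r c) R (n * (T + 4) + 3) R' \<and> I 0 R'"
proof -
  have loop: "\<exists>R'. runs x (Loop r (Prim (Sub r r 3) ;; c)) R (j * (T + 4) + 1) R' \<and> I 0 R'"
    if "I j R" "R r = j" "j \<le> n" for j R
    using that
  proof (induction j arbitrary: R)
    case 0
    then show ?case using runs_Loop_zero[of R r x] by auto
  next
    case (Suc j)
    let ?R = "R(r := R r - R 3)"
    have r3: "R 3 = 1" using base Suc by blast
    have I1: "I (Suc j) ?R"
      by (rule indep[OF Suc.prems(1)]) simp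
    obtain R1 where R1: "runs x c ?R T R1" "I j R1" "R1 r = j"
      using body[OF _ I1] Suc.prems r3 by auto
    have "I j (R1(2 := 0))"
      by (rule indep[OF R1(2)]) simp
    then obtain R2 where R2: "runs x (Loop r (Prim (Sub r r 3) ;; c)) (R1(2 := 0)) (j * (T + 4) + 1) R2" "I 0 R2"
      using Suc.IH[of "R1(2 := 0)"] R1(3) r Suc.prems(3) by (metis Suc_leD fun_upd_other insertCI)
    have "runs x (Loop r (Prim (Sub r r 3) ;; c)) R (1 + T + (j * (T + 4) + 1) + 3) R2"
      by (rule runs_Loop_pos[OF _ runs_Seq[OF runs_Sub R1(1)] R2(1)]) (simp add: Suc)
    then have "runs x (Loop r (Prim (Sub r r 3) ;; c)) R (Suc j * (T + 4) + 1) R2"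
      by (rule runs_mono) simp
    then show ?case using R2 by blast
  qed
  let ?R = "R(2 := 0, r := R 1 + 0)"
  have "I n ?R" by (rule indep[OF I]) simp
  then obtain R' where R': "runs x (Loop r (Prim (Sub r r 3) ;; c)) ?R (n * (T + 4) + 1) R'" "I 0 R'"
    using loop[of n ?R] base[OF I] by auto
  have "runs x (For r c) R (1 + (1 + (n * (T + 4) + 1))) R'"
    unfolding For_def
    apply (rule runs_Seq[OF runs_SetConst])
    apply (rule runs_Seq[OF runs_Add])
    using R'(1) r by simp
  then have "runs x (For r c) R (n * (T + 4) + 3) R'"
    by (rule runs_mono) simp
  then show ?thesis using R'(2) by blast
qed

definition agree :: "nat set \<Rightarrow> (nat \<Rightarrow> nat) \<Rightarrow> (nat \<Rightarrow> nat) \<Rightarrow> bool" where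
  "agree S R R' \<longleftrightarrow> (\<forall>q. q \<notin> S \<longrightarrow> R' q = R q)"

text \<open>Register 0 carries truth values, 4 addresses, 5 and 6 serve the multiplication, and 2 is
  the one that loops clear.\<close>

definition scratch :: "nat set" where "scratch = {0, 2, 4, 5, 6}"

lemma agree_trans: "agree S R R1 \<Longrightarrow> agree S R1 R2 \<Longrightarrow> agree S R R2"
  and agree_mono: "agree S R R1 \<Longrightarrow> S \<subseteq> S' \<Longrightarrow> agree S' R R1"
  and agree_upd: "agree S R R1 \<Longrightarrow> q \<in> S \<Longrightarrow> agree S R (R1(q := v))"
  by (auto simp: agree_def)

text \<open>Multiplies register 4 by the number of vertices through repeated addition, as the
  machine has no multiplication. The last two instructions move register 5 to register 4.\<close>

definition Mul :: cmd where
  "Mul = Prim (SetConst 5 0) ;; For 6 (Prim (Add 5 5 4)) ;; Prim (SetConst 2 0) ;; Prim (Add 4 5 2)"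

lemma runs_Mul:
  assumes "R 1 = n" "R 3 = 1"
  shows "\<exists>R'. runs x Mul R (n * 5 + 6) R' \<and> agree scratch R R' \<and> R' 4 = R 4 * n"
proof -
  let ?R = "R(5 := 0)"
  define I where "I j R' \<longleftrightarrow> R' 5 = (n - j) * R 4 \<and> R' 4 = R 4 \<and> R' 1 = n \<and> R' 3 = 1 \<and> agree scratch R R'" for j R'
  have "\<exists>R'. runs x (For 6 (Prim (Add 5 5 4))) ?R (n * (1 + 4) + 3) R' \<and> I 0 R'"
  proof (rule runs_For[where n = n])
    show "I n ?R" using assms by (simp add: I_def agree_def scratch_def)
  next
    fix j R1 assume *: "j < n" "I (Suc j) R1" "R1 6 = j"
    let ?R1 = "R1(5 := R1 5 + R1 4)"
    have "n - j = Suc (n - Suc j)" using *(1) by simp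
    then have "I j ?R1" using * by (auto simp: I_def agree_def scratch_def)
    then show "\<exists>R'. runs x (Prim (Add 5 5 4)) R1 1 R' \<and> I j R' \<and> R' 6 = j"
      using runs_Add[of x 5 5 4 R1] *(3) by fastforce
  qed (auto simp: I_def agree_def scratch_def)
  then obtain R1 where R1: "runs x (For 6 (Prim (Add 5 5 4))) ?R (n * (1 + 4) + 3) R1" "I 0 R1"
    by blast
  let ?R1 = "R1(2 := 0, 4 := (R1(2 := 0)) 5 + (R1(2 := 0)) 2)"
  have "runs x Mul R (1 + (n * (1 + 4) + 3 + (1 + 1))) ?R1"
    unfolding Mul_def by (intro runs_Seq[OF runs_SetConst] runs_Seq[OF R1(1)] runs_Add)
  then have "runs x Mul R (n * 5 + 6) ?R1"
    by (rule runs_mono) simp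
  moreover have "agree scratch R ?R1" "?R1 4 = R 4 * n"
    using R1(2) by (simp_all add: I_def agree_def scratch_def)
  ultimately show ?thesis by blast
qed

definition Address :: "nat \<Rightarrow> nat \<Rightarrow> nat \<Rightarrow> nat \<Rightarrow> nat \<Rightarrow> cmd" where
  "Address K k a b c =
     Prim (SetConst 4 k) ;; Mul ;; Prim (Add 4 4 a) ;; Mul ;; Prim (Add 4 4 b) ;; Mul ;;
     Prim (Add 4 4 c) ;; Prim (SetConst 5 K) ;; Prim (Add 4 4 5)"

text \<open>Horner's rule in base \<open>n\<close>. The tag \<open>k\<close> is the leading digit,
  so it may exceed \<open>n\<close>; the offset \<open>K\<close> keeps the table clear of the
  working registers.\<close>

definition cell :: "nat \<Rightarrow> nat \<Rightarrow> nat \<Rightarrow> nat \<Rightarrow> nat \<Rightarrow> nat \<Rightarrow> nat" where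
  "cell K n k a b c = ((k * n + a) * n + b) * n + c + K"

lemma runs_Address:
  assumes R: "R 1 = n" "R 3 = 1" and abc: "a \<notin> scratch" "b \<notin> scratch" "c \<notin> scratch"
  shows "\<exists>R'. runs x (Address K k a b c) R (n * 15 + 24) R' \<and> agree scratch R R' \<and>
    R' 4 = cell K n k (R a) (R b) (R c)"
proof -
  let ?R = "R(4 := k)"
  have ag: "agree scratch R ?R" by (simp add: agree_def scratch_def)
  obtain R1 where R1: "runs x Mul ?R (n * 5 + 6) R1" "agree scratch R R1" "R1 4 = k * n"
    using runs_Mul[of ?R n x] R agree_trans[OF ag] by auto
  let ?R1 = "R1(4 := R1 4 + R1 a)"
  have ag1: "agree scratch R ?R1" using R1(2) by (simp add: agree_def scratch_def)
  have v1: "?R1 4 = k * n + R a" "?R1 1 = n" "?R1 3 = 1"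
    using R1 R abc by (auto simp: agree_def scratch_def)
  obtain R2 where R2: "runs x Mul ?R1 (n * 5 + 6) R2" "agree scratch R R2" "R2 4 = (k * n + R a) * n"
    using runs_Mul[of ?R1 n x] v1 agree_trans[OF ag1] by metis
  let ?R2 = "R2(4 := R2 4 + R2 b)"
  have ag2: "agree scratch R ?R2" using R2(2) by (simp add: agree_def scratch_def)
  have v2: "?R2 4 = (k * n + R a) * n + R b" "?R2 1 = n" "?R2 3 = 1"
    using R2 R abc by (auto simp: agree_def scratch_def)
  obtain R3 where R3: "runs x Mul ?R2 (n * 5 + 6) R3" "agree scratch R R3"
      "R3 4 = ((k * n + R a) * n + R b) * n"
    using runs_Mul[of ?R2 n x] v2 agree_trans[OF ag2] by metis
  let ?R3 = "R3(4 := R3 4 + R3 c)" let ?R4 = "?R3(5 := K)"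
  let ?R5 = "?R4(4 := ?R4 4 + ?R4 5)"
  have "runs x (Address K k a b c) R
      (1 + (n * 5 + 6 + (1 + (n * 5 + 6 + (1 + (n * 5 + 6 + (1 + (1 + 1)))))))) ?R5"
    unfolding Address_def
    by (intro runs_Seq[OF runs_SetConst] runs_Seq[OF R1(1)] runs_Seq[OF R2(1)] runs_Seq[OF R3(1)]
        runs_Seq[OF runs_Add] runs_Add)
  then have "runs x (Address K k a b c) R (n * 15 + 24) ?R5"
    by (rule runs_mono) simp
  moreover have "agree scratch R ?R5" "?R5 4 = cell K n k (R a) (R b) (R c)"
    using R3 abc by (auto simp: agree_def scratch_def cell_def)
  ultimately show ?thesis by blast
qed

section \<open>First-order formulas and their evaluation on the machine\<close>

datatype fm =
    Arc nat nat
  | Eq nat nat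
  | Rel nat nat nat nat
  | Neg fm
  | Conj fm fm
  | Exists nat fm

fun sat :: "nat \<Rightarrow> (nat \<Rightarrow> nat \<Rightarrow> bool) \<Rightarrow> (nat \<times> nat \<times> nat \<times> nat) set \<Rightarrow> fm \<Rightarrow> (nat \<Rightarrow> nat) \<Rightarrow> bool" where
  "sat n A X (Arc i j) e \<longleftrightarrow> A (e i) (e j)"
| "sat n A X (Eq i j) e \<longleftrightarrow> e i = e j"
| "sat n A X (Rel k i j l) e \<longleftrightarrow> (k, e i, e j, e l) \<in> X"
| "sat n A X (Neg f) e \<longleftrightarrow> \<not> sat n A X f e"
| "sat n A X (Conj f g) e \<longleftrightarrow> sat n A X f e \<and> sat n A X g e"
| "sat n A X (Exists i f) e \<longleftrightarrow> (\<exists>a<n. sat n A X f (e(i := a)))"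

fun fv :: "fm \<Rightarrow> nat set" where
  "fv (Arc i j) = {i, j}"
| "fv (Eq i j) = {i, j}"
| "fv (Rel k i j l) = {i, j, l}"
| "fv (Neg f) = fv f"
| "fv (Conj f g) = fv f \<union> fv g"
| "fv (Exists i f) = fv f - {i}"

fun bv :: "fm \<Rightarrow> nat set" where
  "bv (Neg f) = bv f"
| "bv (Conj f g) = bv f \<union> bv g"
| "bv (Exists i f) = insert i (bv f)"
| "bv _ = {}"

text \<open>
  Every variable has a register of its own, so a quantifier must not clobber a variable that is
  still needed.
\<close>

fun wf_fm :: "nat \<Rightarrow> nat \<Rightarrow> fm \<Rightarrow> bool" where
  "wf_fm m W (Arc i j) \<longleftrightarrow> i < W \<and> j < W"
| "wf_fm m W (Eq i j) \<longleftrightarrow> i < W \<and> j < W"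
| "wf_fm m W (Rel k i j l) \<longleftrightarrow> k < m \<and> i < W \<and> j < W \<and> l < W"
| "wf_fm m W (Neg f) \<longleftrightarrow> wf_fm m W f"
| "wf_fm m W (Conj f g) \<longleftrightarrow> wf_fm m W f \<and> wf_fm m W g \<and> bv f \<inter> fv g = {} \<and> fv f \<inter> bv g = {}"
| "wf_fm m W (Exists i f) \<longleftrightarrow> wf_fm m W f \<and> i < W \<and> i \<notin> bv f"

lemma sat_cong: "(\<And>i. i \<in> fv f \<Longrightarrow> e i = e' i) \<Longrightarrow> sat n A X f e \<longleftrightarrow> sat n A X f e'"
proof (induction f arbitrary: e e')
  case (Exists i f)
  have "sat n A X f (e(i := a)) \<longleftrightarrow> sat n A X f (e'(i := a))" for a
    by (rule Exists.IH) (use Exists.prems in auto)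
  then show ?case by simp
next
  case (Conj f g)
  have "sat n A X f e \<longleftrightarrow> sat n A X f e'" "sat n A X g e \<longleftrightarrow> sat n A X g e'"
    by (rule Conj.IH, use Conj.prems in simp)+
  then show ?case by simp
next
  case (Neg f)
  have "sat n A X f e \<longleftrightarrow> sat n A X f e'"
    by (rule Neg.IH) (use Neg.prems in simp)
  then show ?case by simp
qed simp_all

text \<open>From register 10 on, even registers hold variables and odd ones collect the result of
  the quantifier that binds the variable below. The smaller registers are for work and for the outer
  loops.\<close>

definition var_reg :: "nat \<Rightarrow> nat" where "var_reg i = 10 + 2 * i"
definition flag_reg :: "nat \<Rightarrow> nat" where "flag_reg i = 11 + 2 * i"

text \<open>For \<open>Arc\<close>, adding registers 1 and 3 skips the unary vertex count and its
  terminator in the input. Truth is any nonzero value of register 0, so a quantifier may simply add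
  up the results of its \<open>n\<close> instances, and \<open>1 - R 0\<close>, truncated,
  negates.\<close>

fun Eval :: "nat \<Rightarrow> fm \<Rightarrow> cmd" where
  "Eval K (Arc i j) = Prim (SetConst 4 0) ;; Prim (Add 4 4 (var_reg i)) ;; Mul ;;
     Prim (Add 4 4 (var_reg j)) ;; Prim (Add 4 4 1) ;; Prim (Add 4 4 3) ;; Prim (ReadBit 0 4)"
| "Eval K (Eq i j) = Prim (Sub 0 (var_reg i) (var_reg j)) ;; Prim (Sub 4 (var_reg j) (var_reg i)) ;;
     Prim (Add 0 0 4) ;; Prim (Sub 0 3 0)"
| "Eval K (Rel k i j l) = Address K k (var_reg i) (var_reg j) (var_reg l) ;; Prim (Load 0 4)"
| "Eval K (Neg f) = Eval K f ;; Prim (Sub 0 3 0)"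
| "Eval K (Conj f g) = Eval K f ;; When 0 (Eval K g)"
| "Eval K (Exists i f) = Prim (SetConst (flag_reg i) 0) ;;
     For (var_reg i) (Eval K f ;; Prim (Add (flag_reg i) (flag_reg i) 0)) ;;
     Prim (SetConst 2 0) ;; Prim (Add 0 (flag_reg i) 2)"

fun eval_time :: "fm \<Rightarrow> nat \<Rightarrow> nat" where
  "eval_time (Arc i j) n = n * 5 + 12"
| "eval_time (Eq i j) n = 4"
| "eval_time (Rel k i j l) n = n * 15 + 25"
| "eval_time (Neg f) n = eval_time f n + 1"
| "eval_time (Conj f g) n = eval_time f n + (eval_time g n + 1)"
| "eval_time (Exists i f) n = n * (eval_time f n + 5) + 6"

definition stored :: "nat \<Rightarrow> nat \<Rightarrow> nat \<Rightarrow> (nat \<Rightarrow> nat) \<Rightarrow> (nat \<times> nat \<times> nat \<times> nat) set" where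
  "stored K m n R = {(k, a, b, c). k < m \<and> a < n \<and> b < n \<and> c < n \<and> R (cell K n k a b c) \<noteq> 0}"

definition touched :: "fm \<Rightarrow> nat set" where
  "touched f = scratch \<union> var_reg ` bv f \<union> flag_reg ` bv f"

lemma bv_less: "wf_fm m W f \<Longrightarrow> i \<in> bv f \<Longrightarrow> i < W"
  by (induction f) auto

lemma fv_inter_bv: "wf_fm m W f \<Longrightarrow> fv f \<inter> bv f = {}"
  by (induction f) auto

lemma var_reg_notin: "var_reg i \<notin> scratch" "var_reg i \<noteq> 1" "var_reg i \<noteq> 3"
    "flag_reg i \<notin> scratch" "flag_reg i \<noteq> 1" "flag_reg i \<noteq> 3"
    "var_reg i \<noteq> flag_reg j" "flag_reg j \<noteq> var_reg i"
    "var_reg i = var_reg j \<longleftrightarrow> i = j" "flag_reg i = flag_reg j \<longleftrightarrow> i = j"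
    "var_reg i \<noteq> 2" "flag_reg i \<noteq> 2" "var_reg i \<noteq> 0" "flag_reg i \<noteq> 0"
    "var_reg i \<noteq> 4" "flag_reg i \<noteq> 4" "var_reg i \<noteq> Suc 0" "flag_reg i \<noteq> Suc 0"
  unfolding var_reg_def flag_reg_def scratch_def by (simp_all; presburger)+

lemma touched_simps: "1 \<notin> touched f" "3 \<notin> touched f" "Suc 0 \<notin> touched f"
   "var_reg i \<in> touched f \<longleftrightarrow> i \<in> bv f" "flag_reg i \<in> touched f \<longleftrightarrow> i \<in> bv f"
  "0 \<in> touched f" "2 \<in> touched f" "4 \<in> touched f"
  by (auto simp: touched_def scratch_def var_reg_def flag_reg_def) presburger+

lemma touched_less:
  assumes "wf_fm m W f" "q \<in> touched f"
  shows "q < 10 + 2 * W"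
proof -
  have "10 + 2 * i < 10 + 2 * W \<and> 11 + 2 * i < 10 + 2 * W" if "i \<in> bv f" for i
    using bv_less[OF assms(1) that] by simp
  then show ?thesis using assms(2)
    by (auto simp only: touched_def scratch_def var_reg_def flag_reg_def)
qed

lemma stored_agree:
  assumes "agree S R R'" "\<And>q. q \<in> S \<Longrightarrow> q < K"
  shows "stored K m n R' = stored K m n R"
proof -
  have "cell K n k a b c \<notin> S" for k a b c using assms(2)[of "cell K n k a b c"] by (auto simp: cell_def)
  then show ?thesis using assms(1) by (auto simp: stored_def agree_def)
qed

text \<open>Evaluation writes only registers below \<open>K\<close>, so the stored relation stays
  the same throughout. The disjointness conditions of \<open>wf_fm\<close> keep the free variables
  alive across the first half of a conjunction and across the rounds of a quantifier.\<close>

lemma runs_Eval: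
  assumes bits: "\<And>a b. a < n \<Longrightarrow> b < n \<Longrightarrow>
      n + 1 + (a * n + b) < length x \<and> (x ! (n + 1 + (a * n + b)) \<longleftrightarrow> A a b)"
    and K: "K = 10 + 2 * W"
  shows "wf_fm m W f \<Longrightarrow> R 1 = n \<Longrightarrow> R 3 = 1 \<Longrightarrow> (\<And>i. i \<in> fv f \<Longrightarrow> R (var_reg i) < n) \<Longrightarrow>
    \<exists>R'. runs x (Eval K f) R (eval_time f n) R' \<and> agree (touched f) R R' \<and>
      (R' 0 \<noteq> 0 \<longleftrightarrow> sat n A (stored K m n R) f (\<lambda>i. R (var_reg i)))"
proof (induction f arbitrary: R)
  case (Arc i j)
  let ?R0 = "R(4 := 0)" let ?R = "?R0(4 := ?R0 4 + ?R0 (var_reg i))"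
  have v: "?R 4 = R (var_reg i)" by (simp add: var_reg_notin)
  obtain R1 where R1: "runs x Mul ?R (n * 5 + 6) R1" "agree scratch ?R R1" "R1 4 = R (var_reg i) * n"
    using runs_Mul[of ?R n x] Arc.prems v by auto
  let ?R2 = "R1(4 := R1 4 + R1 (var_reg j))" let ?R3 = "?R2(4 := ?R2 4 + ?R2 1)"
  let ?R4 = "?R3(4 := ?R3 4 + ?R3 3)"
  let ?R5 = "?R4(0 := (if ?R4 4 < length x \<and> x ! ?R4 4 then 1 else 0))"
  have "runs x (Eval K (Arc i j)) R (1 + (1 + (n * 5 + 6 + (1 + (1 + (1 + 1)))))) ?R5"
    unfolding Eval.simps
    by (intro runs_Seq[OF runs_SetConst] runs_Seq[OF R1(1)] runs_Seq[OF runs_Add] runs_ReadBit)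
  then have "runs x (Eval K (Arc i j)) R (eval_time (Arc i j) n) ?R5"
    by (rule runs_mono) simp
  moreover have ag: "agree scratch R R1"
    using R1(2) by (simp add: agree_def scratch_def)
  have r: "R1 (var_reg j) = R (var_reg j)" "R1 1 = n" "R1 3 = 1"
    using ag Arc.prems var_reg_notin(1)[of j] by (auto simp: agree_def scratch_def)
  have a: "?R4 4 = n + 1 + (R (var_reg i) * n + R (var_reg j))"
    using R1(3) r by simp
  have "?R5 0 \<noteq> 0 \<longleftrightarrow> A (R (var_reg i)) (R (var_reg j))"
    using bits[of "R (var_reg i)" "R (var_reg j)"] Arc.prems(4) unfolding a by simp
  moreover have "agree (touched (Arc i j)) R ?R5"
    using ag by (auto simp: agree_def touched_def scratch_def)
  ultimately show ?case unfolding sat.simps by blast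
next
  case (Eq i j)
  let ?i = "R (var_reg i)" and ?j = "R (var_reg j)"
  let ?R0 = "R(0 := ?i - ?j)" let ?R1 = "?R0(4 := ?R0 (var_reg j) - ?R0 (var_reg i))"
  let ?R2 = "?R1(0 := ?R1 0 + ?R1 4)" let ?R3 = "?R2(0 := ?R2 3 - ?R2 0)"
  have "runs x (Eval K (Eq i j)) R (1 + (1 + (1 + 1))) ?R3"
    unfolding Eval.simps by (intro runs_Seq[OF runs_Sub] runs_Seq[OF runs_Add] runs_Sub)
  then have "runs x (Eval K (Eq i j)) R (eval_time (Eq i j) n) ?R3"
    by (rule runs_mono) simp
  moreover have "agree (touched (Eq i j)) R ?R3"
    by (auto simp: agree_def touched_def scratch_def)
  moreover have "?R3 0 \<noteq> 0 \<longleftrightarrow> ?i = ?j"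
    using Eq.prems(3) by (auto simp: var_reg_notin)
  ultimately show ?case unfolding sat.simps by blast
next
  case (Rel k i j l)
  obtain R1 where R1: "runs x (Address K k (var_reg i) (var_reg j) (var_reg l)) R (n * 15 + 24) R1"
      "agree scratch R R1" "R1 4 = cell K n k (R (var_reg i)) (R (var_reg j)) (R (var_reg l))"
    using runs_Address[of R n "var_reg i" "var_reg j" "var_reg l" x K k] Rel.prems var_reg_notin(1)
    by blast
  let ?R2 = "R1(0 := R1 (R1 4))"
  have "runs x (Eval K (Rel k i j l)) R (n * 15 + 24 + 1) ?R2"
    unfolding Eval.simps by (intro runs_Seq[OF R1(1)] runs_Load)
  then have "runs x (Eval K (Rel k i j l)) R (eval_time (Rel k i j l) n) ?R2"
    by (rule runs_mono) simp
  moreover have "agree (touched (Rel k i j l)) R ?R2"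
    using R1(2) by (auto simp: agree_def touched_def scratch_def)
  moreover have "R1 (R1 4) = R (R1 4)"
    using R1(2,3) K by (auto simp: agree_def scratch_def cell_def)
  then have "?R2 0 \<noteq> 0 \<longleftrightarrow> (k, R (var_reg i), R (var_reg j), R (var_reg l)) \<in> stored K m n R"
    using Rel.prems R1(3) by (simp add: stored_def)
  ultimately show ?case unfolding sat.simps by blast
next
  case (Neg f)
  obtain R1 where R1: "runs x (Eval K f) R (eval_time f n) R1" "agree (touched f) R R1"
      "R1 0 \<noteq> 0 \<longleftrightarrow> sat n A (stored K m n R) f (\<lambda>i. R (var_reg i))"
    using Neg.IH[of R] Neg.prems by auto
  let ?R = "R1(0 := R1 3 - R1 0)"
  have "runs x (Eval K (Neg f)) R (eval_time (Neg f) n) ?R"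
    unfolding Eval.simps eval_time.simps by (rule runs_Seq[OF R1(1) runs_Sub])
  moreover have "agree (touched (Neg f)) R ?R"
    using agree_upd[OF R1(2) touched_simps(6)] by (simp add: touched_def)
  moreover have "R1 3 = 1"
    using R1(2) touched_simps(2) Neg.prems by (auto simp: agree_def)
  then have "?R 0 \<noteq> 0 \<longleftrightarrow> \<not> sat n A (stored K m n R) f (\<lambda>i. R (var_reg i))"
    using R1(3) by auto
  ultimately show ?case unfolding sat.simps by blast
next
  case (Conj f g)
  let ?e = "\<lambda>i. R (var_reg i)"
  obtain R1 where R1: "runs x (Eval K f) R (eval_time f n) R1" "agree (touched f) R R1"
      "R1 0 \<noteq> 0 \<longleftrightarrow> sat n A (stored K m n R) f ?e"
    using Conj.IH(1)[of R] Conj.prems by auto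
  have st: "stored K m n R1 = stored K m n R"
    by (rule stored_agree[OF R1(2)]) (use touched_less[of m W f] Conj.prems K in auto)
  have sub: "touched f \<subseteq> touched (Conj f g)" "touched g \<subseteq> touched (Conj f g)"
    by (auto simp: touched_def)
  have r: "R1 (var_reg i) = R (var_reg i)" if "i \<in> fv g" for i
    using R1(2) that Conj.prems(1) touched_simps(4)[of i f] by (auto simp: agree_def)
  show ?case
  proof (cases "R1 0 = 0")
    case True
    have "runs x (Eval K (Conj f g)) R (eval_time f n + Suc (eval_time g n)) R1"
      unfolding Eval.simps by (rule runs_Seq[OF R1(1) runs_When_zero[of R1 0, OF True]])
    then show ?thesis using R1 True agree_mono[OF R1(2) sub(1)] by auto
  next
    case False
    have "R1 1 = n" "R1 3 = 1"
      using R1(2) Conj.prems touched_simps by (auto simp: agree_def)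
    then obtain R2 where R2: "runs x (Eval K g) R1 (eval_time g n) R2" "agree (touched g) R1 R2"
      "R2 0 \<noteq> 0 \<longleftrightarrow> sat n A (stored K m n R1) g (\<lambda>i. R1 (var_reg i))"
      using Conj.IH(2)[of R1] Conj.prems r by auto
    have "sat n A (stored K m n R1) g (\<lambda>i. R1 (var_reg i)) \<longleftrightarrow> sat n A (stored K m n R) g ?e"
      unfolding st by (rule sat_cong) (use r in simp)
    moreover have "runs x (Eval K (Conj f g)) R (eval_time f n + Suc (eval_time g n)) R2"
      unfolding Eval.simps by (rule runs_Seq[OF R1(1) runs_When_pos[OF False R2(1)]])
    ultimately show ?thesis
      using R1 R2 False agree_trans[OF agree_mono[OF R1(2) sub(1)] agree_mono[OF R2(2) sub(2)]]
      by (intro exI[of _ R2]) simp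
  qed
next
  case (Exists i f)
  let ?e = "\<lambda>i. R (var_reg i)" and ?X = "stored K m n R" and ?S = "touched (Exists i f)"
  let ?R = "R(flag_reg i := 0)"
  have sub: "touched f \<subseteq> ?S" by (auto simp: touched_def)
  have less: "q < K" if "q \<in> ?S" for q using touched_less[OF Exists.prems(1) that] K by simp
  define I where "I j R' \<longleftrightarrow> agree ?S R R' \<and>
    (R' (flag_reg i) \<noteq> 0 \<longleftrightarrow> (\<exists>a<n. j \<le> a \<and> sat n A ?X f (?e(i := a))))" for j R'
  have base: "R' 1 = n \<and> R' 3 = 1" if "agree ?S R R'" for R'
    using that Exists.prems touched_simps by (auto simp: agree_def)
  have "\<exists>R'. runs x (For (var_reg i) (Eval K f ;; Prim (Add (flag_reg i) (flag_reg i) 0))) ?R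
      (n * (eval_time f n + 1 + 4) + 3) R' \<and> I 0 R'"
  proof (rule runs_For[where n = n])
    show "R' 1 = n \<and> R' 3 = 1" if "I j R'" for j R' using that base by (simp add: I_def)
    show "I j R''" if "I j R'" "\<forall>q. q \<noteq> var_reg i \<longrightarrow> q \<noteq> 2 \<longrightarrow> R'' q = R' q" for j R' R''
    proof -
      have "R'' q = R q" if "q \<notin> ?S" for q
        using that \<open>I j R'\<close> \<open>\<forall>q. q \<noteq> var_reg i \<longrightarrow> q \<noteq> 2 \<longrightarrow> R'' q = R' q\<close>
          touched_simps(4)[of i "Exists i f"] touched_simps(7)[of "Exists i f"]
        unfolding I_def agree_def by (metis bv.simps(3) insertI1)
      then show ?thesis using that by (simp add: I_def agree_def var_reg_notin)
    qed
    show "var_reg i \<notin> {1, 2, 3}" by (simp add: var_reg_notin)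
    show "I n ?R" by (auto simp: I_def agree_def touched_simps)
  next
    fix j R1 assume *: "j < n" "I (Suc j) R1" "R1 (var_reg i) = j"
    have ag1: "agree ?S R R1" using * by (simp add: I_def)
    have st: "stored K m n R1 = ?X" by (rule stored_agree[OF ag1 less])
    have r: "R1 (var_reg l) = (?e(i := j)) l" if "l \<in> fv f" for l
    proof (cases "l = i")
      case False
      then show ?thesis using ag1 that Exists.prems touched_simps(4)[of l "Exists i f"]
        fv_inter_bv[of m W f] by (auto simp: agree_def)
    qed (use * in simp)
    have "\<And>l. l \<in> fv f \<Longrightarrow> R1 (var_reg l) < n"
      using r Exists.prems(4) *(1) by auto
    then obtain R2 where R2: "runs x (Eval K f) R1 (eval_time f n) R2" "agree (touched f) R1 R2"
      "R2 0 \<noteq> 0 \<longleftrightarrow> sat n A (stored K m n R1) f (\<lambda>i. R1 (var_reg i))"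
      using Exists.IH[of R1] Exists.prems base[OF ag1] by auto
    have sat: "sat n A (stored K m n R1) f (\<lambda>i. R1 (var_reg i)) \<longleftrightarrow> sat n A ?X f (?e(i := j))"
      unfolding st by (rule sat_cong) (use r in simp)
    let ?R3 = "R2(flag_reg i := R2 (flag_reg i) + R2 0)"
    have nb: "i \<notin> bv f" using Exists.prems by simp
    have f: "R2 (flag_reg i) = R1 (flag_reg i)" "R2 (var_reg i) = R1 (var_reg i)"
      using R2(2) nb touched_simps(4,5)[of i f] by (auto simp: agree_def)
    have ag3: "agree ?S R ?R3"
      by (rule agree_upd[OF agree_trans[OF ag1 agree_mono[OF R2(2) sub]]]) (simp add: touched_simps)
    have ex: "(\<exists>a<n. j \<le> a \<and> P a) \<longleftrightarrow> (\<exists>a<n. Suc j \<le> a \<and> P a) \<or> P j" for P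
      using *(1) by (metis Suc_leD le_antisym not_less_eq_eq order_refl)
    have "I j ?R3"
      unfolding I_def ex using ag3 f R2(3) sat *(2) by (simp add: I_def)
    moreover have "runs x (Eval K f ;; Prim (Add (flag_reg i) (flag_reg i) 0)) R1 (eval_time f n + 1) ?R3"
      by (rule runs_Seq[OF R2(1) runs_Add])
    ultimately show "\<exists>R'. runs x (Eval K f ;; Prim (Add (flag_reg i) (flag_reg i) 0)) R1
        (eval_time f n + 1) R' \<and> I j R' \<and> R' (var_reg i) = j"
      using f *(3) by (intro exI[of _ ?R3]) (simp add: var_reg_notin)
  qed
  then obtain R1 where R1: "runs x (For (var_reg i) (Eval K f ;; Prim (Add (flag_reg i) (flag_reg i) 0))) ?R
      (n * (eval_time f n + 1 + 4) + 3) R1" "I 0 R1" by blast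
  let ?R2 = "R1(2 := 0)" let ?R3 = "?R2(0 := ?R2 (flag_reg i) + ?R2 2)"
  have "runs x (Eval K (Exists i f)) R (1 + (n * (eval_time f n + 1 + 4) + 3 + (1 + 1))) ?R3"
    unfolding Eval.simps by (intro runs_Seq[OF runs_SetConst] runs_Seq[OF R1(1)] runs_Add)
  then have "runs x (Eval K (Exists i f)) R (eval_time (Exists i f) n) ?R3"
    by (rule runs_mono) simp
  moreover have "agree ?S R ?R3"
    using R1(2) by (auto simp: I_def intro!: agree_upd simp: touched_simps)
  moreover have "?R3 0 \<noteq> 0 \<longleftrightarrow> sat n A ?X (Exists i f) ?e"
    using R1(2) by (simp add: I_def var_reg_notin)
  ultimately show ?case by (intro exI[of _ ?R3]) blast
qed

section \<open>Inflationary iteration of first-order rules\<close>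

definition tuples :: "nat \<Rightarrow> nat \<Rightarrow> (nat \<times> nat \<times> nat \<times> nat) set" where
  "tuples m n = {..<m} \<times> {..<n} \<times> {..<n} \<times> {..<n}"

definition holds :: "nat \<Rightarrow> (nat \<Rightarrow> nat \<Rightarrow> bool) \<Rightarrow> fm list \<Rightarrow> (nat \<times> nat \<times> nat \<times> nat) set \<Rightarrow>
    nat \<times> nat \<times> nat \<times> nat \<Rightarrow> bool" where
  "holds n A fs X = (\<lambda>(k, a, b, c). sat n A X (fs ! k) ((\<lambda>_. 0)(0 := a, 1 := b, 2 := c)))"

text \<open>The machine tests formulas on the relation that it is extending, so a pass is a sequence
  of single insertions and not one simultaneous application of all rules.\<close>

inductive update for n A fs where
  "u \<in> tuples (length fs) n \<Longrightarrow> holds n A fs X u \<Longrightarrow> update n A fs X (insert u X)"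

definition closed_under :: "nat \<Rightarrow> (nat \<Rightarrow> nat \<Rightarrow> bool) \<Rightarrow> fm list \<Rightarrow> (nat \<times> nat \<times> nat \<times> nat) set \<Rightarrow> bool" where
  "closed_under n A fs X \<longleftrightarrow> (\<forall>u \<in> tuples (length fs) n. holds n A fs X u \<longrightarrow> u \<in> X)"

lemma update_mono: "(update n A fs)\<^sup>*\<^sup>* X Y \<Longrightarrow> X \<subseteq> Y"
  by (induction rule: rtranclp_induct) (auto elim: update.cases)

lemma update_closed: "(update n A fs)\<^sup>*\<^sup>* X Y \<Longrightarrow> closed_under n A fs X \<Longrightarrow> Y = X"
  by (induction rule: rtranclp_induct) (auto elim!: update.cases simp: closed_under_def)

text \<open>Quantifying over all \<open>Z\<close> below \<open>P\<close> merges monotonicity with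
  closedness: for monotone rules the hypothesis just says that \<open>P\<close> is closed.\<close>

lemma update_sound:
  assumes "(update n A fs)\<^sup>*\<^sup>* X Y" "X \<subseteq> P"
    "\<And>Z u. Z \<subseteq> P \<Longrightarrow> u \<in> tuples (length fs) n \<Longrightarrow> holds n A fs Z u \<Longrightarrow> u \<in> P"
  shows "Y \<subseteq> P"
  using assms by (induction rule: rtranclp_induct) (auto elim!: update.cases)

lemma finite_tuples: "finite (tuples m n)" and card_tuples: "card (tuples m n) = m * n ^ 3"
  by (simp_all add: tuples_def card_cartesian_product power3_eq_cube)

lemma stored_subset: "stored K m n R \<subseteq> tuples m n"
  by (auto simp: stored_def tuples_def)

lemma cell_inj:
  assumes "cell K n k a b c = cell K n k' a' b' c'"
    "a < n" "b < n" "c < n" "a' < n" "b' < n" "c' < n"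
  shows "k = k' \<and> a = a' \<and> b = b' \<and> c = c'"
proof -
  have dm: "p = q \<and> r = s" if "p * n + r = q * n + s" "r < n" "s < n" for p q r s
    using that by (metis div_mult_self3 mod_mult_self3 div_less mod_less less_nat_zero_code add_0 add.right_neutral)
  show ?thesis using assms dm unfolding cell_def by (metis add_right_cancel)
qed

section \<open>Programs that iterate to a closed relation\<close>

definition Mark :: "nat \<Rightarrow> nat \<Rightarrow> fm \<Rightarrow> cmd" where
  "Mark K k f = Eval K f ;;
     When 0 (Address K k (var_reg 0) (var_reg 1) (var_reg 2) ;; Prim (Store 4 3))"


lemma stored_insert:
  assumes "k < m" "a < n" "b < n" "c < n"
  shows "stored K m n (R(cell K n k a b c := 1)) = insert (k, a, b, c) (stored K m n R)"
proof -
  have "cell K n k' a' b' c' = cell K n k a b c \<longleftrightarrow> (k', a', b', c') = (k, a, b, c)"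
    if "a' < n" "b' < n" "c' < n" for k' a' b' c'
    using cell_inj[of K n k' a' b' c' k a b c] that assms by auto
  then show ?thesis using assms by (auto simp: stored_def)
qed

fun For3 :: "nat \<Rightarrow> nat \<Rightarrow> nat \<Rightarrow> cmd \<Rightarrow> cmd" where
  "For3 p q r c = For p (For q (For r c))"

definition for_time :: "nat \<Rightarrow> nat \<Rightarrow> nat" where
  "for_time n T = n * (T + 4) + 3"

fun Stages :: "nat \<Rightarrow> nat \<Rightarrow> fm list \<Rightarrow> cmd" where
  "Stages K k [] = Prim (SetConst 2 0)"
| "Stages K k (f # fs) = For3 (var_reg 0) (var_reg 1) (var_reg 2) (Mark K k f) ;; Stages K (Suc k) fs"

fun Repeat :: "nat \<Rightarrow> cmd \<Rightarrow> cmd" where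
  "Repeat 0 c = Prim (SetConst 2 0)"
| "Repeat (Suc k) c = c ;; Repeat k c"

fun stages_time :: "nat \<Rightarrow> fm list \<Rightarrow> nat" where
  "stages_time n [] = 1"
| "stages_time n (f # fs) =
     for_time n (for_time n (for_time n (eval_time f n + (n * 15 + 26)))) + stages_time n fs"

locale fixpoint_machine =
  fixes x :: "bool list" and n :: nat and A :: "nat \<Rightarrow> nat \<Rightarrow> bool" and fs :: "fm list"
    and W :: nat and K :: nat
  assumes bits: "\<And>a b. a < n \<Longrightarrow> b < n \<Longrightarrow>
      n + 1 + (a * n + b) < length x \<and> (x ! (n + 1 + (a * n + b)) \<longleftrightarrow> A a b)"
    and K: "K = 10 + 2 * W" and W: "3 \<le> W"
    and wf: "\<And>f. f \<in> set fs \<Longrightarrow> wf_fm (length fs) W f \<and> fv f \<subseteq> {0, 1, 2} \<and> bv f \<inter> {0, 1, 2} = {}"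
begin

abbreviation "m \<equiv> length fs"
abbreviation "X \<equiv> stored K m n"
abbreviation "updates \<equiv> (update n A fs)\<^sup>*\<^sup>*"

text \<open>If the relation is the same at the end, every tuple of \<open>B R\<close> has been
  tested against this one relation, so the pass certifies closure on \<open>B R\<close>. The
  registers in \<open>P\<close> are preserved, those in \<open>V\<close> hold vertices.\<close>

definition passes :: "nat set \<Rightarrow> nat set \<Rightarrow> cmd \<Rightarrow> nat \<Rightarrow> ((nat \<Rightarrow> nat) \<Rightarrow> (nat \<times> nat \<times> nat \<times> nat) set) \<Rightarrow> bool" where
  "passes P V c T B \<longleftrightarrow> (\<forall>R. R 1 = n \<longrightarrow> R 3 = 1 \<longrightarrow> (\<forall>r\<in>V. R r < n) \<longrightarrow>
     (\<exists>R'. runs x c R T R' \<and> (\<forall>q\<in>P. R' q = R q) \<and> updates (X R) (X R') \<and>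
       (X R' = X R \<longrightarrow> (\<forall>u\<in>B R. holds n A fs (X R) u \<longrightarrow> u \<in> X R))))"

text \<open>Updates only add tuples, so equality of the first and the last relation means that no
  round changed it, and the certificates of all rounds speak of the same relation.\<close>

lemma passes_For:
  assumes c: "passes P V c T B" and r: "r \<in> P" "r \<notin> {1, 2, 3}" "r < K" and P: "1 \<in> P" "3 \<in> P" "2 \<notin> P"
    and V: "V \<subseteq> P" and B: "\<And>R R'. (\<And>q. q \<in> V \<Longrightarrow> R q = R' q) \<Longrightarrow> B R = B R'"
  shows "passes (P - {r}) (V - {r}) (For r c) (for_time n T) (\<lambda>R. \<Union>j<n. B (R(r := j)))"
  unfolding passes_def for_time_def
proof (intro allI impI)
  fix R :: "nat \<Rightarrow> nat" assume R: "R 1 = n" "R 3 = 1" "\<forall>q\<in>V - {r}. R q < n"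
  define I where "I j R' \<longleftrightarrow> (\<forall>q\<in>P - {r}. R' q = R q) \<and> updates (X R) (X R') \<and>
    (X R' = X R \<longrightarrow> (\<forall>i<n. j \<le> i \<longrightarrow> (\<forall>u\<in>B (R(r := i)). holds n A fs (X R) u \<longrightarrow> u \<in> X R)))" for j R'
  have "\<exists>R'. runs x (For r c) R (n * (T + 4) + 3) R' \<and> I 0 R'"
  proof (rule runs_For[where n = n])
    show "R' 1 = n \<and> R' 3 = 1" if "I j R'" for j R'
      using that P R r by (auto simp: I_def)
    show "I j R''" if *: "I j R'" "\<forall>q. q \<noteq> r \<longrightarrow> q \<noteq> 2 \<longrightarrow> R'' q = R' q" for j R' R''
    proof -
      have "X R'' = X R'"
        by (rule stored_agree[of "{r, 2}"]) (use * r K in \<open>auto simp: agree_def\<close>)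
      moreover have "R'' q = R q" if "q \<in> P - {r}" for q
        using * that P by (auto simp: I_def)
      ultimately show ?thesis using *(1) by (simp add: I_def)
    qed
    show "r \<notin> {1, 2, 3}" by fact
    show "I n R" by (simp add: I_def)
  next
    fix j R1 assume *: "j < n" "I (Suc j) R1" "R1 r = j"
    have 1: "R1 1 = n" "R1 3 = 1" using * P R r by (auto simp: I_def)
    have 2: "\<forall>q\<in>V. R1 q < n"
      using * R V by (metis Diff_iff I_def in_mono singletonD)
    obtain R2 where R2: "runs x c R1 T R2" "\<forall>q\<in>P. R2 q = R1 q" "updates (X R1) (X R2)"
       "X R2 = X R1 \<longrightarrow> (\<forall>u\<in>B R1. holds n A fs (X R1) u \<longrightarrow> u \<in> X R1)"
      using c 1 2 unfolding passes_def by blast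
    have eq: "B R1 = B (R(r := j))"
      by (rule B) (use * V in \<open>auto simp: I_def\<close>)
    have up: "updates (X R) (X R1)" using * by (simp add: I_def)
    have "\<forall>i<n. j \<le> i \<longrightarrow> (\<forall>u\<in>B (R(r := i)). holds n A fs (X R) u \<longrightarrow> u \<in> X R)" if "X R2 = X R"
    proof -
      have "X R1 = X R" using that update_mono[OF up] update_mono[OF R2(3)] by auto
      then have a: "\<forall>i<n. Suc j \<le> i \<longrightarrow> (\<forall>u\<in>B (R(r := i)). holds n A fs (X R) u \<longrightarrow> u \<in> X R)"
        and b: "\<forall>u\<in>B (R(r := j)). holds n A fs (X R) u \<longrightarrow> u \<in> X R"
        using * R2(4) that eq by (auto simp: I_def)
      show ?thesis
      proof (intro allI impI)
        fix i assume "i < n" "j \<le> i"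
        then show "\<forall>u\<in>B (R(r := i)). holds n A fs (X R) u \<longrightarrow> u \<in> X R"
          using a b by (cases "i = j") auto
      qed
    qed
    moreover have "updates (X R) (X R2)"
      using *(2) R2(3) unfolding I_def by (blast intro: rtranclp_trans)
    moreover have "\<forall>q\<in>P - {r}. R2 q = R q"
      using *(2) R2(2) by (simp add: I_def)
    ultimately have "I j R2" unfolding I_def by blast
    then show "\<exists>R'. runs x c R1 T R' \<and> I j R' \<and> R' r = j"
      using R2 r *(3) by auto
  qed
  then show "\<exists>R'. runs x (For r c) R (n * (T + 4) + 3) R' \<and> (\<forall>q\<in>P - {r}. R' q = R q) \<and>
      updates (X R) (X R') \<and>
      (X R' = X R \<longrightarrow> (\<forall>u\<in>\<Union>j<n. B (R(r := j)). holds n A fs (X R) u \<longrightarrow> u \<in> X R))"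
    unfolding I_def by (elim exE conjE, intro exI conjI) auto
qed

lemma passes_Mark:
  assumes k: "k < m"
  shows "passes {1, 3, 7, 8, 9, var_reg 0, var_reg 1, var_reg 2} {var_reg 0, var_reg 1, var_reg 2}
    (Mark K k (fs ! k)) (eval_time (fs ! k) n + (n * 15 + 26))
    (\<lambda>R. {(k, R (var_reg 0), R (var_reg 1), R (var_reg 2))})" (is "passes ?P ?V _ _ _")
  unfolding passes_def
proof (intro allI impI)
  fix R :: "nat \<Rightarrow> nat" assume R: "R 1 = n" "R 3 = 1" "\<forall>q\<in>?V. R q < n"
  let ?f = "fs ! k" let ?u = "(k, R (var_reg 0), R (var_reg 1), R (var_reg 2))"
  let ?Q = "\<lambda>R'. runs x (Mark K k ?f) R (eval_time ?f n + (n * 15 + 26)) R' \<and>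
      (\<forall>q\<in>?P. R' q = R q) \<and> updates (X R) (X R') \<and>
      (X R' = X R \<longrightarrow> (\<forall>u\<in>{?u}. holds n A fs (X R) u \<longrightarrow> u \<in> X R))"
  have f: "wf_fm m W ?f" "fv ?f \<subseteq> {0, 1, 2}" "bv ?f \<inter> {0, 1, 2} = {}" using wf k by auto
  have "\<And>i. i \<in> fv ?f \<Longrightarrow> R (var_reg i) < n"
    using f(2) R(3) by fastforce
  then obtain R1 where R1: "runs x (Eval K ?f) R (eval_time ?f n) R1" "agree (touched ?f) R R1"
      "R1 0 \<noteq> 0 \<longleftrightarrow> sat n A (X R) ?f (\<lambda>i. R (var_reg i))"
    using runs_Eval[OF bits K f(1) R(1,2)] by blast
  have "sat n A (X R) ?f (\<lambda>i. R (var_reg i)) \<longleftrightarrow>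
      sat n A (X R) ?f ((\<lambda>_. 0)(0 := R (var_reg 0), 1 := R (var_reg 1), 2 := R (var_reg 2)))"
    by (rule sat_cong) (use f(2) in fastforce)
  then have sat: "R1 0 \<noteq> 0 \<longleftrightarrow> holds n A fs (X R) ?u"
    using R1(3) by (simp add: holds_def)
  have st: "X R1 = X R"
    by (rule stored_agree[OF R1(2)]) (use touched_less[OF f(1)] K in simp)
  have np: "q \<notin> touched ?f \<and> q \<notin> scratch" if "q \<in> ?P" for q
  proof -
    have "q \<in> {7, 8, 9} \<Longrightarrow> q \<notin> touched ?f"
      by (auto simp: touched_def scratch_def var_reg_def flag_reg_def)
    moreover have "q \<in> {var_reg 0, var_reg 1, var_reg 2} \<Longrightarrow> q \<notin> touched ?f"
      using f(3) by (auto simp: touched_simps)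
    moreover have "q \<in> {1, 3} \<Longrightarrow> q \<notin> touched ?f"
      using touched_simps(1,2)[of ?f] by blast
    ultimately have "q \<notin> touched ?f" using that by blast
    then show ?thesis by (simp add: touched_def)
  qed
  have pr: "R1 q = R q" if "q \<in> ?P" for q
    using R1(2) np[OF that] by (auto simp: agree_def)
  show "\<exists>R'. ?Q R'"
  proof (cases "R1 0 = 0")
    case True
    have "runs x (Mark K k ?f) R (eval_time ?f n + Suc (n * 15 + 25)) R1"
      unfolding Mark_def by (rule runs_Seq[OF R1(1) runs_When_zero[of R1 0, OF True]])
    then have "runs x (Mark K k ?f) R (eval_time ?f n + (n * 15 + 26)) R1"
      by (rule runs_mono) simp
    then have "?Q R1" using st pr sat True by simp
    then show ?thesis by blast
  next
    case False
    let ?c = "cell K n k (R (var_reg 0)) (R (var_reg 1)) (R (var_reg 2))"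
    obtain R2 where R2: "runs x (Address K k (var_reg 0) (var_reg 1) (var_reg 2)) R1 (n * 15 + 24) R2"
      "agree scratch R1 R2" "R2 4 = ?c"
      using runs_Address[of R1 n "var_reg 0" "var_reg 1" "var_reg 2" x K k] var_reg_notin(1) pr R
      by auto
    let ?R3 = "R2(R2 4 := R2 3)"
    have "runs x (Mark K k ?f) R (eval_time ?f n + Suc (n * 15 + 24 + 1)) ?R3"
      unfolding Mark_def
      by (rule runs_Seq[OF R1(1) runs_When_pos[of R1 0, OF False runs_Seq[OF R2(1) runs_Store]]])
    then have "runs x (Mark K k ?f) R (eval_time ?f n + (n * 15 + 26)) ?R3"
      by (rule runs_mono) simp
    moreover have r2: "R2 q = R q" if "q \<in> ?P" for q
      using R2(2) np[OF that] pr[OF that] by (auto simp: agree_def)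
    \<comment> \<open>The store goes to a computed address, which is at least \<open>K\<close> and
      hence misses all preserved registers.\<close>
    moreover have "q \<noteq> ?c" if "q \<in> ?P" for q
    proof -
      have "q < K" using that K W by (auto simp: var_reg_def)
      then show ?thesis by (simp add: cell_def)
    qed
    moreover have "X ?R3 = insert ?u (X R)"
    proof -
      have "X R2 = X R1"
        by (rule stored_agree[OF R2(2)]) (use K in \<open>auto simp: scratch_def\<close>)
      moreover have "R2 3 = 1" using r2[of 3] R by simp
      ultimately show ?thesis
        using stored_insert[of k m "R (var_reg 0)" n "R (var_reg 1)" "R (var_reg 2)" K R2] R(3) k st R2(3)
        by simp
    qed
    moreover have "update n A fs (X R) (insert ?u (X R))"
      by (rule update.intros) (use sat False R(3) k in \<open>auto simp: tuples_def\<close>)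
    ultimately have "?Q ?R3" using R2(3) by auto
    then show ?thesis by blast
  qed
qed

lemma passes_Seq:
  assumes c: "passes P {} c S B" and d: "passes P {} d T B'" and P: "1 \<in> P" "3 \<in> P"
    and B: "\<And>R R'. B' R = B' R'"
  shows "passes P {} (c ;; d) (S + T) (\<lambda>R. B R \<union> B' R)"
  unfolding passes_def
proof (intro allI impI)
  fix R :: "nat \<Rightarrow> nat" assume R: "R 1 = n" "R 3 = 1"
  obtain R1 where R1: "runs x c R S R1" "\<forall>q\<in>P. R1 q = R q" "updates (X R) (X R1)"
       "X R1 = X R \<longrightarrow> (\<forall>u\<in>B R. holds n A fs (X R) u \<longrightarrow> u \<in> X R)"
    using c R unfolding passes_def by blast
  have "R1 1 = n" "R1 3 = 1" using R1 P R by auto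
  then obtain R2 where R2: "runs x d R1 T R2" "\<forall>q\<in>P. R2 q = R1 q" "updates (X R1) (X R2)"
       "X R2 = X R1 \<longrightarrow> (\<forall>u\<in>B' R1. holds n A fs (X R1) u \<longrightarrow> u \<in> X R1)"
    using d unfolding passes_def by blast
  have "X R1 = X R" if "X R2 = X R"
    using that update_mono[OF R1(3)] update_mono[OF R2(3)] by auto
  then have "X R2 = X R \<longrightarrow> (\<forall>u\<in>B R \<union> B' R. holds n A fs (X R) u \<longrightarrow> u \<in> X R)"
    using R1(4) R2(4) B[of R R1] by auto
  then show "\<exists>R'. runs x (c ;; d) R (S + T) R' \<and> (\<forall>q\<in>P. R' q = R q) \<and> updates (X R) (X R') \<and>
      (X R' = X R \<longrightarrow> (\<forall>u\<in>B R \<union> B' R. holds n A fs (X R) u \<longrightarrow> u \<in> X R))"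
    using runs_Seq[OF R1(1) R2(1)] R1(2) R2(2) rtranclp_trans[OF R1(3) R2(3)]
    by (intro exI[of _ R2]) simp
qed

text \<open>Registers 7, 8 and 9 are preserved because the loops that repeat the passes count in
  them.\<close>

lemma passes_Stages:
  "gs = drop k fs \<Longrightarrow> passes {1, 3, 7, 8, 9} {} (Stages K k gs) (stages_time n gs)
     (\<lambda>_. {u \<in> tuples m n. k \<le> fst u})"
proof (induction gs arbitrary: k)
  case Nil
  have "\<exists>R'. runs x (Prim (SetConst 2 0)) R 1 R' \<and> (\<forall>q\<in>{1, 3, 7, 8, 9}. R' q = R q) \<and> X R' = X R" for R
  proof (intro exI conjI)
    show "runs x (Prim (SetConst 2 0)) R 1 (R(2 := 0))" by (rule runs_SetConst)
    show "X (R(2 := 0)) = X R"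
      by (rule stored_agree[of "{2}"]) (use K in \<open>auto simp: agree_def\<close>)
  qed auto
  moreover have "m \<le> k" using Nil by simp
  ultimately show ?case
    unfolding passes_def by (fastforce simp: tuples_def)
next
  case (Cons f gs)
  have k: "k < m" using Cons.prems by (metis drop_all linorder_not_le list.distinct(1))
  have "f # gs = fs ! k # drop (Suc k) fs"
    by (simp only: Cons.prems Cons_nth_drop_Suc[OF k])
  then have f: "f = fs ! k" and gs: "gs = drop (Suc k) fs" by blast+
  have v: "var_reg 0 < K" "var_reg 1 < K" "var_reg 2 < K" using K W by (auto simp: var_reg_def)
  let ?P = "{1, 3, 7, 8, 9, var_reg 0, var_reg 1, var_reg 2}"
  let ?V = "{var_reg 0, var_reg 1, var_reg 2}"
  let ?M = "Mark K k f" let ?T = "eval_time f n + (n * 15 + 26)"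
  have 1: "passes (?P - {var_reg 2}) (?V - {var_reg 2}) (For (var_reg 2) ?M) (for_time n ?T)
     (\<lambda>R. \<Union>l<n. (\<lambda>R. {(k, R (var_reg 0), R (var_reg 1), R (var_reg 2))}) (R(var_reg 2 := l)))"
    by (rule passes_For[OF passes_Mark[OF k, folded f]]) (use v in \<open>auto simp: var_reg_notin var_reg_notin(17)[symmetric]\<close>)
  have 2: "passes (?P - {var_reg 2} - {var_reg 1}) (?V - {var_reg 2} - {var_reg 1})
     (For (var_reg 1) (For (var_reg 2) ?M)) (for_time n (for_time n ?T))
     (\<lambda>R. \<Union>j<n. (\<lambda>R. \<Union>l<n. (\<lambda>R. {(k, R (var_reg 0), R (var_reg 1), R (var_reg 2))}) (R(var_reg 2 := l)))
       (R(var_reg 1 := j)))"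
    by (rule passes_For[OF 1]) (use v in \<open>auto simp: var_reg_notin var_reg_notin(17)[symmetric]\<close>)
  have "passes (?P - {var_reg 2} - {var_reg 1} - {var_reg 0}) (?V - {var_reg 2} - {var_reg 1} - {var_reg 0})
     (For (var_reg 0) (For (var_reg 1) (For (var_reg 2) ?M))) (for_time n (for_time n (for_time n ?T)))
     (\<lambda>R. \<Union>i<n. (\<lambda>R. \<Union>j<n. (\<lambda>R. \<Union>l<n. (\<lambda>R. {(k, R (var_reg 0), R (var_reg 1), R (var_reg 2))})
       (R(var_reg 2 := l))) (R(var_reg 1 := j))) (R(var_reg 0 := i)))"
    by (rule passes_For[OF 2]) (use v in \<open>auto simp: var_reg_notin var_reg_notin(17)[symmetric]\<close>)
  then have 3: "passes (?P - {var_reg 2} - {var_reg 1} - {var_reg 0}) (?V - {var_reg 2} - {var_reg 1} - {var_reg 0})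
     (For (var_reg 0) (For (var_reg 1) (For (var_reg 2) ?M))) (for_time n (for_time n (for_time n ?T)))
     (\<lambda>R. \<Union>i<n. \<Union>j<n. \<Union>l<n. {(k, i, j, l)})"
    by (simp add: var_reg_notin)
  have P: "?P - {var_reg 2} - {var_reg 1} - {var_reg 0} = {1, 3, 7, 8, 9}"
      "?V - {var_reg 2} - {var_reg 1} - {var_reg 0} = {}"
    by (auto simp: var_reg_def)
  have B: "{u \<in> tuples m n. k \<le> fst u} =
      (\<Union>i<n. \<Union>j<n. \<Union>l<n. {(k, i, j, l)}) \<union> {u \<in> tuples m n. Suc k \<le> fst u}"
    using k by (auto simp: tuples_def)
  show ?case
    unfolding Stages.simps stages_time.simps For3.simps B
    by (rule passes_Seq[OF 3[unfolded P] Cons.IH[OF gs]]) auto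
qed

text \<open>Progress measure: a closed relation is never changed again, and otherwise the gains add
  up, so the alternative composes under sequencing and looping.\<close>

definition advances :: "nat set \<Rightarrow> cmd \<Rightarrow> nat \<Rightarrow> nat \<Rightarrow> bool" where
  "advances P c T N \<longleftrightarrow> (\<forall>R. R 1 = n \<longrightarrow> R 3 = 1 \<longrightarrow>
     (\<exists>R'. runs x c R T R' \<and> (\<forall>q\<in>P. R' q = R q) \<and> updates (X R) (X R') \<and>
       (closed_under n A fs (X R') \<or> card (X R) + N \<le> card (X R'))))"

lemma advances_Stages: "advances {1, 3, 7, 8, 9} (Stages K 0 fs) (stages_time n fs) 1"
  unfolding advances_def
proof (intro allI impI)
  fix R :: "nat \<Rightarrow> nat" assume R: "R 1 = n" "R 3 = 1"
  obtain R' where R': "runs x (Stages K 0 fs) R (stages_time n fs) R'"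
    "\<forall>q\<in>{1, 3, 7, 8, 9}. R' q = R q" "updates (X R) (X R')"
    "X R' = X R \<longrightarrow> (\<forall>u\<in>tuples m n. holds n A fs (X R) u \<longrightarrow> u \<in> X R)"
    using passes_Stages[of fs 0] R unfolding passes_def
    by (simp only: drop0 le0 simp_thms Collect_mem_eq ball_empty) blast
  have "closed_under n A fs (X R') \<or> card (X R) + 1 \<le> card (X R')"
  proof (cases "X R' = X R")
    case True
    then show ?thesis using R'(4) by (simp add: closed_under_def)
  next
    case False
    then have "X R \<subset> X R'" using update_mono[OF R'(3)] by auto
    then have "card (X R) < card (X R')"
      by (rule psubset_card_mono[OF finite_subset[OF stored_subset finite_tuples]])
    then show ?thesis by simp
  qed
  then show "\<exists>R'. runs x (Stages K 0 fs) R (stages_time n fs) R' \<and>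
      (\<forall>q\<in>{1, 3, 7, 8, 9}. R' q = R q) \<and> updates (X R) (X R') \<and>
      (closed_under n A fs (X R') \<or> card (X R) + 1 \<le> card (X R'))"
    using R' by blast
qed

lemma advances_Seq:
  assumes c: "advances P c S M" and d: "advances P d T N" and P: "1 \<in> P" "3 \<in> P"
  shows "advances P (c ;; d) (S + T) (M + N)"
  unfolding advances_def
proof (intro allI impI)
  fix R :: "nat \<Rightarrow> nat" assume R: "R 1 = n" "R 3 = 1"
  obtain R1 where R1: "runs x c R S R1" "\<forall>q\<in>P. R1 q = R q" "updates (X R) (X R1)"
       "closed_under n A fs (X R1) \<or> card (X R) + M \<le> card (X R1)"
    using c R unfolding advances_def by blast
  have "R1 1 = n" "R1 3 = 1" using R1 P R by auto
  then obtain R2 where R2: "runs x d R1 T R2" "\<forall>q\<in>P. R2 q = R1 q" "updates (X R1) (X R2)"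
       "closed_under n A fs (X R2) \<or> card (X R1) + N \<le> card (X R2)"
    using d unfolding advances_def by blast
  have "closed_under n A fs (X R2)" if "closed_under n A fs (X R1)"
    using update_closed[OF R2(3) that] that by simp
  then have "closed_under n A fs (X R2) \<or> card (X R) + (M + N) \<le> card (X R2)"
    using R1(4) R2(4) by auto
  then show "\<exists>R'. runs x (c ;; d) R (S + T) R' \<and> (\<forall>q\<in>P. R' q = R q) \<and> updates (X R) (X R') \<and>
      (closed_under n A fs (X R') \<or> card (X R) + (M + N) \<le> card (X R'))"
    using runs_Seq[OF R1(1) R2(1)] R1(2) R2(2) rtranclp_trans[OF R1(3) R2(3)]
    by (intro exI[of _ R2]) simp
qed

lemma advances_Repeat:
  assumes "advances P c T N" "1 \<in> P" "3 \<in> P" "2 \<notin> P"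
  shows "advances P (Repeat k c) (k * T + 1) (k * N)"
proof (induction k)
  case 0
  have "X (R(2 := 0)) = X R" for R
    by (rule stored_agree[of "{2}"]) (use K in \<open>auto simp: agree_def\<close>)
  then show ?case using runs_SetConst[of x 2 0] assms(4)
    unfolding advances_def by (intro allI impI, rule_tac x = "R(2 := 0)" in exI) auto
next
  case (Suc k)
  then show ?case using advances_Seq[OF assms(1) Suc assms(2,3)] by (simp add: add.assoc)
qed

lemma advances_For:
  assumes c: "advances P c T N" and r: "r \<in> P" "r \<notin> {1, 2, 3}" "r < K" and P: "1 \<in> P" "3 \<in> P" "2 \<notin> P"
  shows "advances (P - {r}) (For r c) (for_time n T) (n * N)"
  unfolding advances_def for_time_def
proof (intro allI impI)
  fix R :: "nat \<Rightarrow> nat" assume R: "R 1 = n" "R 3 = 1"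
  define I where "I j R' \<longleftrightarrow> (\<forall>q\<in>P - {r}. R' q = R q) \<and> updates (X R) (X R') \<and>
    (closed_under n A fs (X R') \<or> card (X R) + (n - j) * N \<le> card (X R'))" for j R'
  have "\<exists>R'. runs x (For r c) R (n * (T + 4) + 3) R' \<and> I 0 R'"
  proof (rule runs_For[where n = n])
    show "R' 1 = n \<and> R' 3 = 1" if "I j R'" for j R'
      using that P R r by (auto simp: I_def)
    show "I j R''" if *: "I j R'" "\<forall>q. q \<noteq> r \<longrightarrow> q \<noteq> 2 \<longrightarrow> R'' q = R' q" for j R' R''
    proof -
      have "X R'' = X R'"
        by (rule stored_agree[of "{r, 2}"]) (use * r K in \<open>auto simp: agree_def\<close>)
      moreover have "R'' q = R q" if "q \<in> P - {r}" for q
        using * that P by (auto simp: I_def)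
      ultimately show ?thesis using *(1) by (simp add: I_def)
    qed
    show "r \<notin> {1, 2, 3}" by fact
    show "I n R" by (simp add: I_def)
  next
    fix j R1 assume *: "j < n" "I (Suc j) R1" "R1 r = j"
    have 1: "R1 1 = n" "R1 3 = 1" using * P R r by (auto simp: I_def)
    obtain R2 where R2: "runs x c R1 T R2" "\<forall>q\<in>P. R2 q = R1 q" "updates (X R1) (X R2)"
       "closed_under n A fs (X R2) \<or> card (X R1) + N \<le> card (X R2)"
      using c 1 unfolding advances_def by blast
    have cl: "closed_under n A fs (X R2)" if "closed_under n A fs (X R1)"
      using update_closed[OF R2(3) that] that by simp
    have "n - j = Suc (n - Suc j)" using *(1) by simp
    then have "closed_under n A fs (X R2) \<or> card (X R) + (n - j) * N \<le> card (X R2)"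
      using cl R2(4) *(2) by (auto simp: I_def)
    moreover have "updates (X R) (X R2)"
      using *(2) R2(3) unfolding I_def by (blast intro: rtranclp_trans)
    moreover have "\<forall>q\<in>P - {r}. R2 q = R q"
      using *(2) R2(2) by (simp add: I_def)
    ultimately have "I j R2" unfolding I_def by blast
    then show "\<exists>R'. runs x c R1 T R' \<and> I j R' \<and> R' r = j"
      using R2 r *(3) by auto
  qed
  then show "\<exists>R'. runs x (For r c) R (n * (T + 4) + 3) R' \<and> (\<forall>q\<in>P - {r}. R' q = R q) \<and>
      updates (X R) (X R') \<and> (closed_under n A fs (X R') \<or> card (X R) + n * N \<le> card (X R'))"
    by (simp add: I_def)
qed

text \<open>Three nested loops around \<open>m\<close> passes give as many passes as there are
  tuples. If closure were never reached, every pass would store a new tuple, and the full set of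
  tuples is closed anyway.\<close>

lemma runs_fixpoint:
  assumes R: "R 1 = n" "R 3 = 1"
  shows "\<exists>R'. runs x (For3 7 8 9 (Repeat m (Stages K 0 fs))) R
      (for_time n (for_time n (for_time n (m * stages_time n fs + 1)))) R' \<and>
    R' 1 = n \<and> R' 3 = 1 \<and> updates (X R) (X R') \<and> closed_under n A fs (X R')"
proof -
  have k: "7 < K" "8 < K" "9 < K" using K by auto
  have "advances ({1, 3, 7, 8, 9} - {9} - {8} - {7}) (For3 7 8 9 (Repeat m (Stages K 0 fs)))
      (for_time n (for_time n (for_time n (m * stages_time n fs + 1)))) (n * (n * (n * (m * 1))))"
    unfolding For3.simps
    by (intro advances_For advances_Repeat advances_Stages k) auto
  then obtain R' where R': "runs x (For3 7 8 9 (Repeat m (Stages K 0 fs))) R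
      (for_time n (for_time n (for_time n (m * stages_time n fs + 1)))) R'"
    "\<forall>q\<in>{1, 3, 7, 8, 9} - {9} - {8} - {7}. R' q = R q" "updates (X R) (X R')"
    "closed_under n A fs (X R') \<or> card (X R) + (n * (n * (n * (m * 1)))) \<le> card (X R')"
    using R unfolding advances_def by blast
  have "closed_under n A fs (X R')" if "card (X R) + (n * (n * (n * (m * 1)))) \<le> card (X R')"
  proof -
    have "card (tuples m n) \<le> card (X R')"
      using that by (simp add: card_tuples power3_eq_cube mult.commute mult.left_commute)
    then have "X R' = tuples m n"
      by (rule card_seteq[OF finite_tuples stored_subset])
    then show ?thesis by (simp add: closed_under_def)
  qed
  then show ?thesis using R' R by auto
qed

end


definition Count :: cmd where
  "Count = Prim (SetConst 3 1) ;; Prim (SetConst 0 1) ;;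
     Loop 0 (Prim (ReadBit 0 1) ;; When 0 (Prim (Add 1 1 3)))"

text \<open>Register 0 starts at 1 to enter the loop and then holds the bit just read; the separator
  ends it. Registers from 10 on stay 0, so the stored relation starts out empty.\<close>

lemma runs_Count:
  assumes x: "x = replicate n True @ False # bs"
  shows "\<exists>R'. runs x Count (\<lambda>_. 0) (n * 6 + 9) R' \<and> R' 1 = n \<and> R' 3 = 1 \<and> (\<forall>q\<ge>10. R' q = 0)"
proof -
  let ?b = "Prim (ReadBit 0 1) ;; When 0 (Prim (Add 1 1 3))"
  have "\<exists>R'. runs x (Loop 0 ?b) R (d * 6 + 7) R' \<and> R' 1 = n \<and> R' 3 = 1 \<and> (\<forall>q\<ge>10. R' q = R q)"
    if "R 0 \<noteq> 0" "R 3 = 1" "R 1 + d = n" for d R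
    using that
  proof (induction d arbitrary: R)
    case 0
    let ?R = "R(0 := (if R 1 < length x \<and> x ! R 1 then 1 else 0))"
    have z: "?R 0 = 0" using 0 x by (simp add: nth_append)
    have "runs x ?b R (1 + Suc 0) ?R"
      by (rule runs_Seq[OF runs_ReadBit runs_When_zero[of ?R 0, OF z]])
    moreover have "runs x (Loop 0 ?b) (?R(2 := 0)) 1 (?R(2 := 0))"
      by (rule runs_Loop_zero) (use z in simp)
    ultimately have "runs x (Loop 0 ?b) R (1 + Suc 0 + 1 + 3) (?R(2 := 0))"
      by (rule runs_Loop_pos[of R 0, OF 0(1)])
    then have "runs x (Loop 0 ?b) R (0 * 6 + 7) (?R(2 := 0))"
      by (rule runs_mono) simp
    moreover have "(?R(2 := 0)) 1 = n" "(?R(2 := 0)) 3 = 1" "\<forall>q\<ge>10. (?R(2 := 0)) q = R q"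
      using 0 by auto
    ultimately show ?case by blast
  next
    case (Suc d)
    let ?R = "R(0 := (if R 1 < length x \<and> x ! R 1 then 1 else 0))"
    have "R 1 < n" using Suc.prems(3) by simp
    then have z: "?R 0 = 1" using x by (simp add: nth_append)
    let ?R1 = "?R(1 := ?R 1 + ?R 3)"
    have 1: "runs x ?b R (1 + Suc 1) ?R1"
      by (rule runs_Seq[OF runs_ReadBit runs_When_pos[of ?R 0, OF _ runs_Add]]) (use z in simp)
    have "(?R1(2 := 0)) 0 \<noteq> 0" "(?R1(2 := 0)) 3 = 1" "(?R1(2 := 0)) 1 + d = n"
      using Suc.prems z by auto
    from Suc.IH[OF this] obtain R2 where R2: "runs x (Loop 0 ?b) (?R1(2 := 0)) (d * 6 + 7) R2"
      "R2 1 = n" "R2 3 = 1" "\<forall>q\<ge>10. R2 q = (?R1(2 := 0)) q" by blast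
    have "runs x (Loop 0 ?b) R (1 + Suc 1 + (d * 6 + 7) + 3) R2"
      by (rule runs_Loop_pos[of R 0, OF Suc.prems(1) 1 R2(1)])
    then have "runs x (Loop 0 ?b) R (Suc d * 6 + 7) R2"
      by (rule runs_mono) simp
    then show ?case using R2 by (intro exI[of _ R2]) simp
  qed
  note loop = this
  let ?R = "((\<lambda>_. 0)(3 := 1, 0 := 1)) :: nat \<Rightarrow> nat"
  obtain R' where R': "runs x (Loop 0 ?b) ?R (n * 6 + 7) R'" "R' 1 = n" "R' 3 = 1" "\<forall>q\<ge>10. R' q = ?R q"
    using loop[of ?R n] by auto
  have "runs x Count (\<lambda>_. 0) (1 + (1 + (n * 6 + 7))) R'"
    unfolding Count_def by (intro runs_Seq[OF runs_SetConst] R'(1))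
  then have "runs x Count (\<lambda>_. 0) (n * 6 + 9) R'"
    by (rule runs_mono) simp
  then show ?thesis using R' by auto
qed

section \<open>Polynomial bounds on the running time\<close>

definition polynomially_bounded :: "(nat \<Rightarrow> nat) \<Rightarrow> bool" where
  "polynomially_bounded f \<longleftrightarrow> (\<exists>q :: nat poly. \<forall>n. f n \<le> poly q n)"

lemma polynomially_bounded_const: "polynomially_bounded (\<lambda>_. c)"
  unfolding polynomially_bounded_def by (rule exI[of _ "[:c:]"]) simp

lemma polynomially_bounded_id: "polynomially_bounded (\<lambda>n. n)"
  unfolding polynomially_bounded_def by (rule exI[of _ "[:0, 1:]"]) simp

lemma polynomially_bounded_add:
  "polynomially_bounded f \<Longrightarrow> polynomially_bounded g \<Longrightarrow> polynomially_bounded (\<lambda>n. f n + g n)"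
  unfolding polynomially_bounded_def by (metis add_mono poly_add)

lemma polynomially_bounded_mult:
  "polynomially_bounded f \<Longrightarrow> polynomially_bounded g \<Longrightarrow> polynomially_bounded (\<lambda>n. f n * g n)"
  unfolding polynomially_bounded_def by (metis mult_le_mono poly_mult)

lemmas polynomially_bounded_intros =
  polynomially_bounded_const polynomially_bounded_id polynomially_bounded_add polynomially_bounded_mult

lemma polynomially_bounded_for_time:
  "polynomially_bounded f \<Longrightarrow> polynomially_bounded (\<lambda>n. for_time n (f n))"
  unfolding for_time_def by (intro polynomially_bounded_intros)

lemma polynomially_bounded_eval_time: "polynomially_bounded (eval_time f)"
proof (induction f)
  case (Exists i f)
  have "polynomially_bounded (\<lambda>n. n * (eval_time f n + 5) + 6)"
    by (intro polynomially_bounded_intros Exists)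
  then show ?case by simp
next
  case (Conj f g)
  have "polynomially_bounded (\<lambda>n. eval_time f n + (eval_time g n + 1))"
    by (intro polynomially_bounded_intros Conj)
  then show ?case by simp
next
  case (Neg f)
  have "polynomially_bounded (\<lambda>n. eval_time f n + 1)"
    by (intro polynomially_bounded_intros Neg)
  then show ?case by simp
qed (unfold eval_time.simps, (intro polynomially_bounded_intros)+)

lemma polynomially_bounded_stages_time: "polynomially_bounded (\<lambda>n. stages_time n fs)"
proof (induction fs)
  case (Cons f fs)
  show ?case
    unfolding stages_time.simps
    by (intro polynomially_bounded_intros polynomially_bounded_for_time Cons
        polynomially_bounded_eval_time)
qed (simp add: polynomially_bounded_const)

lemma poly_nat_mono: "(a :: nat) \<le> b \<Longrightarrow> poly q a \<le> poly q b"
  by (induction q) (auto intro: add_mono mult_mono)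

lemma encode_digraph_bit:
  assumes V: "pverts D = {0..<n}" and ab: "a < n" "b < n"
  shows "n + 1 + (a * n + b) < length (encode_digraph D)"
    and "encode_digraph D ! (n + 1 + (a * n + b)) \<longleftrightarrow> (a, b) \<in> parcs D"
proof -
  have "a * n + b < (a + 1) * n" using ab by simp
  also have "\<dots> \<le> n * n" using ab by (intro mult_right_mono) auto
  finally have l: "a * n + b < n * n" .
  show "n + 1 + (a * n + b) < length (encode_digraph D)"
    using l by (simp add: length_encode_digraph V)
  have "List.product [0..<n] [0..<n] ! (a * n + b) = (a, b)"
    using product_nth[of "a * n + b" "[0..<n]" "[0..<n]"] l ab by simp
  then show "encode_digraph D ! (n + 1 + (a * n + b)) \<longleftrightarrow> (a, b) \<in> parcs D"
    using l by (simp add: encode_digraph_def Let_def V nth_append)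
qed

text \<open>The formulas do not depend on the input, so they yield loops of constant nesting depth
  over the vertices, hence a polynomial. Assumption \<open>correct\<close> receives only that
  \<open>X\<close> is closed and lies below every \<open>P\<close> that absorbs consequences of its
  subsets; for monotone rules this is the least fixed point.\<close>

theorem fixpoint_definable_polynomial_time:
  assumes I: "I \<subseteq> input_digraphs"
    and W: "3 \<le> W"
    and wf: "\<And>f. f \<in> set fs \<Longrightarrow> wf_fm (length fs) W f \<and> fv f \<subseteq> {0, 1, 2} \<and> bv f \<inter> {0, 1, 2} = {}"
    and g: "wf_fm (length fs) W g" "fv g = {}"
    and correct: "\<And>D n X. D \<in> I \<Longrightarrow> pverts D = {0..<n} \<Longrightarrow>
        X \<subseteq> tuples (length fs) n \<Longrightarrow> closed_under n (\<lambda>a b. (a, b) \<in> parcs D) fs X \<Longrightarrow>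
        (\<And>P. (\<And>Z u. Z \<subseteq> P \<Longrightarrow> u \<in> tuples (length fs) n \<Longrightarrow>
            holds n (\<lambda>a b. (a, b) \<in> parcs D) fs Z u \<Longrightarrow> u \<in> P) \<Longrightarrow> X \<subseteq> P) \<Longrightarrow>
        sat n (\<lambda>a b. (a, b) \<in> parcs D) X g (\<lambda>_. 0) \<longleftrightarrow> Q D"
  shows "polynomial_time_solvable_on I encode_digraph Q"
proof -
  let ?m = "length fs"
  define K where "K = 10 + 2 * W"
  define T where "T n = n * 6 + 9 + (for_time n (for_time n (for_time n (?m * stages_time n fs + 1)))
    + eval_time g n)" for n
  define c where "c = Count ;; For3 7 8 9 (Repeat ?m (Stages K 0 fs)) ;; Eval K g"
  define P where "P = compile 0 c"
  have "polynomially_bounded T"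
    unfolding T_def
    by (intro polynomially_bounded_intros polynomially_bounded_for_time
        polynomially_bounded_stages_time polynomially_bounded_eval_time)
  then obtain q :: "nat poly" where q: "T n \<le> poly q n" for n
    unfolding polynomially_bounded_def by blast
  have "\<exists>t \<le> poly q (length (encode_digraph D)). halted P (config_after P (encode_digraph D) t) \<and>
      (accepting (config_after P (encode_digraph D) t) \<longleftrightarrow> Q D)" if D: "D \<in> I" for D
  proof -
    obtain n where n: "pverts D = {0..<n}" using D I by (auto simp: input_digraphs_def)
    let ?x = "encode_digraph D" and ?A = "\<lambda>a b. (a, b) \<in> parcs D"
    interpret fixpoint_machine ?x n ?A fs W K
      by unfold_locales (use encode_digraph_bit[OF n] K_def W wf in auto)
    have "?x = replicate n True @ False # map (\<lambda>a. a \<in> parcs D) (List.product [0..<n] [0..<n])"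
      by (simp add: encode_digraph_def Let_def n)
    from runs_Count[OF this] obtain R1 where R1: "runs ?x Count (\<lambda>_. 0) (n * 6 + 9) R1" "R1 1 = n" "R1 3 = 1"
      "\<forall>q\<ge>10. R1 q = 0" by blast
    have e: "X R1 = {}" using R1(4) by (auto simp: stored_def cell_def K_def)
    obtain R2 where R2: "runs ?x (For3 7 8 9 (Repeat m (Stages K 0 fs))) R1
        (for_time n (for_time n (for_time n (m * stages_time n fs + 1)))) R2"
      "R2 1 = n" "R2 3 = 1" "updates (X R1) (X R2)" "closed_under n ?A fs (X R2)"
      using runs_fixpoint[OF R1(2,3)] by blast
    obtain R3 where R3: "runs ?x (Eval K g) R2 (eval_time g n) R3"
      "R3 0 \<noteq> 0 \<longleftrightarrow> sat n ?A (X R2) g (\<lambda>i. R2 (var_reg i))"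
      using runs_Eval[OF bits K g(1) R2(2,3)] g(2) by auto
    have "sat n ?A (X R2) g (\<lambda>i. R2 (var_reg i)) \<longleftrightarrow> sat n ?A (X R2) g (\<lambda>_. 0)"
      by (rule sat_cong) (simp add: g(2))
    also have "\<dots> \<longleftrightarrow> Q D"
    proof (rule correct[OF D n stored_subset R2(5)])
      fix P assume "\<And>Z u. Z \<subseteq> P \<Longrightarrow> u \<in> tuples (length fs) n \<Longrightarrow> holds n ?A fs Z u \<Longrightarrow> u \<in> P"
      then show "X R2 \<subseteq> P" using update_sound[OF R2(4), of P] e by simp
    qed
    finally have acc: "R3 0 \<noteq> 0 \<longleftrightarrow> Q D" using R3(2) by blast
    have "runs ?x c (\<lambda>_. 0) (T n) R3"
      unfolding c_def T_def by (rule runs_Seq[OF R1(1) runs_Seq[OF R2(1) R3(1)]])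
    then obtain t where t: "t \<le> T n" "exec ?x c (\<lambda>_. 0) t R3" unfolding runs_def by blast
    have fin: "config_after P ?x t = (length P, R3)"
      using compile_correct[OF t(2), of P "[]" 0 "[]"] by (simp add: config_after_def P_def)
    have "t \<le> poly q n" using t(1) q[of n] by simp
    also have "\<dots> \<le> poly q (length ?x)" by (rule poly_nat_mono) (simp add: length_encode_digraph n)
    finally show ?thesis using fin acc by (intro exI[of _ t]) (simp add: halted_def accepting_def)
  qed
  then show ?thesis unfolding polynomial_time_solvable_on_def by blast
qed

section \<open>Traversing sequences of label sets, and paths in trees\<close>

text \<open>The range is half open: with edge \<open>k\<close> joining vertices \<open>k\<close> and
  \<open>Suc k\<close> of a path, it is a traversal from vertex \<open>i\<close> to vertex
  \<open>j\<close>.\<close>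

definition increasing :: "(nat \<Rightarrow> nat set) \<Rightarrow> nat \<Rightarrow> nat \<Rightarrow> bool" where
  "increasing L i j \<longleftrightarrow>
     (\<exists>\<tau>. (\<forall>k. i \<le> k \<longrightarrow> k < j \<longrightarrow> \<tau> k \<in> L k) \<and> (\<forall>k. i \<le> k \<longrightarrow> Suc k < j \<longrightarrow> \<tau> k < \<tau> (Suc k)))"

lemma increasing_sub: "increasing L i j \<Longrightarrow> i \<le> i' \<Longrightarrow> j' \<le> j \<Longrightarrow> increasing L i' j'"
  unfolding increasing_def by (meson le_trans less_le_trans)

lemma increasing_shift: "increasing (\<lambda>k. L (i + k)) 0 d \<longleftrightarrow> increasing L i (i + d)"
proof
  assume "increasing (\<lambda>k. L (i + k)) 0 d"
  then obtain t where t: "\<forall>k<d. t k \<in> L (i + k)" "\<forall>k. Suc k < d \<longrightarrow> t k < t (Suc k)"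
    by (auto simp: increasing_def)
  have "\<forall>k. i \<le> k \<longrightarrow> k < i + d \<longrightarrow> t (k - i) \<in> L k"
  proof (intro allI impI)
    fix k assume "i \<le> k" "k < i + d"
    then show "t (k - i) \<in> L k" using t(1)[rule_format, of "k - i"] by auto
  qed
  moreover have "\<forall>k. i \<le> k \<longrightarrow> Suc k < i + d \<longrightarrow> t (k - i) < t (Suc k - i)"
    using t(2) by (auto simp: Suc_diff_le)
  ultimately show "increasing L i (i + d)"
    unfolding increasing_def by (intro exI[of _ "\<lambda>k. t (k - i)"]) blast
next
  assume "increasing L i (i + d)"
  then obtain t where t: "\<forall>k. i \<le> k \<longrightarrow> k < i + d \<longrightarrow> t k \<in> L k"
      "\<forall>k. i \<le> k \<longrightarrow> Suc k < i + d \<longrightarrow> t k < t (Suc k)"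
    by (auto simp: increasing_def)
  then show "increasing (\<lambda>k. L (i + k)) 0 d"
    unfolding increasing_def by (intro exI[of _ "\<lambda>k. t (i + k)"]) auto
qed

lemma increasing_two: "increasing L i (i + 2) \<longleftrightarrow> (\<exists>s\<in>L i. \<exists>t\<in>L (Suc i). s < t)"
proof
  assume "\<exists>s\<in>L i. \<exists>t\<in>L (Suc i). s < t"
  then obtain s t where st: "s \<in> L i" "t \<in> L (Suc i)" "s < t" by blast
  show "increasing L i (i + 2)"
    unfolding increasing_def
    by (rule exI[of _ "\<lambda>k. if k = i then s else t"]) (use st in \<open>auto simp: less_Suc_eq\<close>)
next
  assume "increasing L i (i + 2)"
  then obtain t where "\<forall>k. i \<le> k \<longrightarrow> k < i + 2 \<longrightarrow> t k \<in> L k" "\<forall>k. i \<le> k \<longrightarrow> Suc k < i + 2 \<longrightarrow> t k < t (Suc k)"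
    by (auto simp: increasing_def)
  then have "t i \<in> L i" "t (Suc i) \<in> L (Suc i)" "t i < t (Suc i)" by auto
  then show "\<exists>s\<in>L i. \<exists>t\<in>L (Suc i). s < t" by blast
qed

lemma increasing_cong: "(\<And>k. i \<le> k \<Longrightarrow> k < j \<Longrightarrow> L k = L' k) \<Longrightarrow> increasing L i j \<longleftrightarrow> increasing L' i j"
  unfolding increasing_def by auto

lemma Min_less_Max_iff:
  assumes "finite S" "S \<noteq> {}" "finite T" "T \<noteq> {}"
  shows "(\<exists>s\<in>S. \<exists>t\<in>T. s < t) \<longleftrightarrow> Min S < (Max T :: nat)"
  using assms by (metis Max_ge Max_in Min_in Min_le le_less_trans less_le_trans)

text \<open>
  An inclusion-minimal stretch that cannot be traversed leaves no slack anywhere: the two traversals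
  that omit one end are forced, and gluing them must fail at every position.
\<close>

lemma minimal_blocked:
  assumes fin: "\<And>k. k < l \<Longrightarrow> finite (L k) \<and> L k \<noteq> {}" and l: "2 \<le> l"
    and mono: "\<And>k. Suc k < l \<Longrightarrow> Max (L k) \<le> Min (L (Suc k))"
    and fwd: "increasing L 0 (l - 1)" and bwd: "increasing L 1 l" and blocked: "\<not> increasing L 0 l"
  shows "\<And>k. Suc k < l \<Longrightarrow> Max (L k) = Min (L (Suc k))"
    and "card (L 0) = 1" and "card (L (l - 1)) = 1"
    and "\<And>k. 0 < k \<Longrightarrow> Suc k < l \<Longrightarrow> card (L k) = 2"
proof -
  obtain t where t: "\<forall>k<l - 1. t k \<in> L k" "\<forall>k. Suc k < l - 1 \<longrightarrow> t k < t (Suc k)"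
    using fwd by (auto simp: increasing_def)
  obtain s where s: "\<forall>k. 1 \<le> k \<longrightarrow> k < l \<longrightarrow> s k \<in> L k" "\<forall>k. 1 \<le> k \<longrightarrow> Suc k < l \<longrightarrow> s k < s (Suc k)"
    using bwd by (auto simp: increasing_def)
  \<comment> \<open>\<open>t\<close> up to position \<open>k\<close> followed by \<open>s\<close>
    from \<open>Suc k\<close> on would traverse the whole stretch.\<close>
  have glue: "\<not> t k < s (Suc k)" if "Suc k < l" for k
  proof
    assume "t k < s (Suc k)"
    have "increasing L 0 l"
      unfolding increasing_def
    proof (intro exI[of _ "\<lambda>i. if i \<le> k then t i else s i"] conjI allI impI)
      fix i assume "i < l"
      then show "(if i \<le> k then t i else s i) \<in> L i" using t s that by auto
    next
      fix i assume i: "Suc i < l"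
      consider "Suc i \<le> k" | "i = k" | "k < i" by linarith
      then show "(if i \<le> k then t i else s i) < (if Suc i \<le> k then t (Suc i) else s (Suc i))"
        by cases (use t s i that \<open>t k < s (Suc k)\<close> in auto)
    qed
    with blocked show False ..
  qed
  \<comment> \<open>The chain \<open>t k\<close> <= \<open>Max (L k)\<close> <=
    \<open>Min (L (Suc k))\<close> <= \<open>s (Suc k)\<close> collapses, since \<open>glue\<close>
    gives \<open>s (Suc k)\<close> <= \<open>t k\<close>.\<close>
  have all: "t k = Max (L k) \<and> Max (L k) = Min (L (Suc k)) \<and> s (Suc k) = Min (L (Suc k))" if k: "Suc k < l" for k
  proof -
    have "t k \<le> Max (L k)" using t(1) k fin[of k] by simp
    moreover have "Min (L (Suc k)) \<le> s (Suc k)" using s(1) k fin[of "Suc k"] by simp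
    ultimately show ?thesis using glue[OF k] mono[OF k] by linarith
  qed
  show "\<And>k. Suc k < l \<Longrightarrow> Max (L k) = Min (L (Suc k))" using all by blast
  \<comment> \<open>Another label of the first edge would lie below \<open>s 1\<close> and could be
    put in front of \<open>s\<close>.\<close>
  show "card (L 0) = 1"
  proof -
    have "a = t 0" if a: "a \<in> L 0" for a
    proof (rule ccontr)
      assume "a \<noteq> t 0"
      moreover have "a \<le> Max (L 0)" using a fin[of 0] l by simp
      ultimately have "a < s 1" using all[of 0] l by simp
      then have "increasing L 0 l"
        unfolding increasing_def using a s
        by (intro exI[of _ "s(0 := a)"]) (auto simp: less_Suc_eq_0_disj)
      with blocked show False ..
    qed
    then have "L 0 = {t 0}" using fin[of 0] l by auto
    then show ?thesis by simp
  qed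
  show "card (L (l - 1)) = 1"
  proof -
    have "a = s (l - 1)" if a: "a \<in> L (l - 1)" for a
    proof (rule ccontr)
      assume "a \<noteq> s (l - 1)"
      moreover have "Min (L (l - 1)) \<le> a" using a fin[of "l - 1"] l by simp
      moreover have "Suc (l - 2) = l - 1" using l by simp
      ultimately have "t (l - 2) < a" using all[of "l - 2"] l by simp
      moreover have "k = l - 2" if "Suc k < l" "Suc k = l - 1" for k using that by simp
      ultimately have "increasing L 0 l"
        unfolding increasing_def using a t l
        by (intro exI[of _ "t(l - 1 := a)"]) auto
      with blocked show False ..
    qed
    then have "L (l - 1) = {s (l - 1)}" using fin[of "l - 1"] l by auto
    then show ?thesis by simp
  qed
  \<comment> \<open>At an inner edge \<open>t\<close> uses the last label, while the label of
    \<open>t\<close> one edge earlier equals the first label here, so the two extremes differ. A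
    label strictly between them would connect \<open>t\<close> before it to \<open>s\<close> after
    it.\<close>
  show "card (L k) = 2" if k: "0 < k" "Suc k < l" for k
  proof -
    let ?a = "Min (L k)" and ?b = "Max (L k)"
    obtain k' where k': "k = Suc k'" using k by (cases k) auto
    have tk: "t k = ?b" "s (Suc k) = ?b" "t k' = ?a" using all[of k] all[of k'] k k' by auto
    have "t k' < t k" using t(2) k k' by auto
    then have ab: "?a < ?b" using tk by simp
    have "c \<in> {?a, ?b}" if c: "c \<in> L k" for c
    proof (rule ccontr)
      assume "c \<notin> {?a, ?b}"
      moreover have "?a \<le> c" "c \<le> ?b" using c fin[of k] k by auto
      ultimately have c2: "t k' < c" "c < s (Suc k)" using tk by auto
      have "increasing L 0 l"
        unfolding increasing_def
      proof (intro exI[of _ "\<lambda>i. if i < k then t i else if i = k then c else s i"] conjI allI impI)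
        fix i assume "i < l"
        then show "(if i < k then t i else if i = k then c else s i) \<in> L i"
          using c t s k by auto
      next
        fix i assume i: "Suc i < l"
        consider "Suc i < k" | "Suc i = k" | "i = k" | "k < i" by linarith
        then show "(if i < k then t i else if i = k then c else s i)
            < (if Suc i < k then t (Suc i) else if Suc i = k then c else s (Suc i))"
          by cases (use c2 t s k k' i in auto)
      qed
      with blocked show False ..
    qed
    moreover have "?a \<in> L k" "?b \<in> L k" using fin[of k] k by auto
    ultimately have "L k = {?a, ?b}" by blast
    then show ?thesis using ab by (metis card_2_iff less_irrefl)
  qed
qed

text \<open>Here \<open>C k\<close> is the number of labels minus one. By induction a traversal has
  reached the last label of edge \<open>k\<close>: this is so at the single-label start, and
  tightness then excludes the first of the two labels of the next edge. The only label of the final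
  edge has been reached before it.\<close>

lemma tight_blocked:
  assumes l: "2 \<le> l" and tight: "\<And>k. Suc k < l \<Longrightarrow> B (Suc k) = B k + C k"
    and C: "C 0 = 0" "C (l - 1) = 0" "\<And>k. 0 < k \<Longrightarrow> Suc k < l \<Longrightarrow> C k = (1 :: nat)"
  shows "\<not> increasing (\<lambda>k. {B k..B k + C k}) 0 l"
proof
  assume "increasing (\<lambda>k. {B k..B k + C k}) 0 l"
  then obtain t where t: "\<forall>k<l. B k \<le> t k \<and> t k \<le> B k + C k" "\<forall>k. Suc k < l \<longrightarrow> t k < t (Suc k)"
    by (auto simp: increasing_def)
  have late: "B k + C k \<le> t k" if "Suc k < l" for k
    using that
  proof (induction k)
    case 0
    then show ?case using t(1) C(1) by auto
  next
    case (Suc k)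
    have "B k + C k \<le> t k" "t k < t (Suc k)" using Suc t(2) by auto
    then show ?case using tight[of k] C(3)[of "Suc k"] Suc.prems by simp
  qed
  obtain k where k: "l = Suc (Suc k)" using l by (cases l; cases "l - 1") auto
  have "B (Suc k) < t (Suc k)" using late[of k] t(2) tight[of k] k by force
  then show False using t(1)[rule_format, of "Suc k"] C(2) k by simp
qed

text \<open>
  The earliest traversal leaves a label unused for later unless it is delayed (\<open>dl\<close>), that is,
  unless it uses the last label of the current edge.
\<close>

lemma greedy_traversal:
  assumes mono: "\<And>k. Suc k < l \<Longrightarrow> B k + C k \<le> B (Suc k)" and C: "\<And>k. k < l \<Longrightarrow> C k \<le> (2 :: nat)"
    and start: "\<And>k. k < l \<Longrightarrow> C k = 0 \<Longrightarrow> dl k"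
    and cont: "\<And>k. Suc k < l \<Longrightarrow> dl k \<Longrightarrow> B (Suc k) = B k + C k \<Longrightarrow> C (Suc k) = 1 \<Longrightarrow> dl (Suc k)"
    and free: "\<And>k. Suc k < l \<Longrightarrow> dl k \<Longrightarrow> B (Suc k) = B k + C k \<Longrightarrow> C (Suc k) \<noteq> 0"
  shows "increasing (\<lambda>k. {B k..B k + C k}) 0 l"
proof -
  \<comment> \<open>The greedy choice: the first label of the next edge if it is late enough,
    otherwise the successor of the current time.\<close>
  define t where "t = rec_nat (B 0) (\<lambda>k s. max (B (Suc k)) (Suc s))"
  have t0: "t 0 = B 0" and tS: "t (Suc k) = max (B (Suc k)) (Suc (t k))" for k
    by (simp_all add: t_def)
  have "B k \<le> t k \<and> t k \<le> B k + C k \<and> (t k = B k + C k \<longrightarrow> dl k)" if "k < l" for k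
    using that
  proof (induction k)
    case 0
    then show ?case using start[of 0] by (auto simp: t0)
  next
    case (Suc k)
    have IH: "B k \<le> t k" "t k \<le> B k + C k" "t k = B k + C k \<Longrightarrow> dl k" using Suc by auto
    have m: "B k + C k \<le> B (Suc k)" using mono Suc.prems by blast
    show ?case
    proof (cases "t k < B (Suc k)")
      case True
      then have "t (Suc k) = B (Suc k)" by (simp add: tS)
      then show ?thesis using start[of "Suc k"] Suc.prems by auto
    next
      case False
      then have eq: "t k = B k + C k" "B (Suc k) = B k + C k" using IH m by auto
      \<comment> \<open>The first label is lost and the second is used. It is the last one only if
        \<open>C (Suc k) = 1\<close>; with three labels the delay ends here.\<close>
      have "t (Suc k) = Suc (B (Suc k))" using eq by (simp add: tS)
      moreover have "C (Suc k) \<noteq> 0" using free Suc.prems IH eq by blast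
      moreover have "C (Suc k) = 1 \<Longrightarrow> dl (Suc k)" using cont Suc.prems IH eq by blast
      ultimately show ?thesis by auto
    qed
  qed
  then show ?thesis
    unfolding increasing_def by (intro exI[of _ t]) (auto simp: tS)
qed

lemma length_path_edges: "length (path_edges vs) = length vs - 1"
  and path_edges_nth: "Suc i < length vs \<Longrightarrow> path_edges vs ! i = {vs ! i, vs ! Suc i}"
  by (auto simp: path_edges_def nth_tl)

lemma path_edges_Cons: "path_edges (x # y # zs) = {x, y} # path_edges (y # zs)"
  and path_edges_single: "path_edges [x] = []" "path_edges [] = []"
  by (simp_all add: path_edges_def)

lemma strict_temporal_path_iff:
  "(\<exists>p. strict_temporal_path V E lab u p v) \<longleftrightarrow>
   (\<exists>vs. undirected_path V E vs \<and> hd vs = u \<and> last vs = v \<and>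
      increasing (\<lambda>i. lab {vs ! i, vs ! Suc i}) 0 (length vs - 1))"
proof
  assume "\<exists>p. strict_temporal_path V E lab u p v"
  then obtain p vs where *: "undirected_path V E vs" "hd vs = u" "last vs = v" "map fst p = path_edges vs"
    "\<forall>(e, t)\<in>set p. t \<in> lab e" "sorted_wrt (<) (map snd p)"
    by (auto simp: strict_temporal_path_def)
  have l: "length p = length vs - 1" using *(4) by (metis length_map length_path_edges)
  have "snd (p ! k) \<in> lab {vs ! k, vs ! Suc k}" if "k < length vs - 1" for k
  proof -
    have "fst (p ! k) = {vs ! k, vs ! Suc k}"
      using *(4) that l path_edges_nth[of k vs] by (metis Suc_eq_plus1 less_diff_conv nth_map)
    moreover have "snd (p ! k) \<in> lab (fst (p ! k))"
      using *(5) that l by (metis (mono_tags, lifting) case_prod_beta nth_mem)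
    ultimately show ?thesis by simp
  qed
  moreover have "snd (p ! k) < snd (p ! Suc k)" if "Suc k < length vs - 1" for k
    using *(6) that l by (simp add: sorted_wrt_iff_nth_less)
  ultimately have "increasing (\<lambda>i. lab {vs ! i, vs ! Suc i}) 0 (length vs - 1)"
    unfolding increasing_def by (intro exI[of _ "\<lambda>k. snd (p ! k)"]) auto
  with * show "\<exists>vs. undirected_path V E vs \<and> hd vs = u \<and> last vs = v \<and>
      increasing (\<lambda>i. lab {vs ! i, vs ! Suc i}) 0 (length vs - 1)" by blast
next
  assume "\<exists>vs. undirected_path V E vs \<and> hd vs = u \<and> last vs = v \<and>
      increasing (\<lambda>i. lab {vs ! i, vs ! Suc i}) 0 (length vs - 1)"
  then obtain vs t where vs: "undirected_path V E vs" "hd vs = u" "last vs = v"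
    and t: "\<forall>k<length vs - 1. t k \<in> lab {vs ! k, vs ! Suc k}"
      "\<forall>k. Suc k < length vs - 1 \<longrightarrow> t k < t (Suc k)"
    by (auto simp: increasing_def)
  let ?p = "map (\<lambda>k. ({vs ! k, vs ! Suc k}, t k)) [0..<length vs - 1]"
  have "map fst ?p = path_edges vs"
    by (rule nth_equalityI) (auto simp: length_path_edges path_edges_nth)
  moreover have "\<forall>(e, t)\<in>set ?p. t \<in> lab e" using t(1) by auto
  moreover have "sorted_wrt (<) (map snd ?p)"
    using t(2) by (subst sorted_wrt_iff_nth_Suc_transp) auto
  ultimately have "strict_temporal_path V E lab u ?p v"
    using vs unfolding strict_temporal_path_def by blast
  then show "\<exists>p. strict_temporal_path V E lab u p v" ..
qed


section \<open>Non-backtracking walks and paths in a tree\<close>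

text \<open>In a tree the walks that never turn back at once are exactly the paths. This condition
  is local, so walks can be glued without comparing their vertex sets.\<close>

fun nb_walk :: "'a set set \<Rightarrow> 'a list \<Rightarrow> bool" where
  "nb_walk E (x # y # zs) \<longleftrightarrow> {x, y} \<in> E \<and> nb_walk E (y # zs) \<and> (zs = [] \<or> x \<noteq> hd zs)"
| "nb_walk E _ \<longleftrightarrow> True"

text \<open>The condition concerns at most three consecutive vertices, and two parts that share an
  edge cover every such triple.\<close>

lemma nb_walk_overlap:
  "nb_walk E (xs @ x # y # ys) \<longleftrightarrow> nb_walk E (xs @ [x, y]) \<and> nb_walk E (x # y # ys)"
proof (induction xs)
  case (Cons a xs)
  show ?case
  proof (cases xs)
    case (Cons b xs')
    then show ?thesis using Cons.IH by (cases xs') auto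
  qed auto
qed auto

lemma nb_walk_rev: "nb_walk E (rev xs) \<longleftrightarrow> nb_walk E xs"
proof (induction E xs rule: nb_walk.induct)
  case (1 E x y zs)
  show ?case
  proof (cases zs)
    case (Cons z zs')
    have "nb_walk E (rev (x # y # zs)) \<longleftrightarrow> nb_walk E (rev zs' @ [z, y]) \<and> nb_walk E [z, y, x]"
      using nb_walk_overlap[of E "rev zs'" z y "[x]"] Cons by simp
    moreover have "nb_walk E (rev zs' @ [z, y]) \<longleftrightarrow> nb_walk E (y # zs)"
      using 1 Cons by simp
    ultimately show ?thesis using Cons by (auto simp: insert_commute)
  qed (auto simp: insert_commute)
qed auto

lemma nb_walk_append: "nb_walk E (xs @ ys) \<Longrightarrow> nb_walk E xs \<and> nb_walk E ys"
proof (induction E xs rule: nb_walk.induct)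
  case (1 E x y zs)
  then show ?case by (cases zs) auto
next
  case ("2_2" E x)
  then show ?case by (cases ys) auto
qed auto

lemma undirected_path_imp_nb_walk: "undirected_path V E xs \<Longrightarrow> nb_walk E xs"
proof (induction E xs rule: nb_walk.induct)
  case (1 E x y zs)
  then show ?case
    by (cases zs) (auto simp: undirected_path_def path_edges_Cons)
qed auto

lemma nb_walk_path_edges: "nb_walk E xs \<Longrightarrow> set (path_edges xs) \<subseteq> E"
  by (induction E xs rule: nb_walk.induct) (auto simp: path_edges_Cons path_edges_single)

lemma undirected_path_nth_edge:
  assumes "undirected_path V E p" "Suc i < length p"
  shows "{p ! i, p ! Suc i} \<in> E"
proof -
  have "path_edges p ! i \<in> set (path_edges p)"
    using assms(2) by (intro nth_mem) (simp add: length_path_edges)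
  then show ?thesis using assms by (auto simp: undirected_path_def path_edges_nth)
qed

lemma undirected_path_append:
  assumes "undirected_path V E (xs @ ys)"
  shows "xs \<noteq> [] \<Longrightarrow> undirected_path V E xs" "ys \<noteq> [] \<Longrightarrow> undirected_path V E ys"
proof -
  have "set (path_edges xs) \<subseteq> set (path_edges (xs @ ys)) \<and> set (path_edges ys) \<subseteq> set (path_edges (xs @ ys))"
  proof (induction xs rule: induct_list012)
    case (2 x)
    then show ?case by (cases ys) (auto simp: path_edges_Cons path_edges_single)
  qed (auto simp: path_edges_Cons path_edges_single)
  then show "xs \<noteq> [] \<Longrightarrow> undirected_path V E xs" "ys \<noteq> [] \<Longrightarrow> undirected_path V E ys"
    using assms unfolding undirected_path_def by auto
qed

definition segment :: "nat \<Rightarrow> nat \<Rightarrow> 'a list \<Rightarrow> 'a list" where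
  "segment i j p = take (Suc j - i) (drop i p)"

lemma segment:
  assumes "i \<le> j" "j < length p"
  shows "length (segment i j p) = Suc (j - i)" "hd (segment i j p) = p ! i" "last (segment i j p) = p ! j"
    "k \<le> j - i \<Longrightarrow> segment i j p ! k = p ! (i + k)" "segment i j p \<noteq> []"
proof -
  show l: "length (segment i j p) = Suc (j - i)" using assms by (auto simp: segment_def)
  then show ne: "segment i j p \<noteq> []" by auto
  show n: "segment i j p ! k = p ! (i + k)" if "k \<le> j - i" for k
    using that assms by (auto simp: segment_def)
  show "hd (segment i j p) = p ! i" using n[of 0] ne by (simp add: hd_conv_nth)
  show "last (segment i j p) = p ! j" using n[of "j - i"] ne l assms by (simp add: last_conv_nth)
qed

lemma undirected_path_segment:
  assumes "undirected_path V E p" "i \<le> j" "j < length p"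
  shows "undirected_path V E (segment i j p)"
proof -
  have "p = take i p @ segment i j p @ drop (Suc j - i) (drop i p)"
    by (simp add: segment_def del: drop_drop)
  then show ?thesis
    using assms segment(5)[OF assms(2,3)] undirected_path_append by (metis append_is_Nil_conv)
qed

locale utree =
  fixes V :: "'a set" and E :: "'a set set"
  assumes tree: "undirected_tree V E"
begin

abbreviation "path \<equiv> undirected_path V E"

lemma edgeD: "{x, y} \<in> E \<Longrightarrow> x \<noteq> y \<and> x \<in> V \<and> y \<in> V"
  using tree unfolding undirected_tree_def simple_graph_def
  by (metis card_1_singleton_iff doubleton_eq_iff insert_absorb2 insert_subset is_singletonI
      is_singleton_altdef numeral_eq_one_iff semiring_norm(85))

lemma finite_V: "finite V" and V_nonempty: "V \<noteq> {}"
  using tree by (auto simp: undirected_tree_def simple_graph_def)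

lemma path_exists: "u \<in> V \<Longrightarrow> v \<in> V \<Longrightarrow> \<exists>p. path p \<and> hd p = u \<and> last p = v"
  using tree by (auto simp: undirected_tree_def)

text \<open>At the first return to a vertex \<open>z\<close>, the stretch since its earlier visit is
  a cycle: it has at least three vertices because there are neither loops nor immediate
  reversals.\<close>

lemma nb_walk_distinct: "nb_walk E xs \<Longrightarrow> set xs \<subseteq> V \<Longrightarrow> distinct xs"
proof (induction xs rule: rev_induct)
  case (snoc z xs)
  have d: "distinct xs" using snoc nb_walk_append[of E xs "[z]"] by auto
  have "z \<notin> set xs"
  proof
    assume "z \<in> set xs"
    then obtain as bs where xs: "xs = as @ z # bs" by (meson split_list)
    have nb: "nb_walk E (z # bs @ [z])"
      using snoc.prems nb_walk_append[of E as "z # bs @ [z]"] by (simp add: xs)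
    have "undirected_path V E (z # bs)"
      using d snoc.prems nb_walk_append[of E "z # bs" "[z]"] nb nb_walk_path_edges
      by (auto simp: xs undirected_path_def)
    moreover have "{last (z # bs), z} \<in> E"
    proof (cases bs rule: rev_cases)
      case (snoc cs c)
      then show ?thesis using nb nb_walk_overlap[of E "z # cs" c z "[]"] nb_walk_append[of E "z # cs" "[c, z]"] by simp
    qed (use nb in simp)
    moreover have "length (z # bs) \<ge> 3"
    proof (cases bs)
      case Nil
      then show ?thesis using nb edgeD[of z z] by simp
    next
      case (Cons b cs)
      then show ?thesis using nb by (cases cs) auto
    qed
    ultimately have "undirected_cycle V E (z # bs)" by (simp add: undirected_cycle_def)
    then show False using tree by (auto simp: undirected_tree_def)
  qed
  then show ?case using d by simp
qed simp

lemma nb_walk_subset: "nb_walk E xs \<Longrightarrow> hd xs \<in> V \<Longrightarrow> set xs \<subseteq> V"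
  by (induction xs rule: induct_list012) (auto dest: edgeD)

lemma path_iff: "path p \<longleftrightarrow> p \<noteq> [] \<and> hd p \<in> V \<and> nb_walk E p"
  using undirected_path_imp_nb_walk nb_walk_distinct nb_walk_subset nb_walk_path_edges
  unfolding undirected_path_def by (metis hd_in_set subset_iff)

text \<open>If two paths part at \<open>u\<close>, one of them reversed and followed by the other is
  a non-backtracking walk, so its vertices are distinct, which contradicts the common end.\<close>

lemma path_unique: "path p \<Longrightarrow> path q \<Longrightarrow> hd p = hd q \<Longrightarrow> last p = last q \<Longrightarrow> p = q"
proof (induction p arbitrary: q)
  case (Cons u p)
  obtain q' where q: "q = u # q'" using Cons.prems by (cases q) (auto simp: path_iff)
  have d: "distinct (u # p)" "distinct (u # q')" using Cons.prems q by (auto simp: undirected_path_def)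
  show ?case
  proof (cases "p = [] \<or> q' = []")
    case True
    then show ?thesis using Cons.prems q d by (metis last.simps last_in_set distinct.simps(2))
  next
    case False
    then obtain a p' b q'' where pq: "p = a # p'" "q' = b # q''" by (metis list.exhaust)
    show ?thesis
    proof (cases "a = b")
      case True
      then show ?thesis using Cons.IH[of q'] Cons.prems q pq undirected_path_append(2)[of V E "[u]"]
        by simp
    next
      case False
      have e: "nb_walk E (u # a # p')" "nb_walk E (u # b # q'')" "u \<in> V"
        using Cons.prems q pq by (auto simp: path_iff)
      have n1: "nb_walk E (rev p' @ [a, u])" using e(1) nb_walk_rev[of E "u # a # p'"] by simp
      have n2: "nb_walk E (a # u # b # q'')" using e False by (auto simp: insert_commute)
      have w: "nb_walk E (rev p' @ a # u # b # q'')"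
        by (rule nb_walk_overlap[THEN iffD2, OF conjI[OF n1 n2]])
      have "set (rev p' @ a # u # b # q'') \<subseteq> V"
        using Cons.prems q pq by (auto simp: undirected_path_def)
      from nb_walk_distinct[OF w this] have "set (a # p') \<inter> set (b # q'') = {}" by auto
      moreover have "last (a # p') = last (b # q'')" using Cons.prems q pq by simp
      ultimately show ?thesis by (metis disjoint_iff last_in_set list.distinct(1))
    qed
  qed
qed (simp add: undirected_path_def)

lemma path_two: "{x, y} \<in> E \<Longrightarrow> path [x, y]"
  by (auto simp: path_iff dest: edgeD)

lemma path_three: "{x, y} \<in> E \<Longrightarrow> {y, z} \<in> E \<Longrightarrow> x \<noteq> z \<Longrightarrow> path [x, y, z]"
  by (auto simp: path_iff dest: edgeD)

lemma no_triangle: "{x, y} \<in> E \<Longrightarrow> {y, z} \<in> E \<Longrightarrow> {x, z} \<notin> E"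
proof
  assume *: "{x, y} \<in> E" "{y, z} \<in> E" "{x, z} \<in> E"
  then have "x \<noteq> z" using edgeD by blast
  then have "[x, y, z] = [x, z]" by (intro path_unique path_three path_two) (use * in auto)
  then show False by simp
qed

lemma path_rev: "path p \<Longrightarrow> path (rev p)"
  using nb_walk_rev[of E p] last_in_set[of p] unfolding path_iff
  by (metis hd_rev in_mono nb_walk_subset rev_is_Nil_conv)

lemma path_snoc:
  assumes "path p" "{last p, z} \<in> E" "z \<notin> set p"
  shows "path (p @ [z])"
proof (cases p rule: rev_cases)
  case (snoc q y)
  have "nb_walk E (q @ [y, z])"
  proof (cases q rule: rev_cases)
    case (snoc r x)
    show ?thesis
      using assms \<open>p = q @ [y]\<close> snoc nb_walk_overlap[of E r x y "[z]"] nb_walk_append[of E r "[x, y]"]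
      by (auto simp: path_iff)
  qed (use assms \<open>p = q @ [y]\<close> in auto)
  then show ?thesis using assms(1) snoc by (cases q) (auto simp: path_iff)
qed (use assms in \<open>auto simp: path_iff\<close>)

text \<open>Antisymmetric weights can be integrated because there is no cycle on which they would
  have to sum to zero: \<open>h v\<close> sums the weights along the path from a root to
  \<open>v\<close>.\<close>

lemma potential_exists:
  fixes w :: "'a \<Rightarrow> 'a \<Rightarrow> int"
  assumes w: "\<And>x y. {x, y} \<in> E \<Longrightarrow> w y x = - w x y"
  shows "\<exists>h. \<forall>x y. {x, y} \<in> E \<longrightarrow> h y - h x = w x y"
proof -
  obtain r where r: "r \<in> V" using V_nonempty by blast
  define P where "P v = (SOME p. path p \<and> hd p = r \<and> last p = v)" for v
  have P: "path (P v) \<and> hd (P v) = r \<and> last (P v) = v" if "v \<in> V" for v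
    unfolding P_def using path_exists[OF r that] by (rule someI_ex)
  define h where "h v = (\<Sum>i<length (P v) - 1. w (P v ! i) (P v ! Suc i))" for v
  have ext: "h y - h x = w x y" if e: "{x, y} \<in> E" and y: "P y = P x @ [y]" for x y
  proof -
    have Px: "path (P x)" "last (P x) = x" using P e edgeD by blast+
    have ne: "P x \<noteq> []" using Px by (auto simp: path_iff)
    let ?n = "length (P x)"
    obtain m where m: "?n = Suc m" using ne by (cases "P x") auto
    have "h y = (\<Sum>i<Suc m. w ((P x @ [y]) ! i) ((P x @ [y]) ! Suc i))"
      unfolding h_def y using m by simp
    also have "\<dots> = (\<Sum>i<m. w (P x ! i) (P x ! Suc i)) + w (P x ! m) y"
      using m by (simp add: nth_append)
    also have "P x ! m = x" using Px ne m by (simp add: last_conv_nth)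
    finally show ?thesis unfolding h_def using m by simp
  qed
  have "h y - h x = w x y" if e: "{x, y} \<in> E" for x y
  proof (cases "y \<in> set (P x)")
    case False
    have x: "path (P x)" "hd (P x) = r" "last (P x) = x" and y: "y \<in> V" using P e edgeD by blast+
    have "path (P x @ [y])" using path_snoc x False e by simp
    then have "P y = P x @ [y]"
      using path_unique[of "P y" "P x @ [y]"] P[OF y] x by (auto simp: path_iff)
    with e show ?thesis by (rule ext)
  next
    \<comment> \<open>The edge now points towards the root: \<open>y\<close> is the last vertex
      before \<open>x\<close>, and the case of an extension applies with the roles
      exchanged.\<close>
    case True
    have x: "path (P x)" "hd (P x) = r" "last (P x) = x" and y: "y \<in> V" using P e edgeD by blast+
    obtain as bs where s: "P x = as @ y # bs" using True by (meson split_list)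
    have "path (y # bs)" using x(1) s undirected_path_append(2) by (metis list.distinct(1))
    moreover have "path [y, x]" using e path_two by (simp add: insert_commute)
    ultimately have "y # bs = [y, x]" by (rule path_unique) (use x s in auto)
    then have s: "P x = (as @ [y]) @ [x]" using s by simp
    have "path (as @ [y])" using x(1) s undirected_path_append(1) by (metis append_is_Nil_conv list.distinct(1))
    then have "P y = as @ [y]"
      using P[OF y] x(2) s by (intro path_unique) (auto simp: hd_append split: if_splits)
    then have "P x = P y @ [x]" using s by simp
    then have "h x - h y = w y x" using ext[of y x] e by (simp add: insert_commute)
    then show ?thesis using w[OF e] by simp
  qed
  then show ?thesis by blast
qed

text \<open>The vertices beyond the edge \<open>uw\<close> as seen from \<open>u\<close>, that is,
  the component of \<open>w\<close> once this edge is removed.\<close>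

definition side :: "'a \<Rightarrow> 'a \<Rightarrow> 'a \<Rightarrow> bool" where
  "side u w v \<longleftrightarrow> (\<exists>q. path (u # w # q) \<and> last (w # q) = v)"

lemma side_edge: "{u, w} \<in> E \<Longrightarrow> side u w w"
  unfolding side_def using path_two by fastforce

text \<open>Either \<open>v'\<close> prolongs the path to \<open>v\<close>, or it already lies on it
  and the path is cut there.\<close>

lemma side_step:
  assumes "side u w v" "{v, v'} \<in> E" "v' \<noteq> u"
  shows "side u w v'"
proof -
  obtain q where q: "path (u # w # q)" "last (w # q) = v" using assms by (auto simp: side_def)
  show ?thesis
  proof (cases "v' \<in> set (w # q)")
    case True
    then obtain as bs where s: "w # q = as @ v' # bs" by (meson split_list)
    have "path (u # as @ [v'])"
      using q(1) s undirected_path_append(1)[of V E "u # as @ [v']" bs] by simp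
    show ?thesis
    proof (cases as)
      case Nil
      then show ?thesis using \<open>path (u # as @ [v'])\<close> s unfolding side_def by (intro exI[of _ "[]"]) simp
    next
      case (Cons b cs)
      then show ?thesis using \<open>path (u # as @ [v'])\<close> s unfolding side_def
        by (intro exI[of _ "cs @ [v']"]) simp
    qed
  next
    case False
    then have "path ((u # w # q) @ [v'])" using path_snoc[OF q(1)] assms q by auto
    then show ?thesis unfolding side_def by (intro exI[of _ "q @ [v']"]) auto
  qed
qed

text \<open>With \<open>side_edge\<close> and \<open>side_step\<close> this makes
  \<open>side\<close> the least relation closed under two first-order rules, which are the rules for
  tag 0.\<close>

lemma side_induct:
  assumes "side u w v" and base: "{u, w} \<in> E \<Longrightarrow> P w"
    and step: "\<And>v v'. P v \<Longrightarrow> side u w v \<Longrightarrow> side u w v' \<Longrightarrow> {v, v'} \<in> E \<Longrightarrow> v' \<noteq> u \<Longrightarrow> P v'"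
  shows "P v"
proof -
  have "path (u # w # q) \<Longrightarrow> P (last (w # q))" for q
  proof (induction q rule: rev_induct)
    case Nil
    then show ?case using base by (auto simp: path_iff)
  next
    case (snoc x q)
    have q: "path (u # w # q)" using undirected_path_append(1)[of V E "u # w # q" "[x]"] snoc.prems by simp
    have "nb_walk E ((u # w # q) @ [x])" using snoc.prems by (simp add: path_iff)
    then have e: "{last (w # q), x} \<in> E"
    proof (cases q rule: rev_cases)
      case (snoc r y)
      then show ?thesis
        using \<open>nb_walk E ((u # w # q) @ [x])\<close> nb_walk_append[of E "u # w # r" "[y, x]"] by simp
    qed auto
    have "x \<noteq> u" using snoc.prems by (auto simp: undirected_path_def)
    moreover have "side u w (last (w # q))" "side u w x"
      unfolding side_def using q snoc.prems by (blast, intro exI[of _ "q @ [x]"], simp)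
    ultimately show ?case using step[OF snoc.IH[OF q]] e by simp
  qed
  then show ?thesis using assms(1) by (auto simp: side_def)
qed

lemma side_nth:
  assumes p: "path p" and ij: "i < j" "j < length p"
  shows "side (p ! i) (p ! Suc i) (p ! j)"
proof -
  let ?s = "segment i j p"
  have s: "path ?s" "length ?s = Suc (j - i)" "?s ! 0 = p ! i" "?s ! 1 = p ! Suc i" "last ?s = p ! j"
    using undirected_path_segment[OF p] segment[of i j p] ij by auto
  obtain a b q where abq: "?s = a # b # q" using s(2) ij by (cases ?s; cases "tl ?s") auto
  then have "a = p ! i" "b = p ! Suc i" "path (a # b # q)" "last (b # q) = p ! j" using s by auto
  then show ?thesis unfolding side_def by blast
qed

lemma side_nth_rev:
  assumes p: "path p" and ij: "i \<le> j" "Suc j < length p"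
  shows "side (p ! Suc j) (p ! j) (p ! i)"
proof -
  have "side (rev p ! (length p - Suc (Suc j))) (rev p ! Suc (length p - Suc (Suc j))) (rev p ! (length p - Suc i))"
    by (rule side_nth[OF path_rev[OF p]]) (use ij in auto)
  moreover have "length p - Suc (length p - Suc (Suc j)) = Suc j" "length p - Suc (Suc (length p - Suc (Suc j))) = j"
    "length p - Suc (length p - Suc i) = i" using ij by auto
  ultimately show ?thesis using ij by (simp add: rev_nth)
qed

lemma side_first:
  assumes "side u a v" "path p" "hd p = u" "last p = v"
  shows "2 \<le> length p \<and> p ! 1 = a \<and> u \<noteq> v"
proof -
  obtain q where q: "path (u # a # q)" "last (a # q) = v" using assms by (auto simp: side_def)
  have "p = u # a # q" by (rule path_unique) (use assms q in auto)
  moreover have "u \<noteq> v" using q by (auto simp: undirected_path_def split: if_splits)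
  ultimately show ?thesis by simp
qed

lemma side_edgeD: "side u a v \<Longrightarrow> {u, a} \<in> E \<and> v \<in> V"
proof -
  assume "side u a v"
  then obtain q where q: "path (u # a # q)" "last (a # q) = v" by (auto simp: side_def)
  then have "set (u # a # q) \<subseteq> V" by (simp add: undirected_path_def)
  then have "v \<in> V" using q(2) last_in_set[of "a # q"] by auto
  then show ?thesis using q(1) by (simp add: path_iff)
qed

text \<open>The edge separates the ends of \<open>p\<close>. The two paths that leave it in opposite
  directions share the edge, so they glue to a non-backtracking walk, which is \<open>p\<close> by
  uniqueness.\<close>

lemma on_path:
  assumes p: "path p" and xy: "side x y (last p)" "side y x (hd p)"
  shows "\<exists>i. Suc i < length p \<and> x = p ! i \<and> y = p ! Suc i"
proof -
  obtain q where q: "path (x # y # q)" "last (y # q) = last p" using xy by (auto simp: side_def)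
  obtain q' where q': "path (y # x # q')" "last (x # q') = hd p" using xy by (auto simp: side_def)
  have "nb_walk E (rev q' @ [x, y])" using q' nb_walk_rev[of E "y # x # q'"] by (simp add: path_iff)
  then have w: "nb_walk E (rev q' @ x # y # q)" using q nb_walk_overlap[of E "rev q'" x y q] by (simp add: path_iff)
  have hd: "hd (rev q' @ x # y # q) = hd p"
    using q'(2) by (cases q' rule: rev_cases) auto
  have "hd p \<in> V" using p by (auto simp: path_iff)
  then have "path (rev q' @ x # y # q)" using w hd by (auto simp: path_iff)
  then have "p = rev q' @ x # y # q" using p by (intro path_unique) (use hd q in auto)
  then show ?thesis by (intro exI[of _ "length q'"]) (auto simp: nth_append)
qed

text \<open>Since tree paths are unique, only the labels along \<open>p\<close> between the two
  positions decide about the arc.\<close>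

lemma reach_iff:
  assumes p: "path p" and ij: "i < j" "j < length p"
  shows "(p ! i, p ! j) \<in> parcs (strict_reachability_graph V E lab) \<longleftrightarrow>
    increasing (\<lambda>k. lab {p ! k, p ! Suc k}) i j"
proof -
  let ?s = "segment i j p"
  have s: "path ?s" "length ?s = Suc (j - i)" "hd ?s = p ! i" "last ?s = p ! j"
    using undirected_path_segment[OF p] segment[of i j p] ij by auto
  have ne: "p ! i \<noteq> p ! j" "p ! i \<in> V" "p ! j \<in> V"
    using p ij by (auto simp: undirected_path_def nth_eq_iff_index_eq)
  have "(p ! i, p ! j) \<in> parcs (strict_reachability_graph V E lab) \<longleftrightarrow>
    increasing (\<lambda>k. lab {?s ! k, ?s ! Suc k}) 0 (length ?s - 1)"
  proof -
    have "(\<exists>vs. path vs \<and> hd vs = p ! i \<and> last vs = p ! j \<and>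
        increasing (\<lambda>k. lab {vs ! k, vs ! Suc k}) 0 (length vs - 1)) \<longleftrightarrow>
      increasing (\<lambda>k. lab {?s ! k, ?s ! Suc k}) 0 (length ?s - 1)"
    proof
      assume "\<exists>vs. path vs \<and> hd vs = p ! i \<and> last vs = p ! j \<and>
        increasing (\<lambda>k. lab {vs ! k, vs ! Suc k}) 0 (length vs - 1)"
      then obtain vs where vs: "path vs" "hd vs = p ! i" "last vs = p ! j"
        "increasing (\<lambda>k. lab {vs ! k, vs ! Suc k}) 0 (length vs - 1)" by blast
      have "?s = vs" by (rule path_unique[OF s(1) vs(1)]) (simp_all only: s vs)
      with vs(4) show "increasing (\<lambda>k. lab {?s ! k, ?s ! Suc k}) 0 (length ?s - 1)" by simp
    qed (use s in blast)
    then show ?thesis using ne by (simp add: strict_reachability_graph_def strict_temporal_path_iff)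
  qed
  also have "\<dots> \<longleftrightarrow> increasing (\<lambda>k. lab {p ! (i + k), p ! Suc (i + k)}) 0 (j - i)"
    unfolding s(2) diff_Suc_1 by (rule increasing_cong) (use segment(4)[of i j p] ij in simp)
  also have "\<dots> \<longleftrightarrow> increasing (\<lambda>k. lab {p ! k, p ! Suc k}) i j"
    using increasing_shift[of "\<lambda>k. lab {p ! k, p ! Suc k}" i "j - i"] ij by simp
  finally show ?thesis .
qed

end

section \<open>Labelling the solid tree\<close>

text \<open>To be read at a vertex \<open>v\<close> with neighbours \<open>M\<close>:
  \<open>lt\<close> is the arc relation, \<open>t x y\<close> says that \<open>xv\<close> and
  \<open>vy\<close> are tight, and \<open>c x\<close> is the number of labels of \<open>xv\<close>
  minus one. Incomparable neighbours carry the same single label, so they are interchangeable in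
  \<open>lt\<close> and \<open>t\<close>. A neighbour \<open>y\<close> between \<open>x\<close> and
  \<open>z\<close> fills the space between them: they can be tight only if \<open>y\<close> has one
  label and is tight to both.\<close>

locale local_order =
  fixes M :: "'a set" and lt t :: "'a \<Rightarrow> 'a \<Rightarrow> bool" and c :: "'a \<Rightarrow> nat"
  assumes finite_M: "finite M"
    and asym: "x \<in> M \<Longrightarrow> y \<in> M \<Longrightarrow> lt x y \<Longrightarrow> \<not> lt y x"
    and trans: "x \<in> M \<Longrightarrow> y \<in> M \<Longrightarrow> z \<in> M \<Longrightarrow> lt x y \<Longrightarrow> lt y z \<Longrightarrow> lt x z"
    and sim_lt: "x \<in> M \<Longrightarrow> y \<in> M \<Longrightarrow> z \<in> M \<Longrightarrow> x \<noteq> y \<Longrightarrow> \<not> lt x y \<Longrightarrow> \<not> lt y x \<Longrightarrow> lt y z \<Longrightarrow> lt x z"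
    and lt_sim: "x \<in> M \<Longrightarrow> y \<in> M \<Longrightarrow> z \<in> M \<Longrightarrow> lt x y \<Longrightarrow> y \<noteq> z \<Longrightarrow> \<not> lt y z \<Longrightarrow> \<not> lt z y \<Longrightarrow> lt x z"
    and sim_c: "x \<in> M \<Longrightarrow> y \<in> M \<Longrightarrow> x \<noteq> y \<Longrightarrow> \<not> lt x y \<Longrightarrow> \<not> lt y x \<Longrightarrow> c x = 0"
    and t_split: "x \<in> M \<Longrightarrow> y \<in> M \<Longrightarrow> z \<in> M \<Longrightarrow> lt x y \<Longrightarrow> lt y z \<Longrightarrow> t x z \<Longrightarrow> t x y \<and> c y = 0 \<and> t y z"
    and t_join: "x \<in> M \<Longrightarrow> y \<in> M \<Longrightarrow> z \<in> M \<Longrightarrow> t x y \<Longrightarrow> c y = 0 \<Longrightarrow> t y z \<Longrightarrow> t x z"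
    and sim_t: "x \<in> M \<Longrightarrow> y \<in> M \<Longrightarrow> z \<in> M \<Longrightarrow> x \<noteq> y \<Longrightarrow> \<not> lt x y \<Longrightarrow> \<not> lt y x \<Longrightarrow> t y z \<Longrightarrow> t x z"
    and t_sim: "x \<in> M \<Longrightarrow> y \<in> M \<Longrightarrow> z \<in> M \<Longrightarrow> t x y \<Longrightarrow> y \<noteq> z \<Longrightarrow> \<not> lt y z \<Longrightarrow> \<not> lt z y \<Longrightarrow> t x z"
begin

text \<open>The offsets, first labels up to a shift, are chosen for one neighbour at a time, with a
  maximal \<open>m\<close> last: \<open>m\<close> copies the offset of an incomparable neighbour, or
  else takes the earliest position that all smaller neighbours allow.\<close>

lemma offsets_exist:
  "\<exists>d :: 'a \<Rightarrow> int. \<forall>x\<in>M. \<forall>y\<in>M. (\<not> lt x y \<and> \<not> lt y x \<longrightarrow> d x = d y) \<and>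
     (lt x y \<longrightarrow> d x + int (c x) \<le> d y \<and> (d y = d x + int (c x) \<longleftrightarrow> t x y))"
proof -
  define good where "good N d \<longleftrightarrow> (\<forall>x\<in>N. \<forall>y\<in>N. (\<not> lt x y \<and> \<not> lt y x \<longrightarrow> d x = d y) \<and>
     (lt x y \<longrightarrow> d x + int (c x) \<le> d y \<and> (d y = d x + int (c x) \<longleftrightarrow> t x y)))" for N and d :: "'a \<Rightarrow> int"
  have irr: "\<not> lt x x" if "x \<in> M" for x using asym that by blast
  have "finite N \<Longrightarrow> N \<subseteq> M \<Longrightarrow> \<exists>d. good N d" for N
  proof (induction N rule: finite_psubset_induct)
    case (psubset N)
    show ?case
    proof (cases "N = {}")
      case False
      have "\<exists>m\<in>N. \<forall>x\<in>N. x \<noteq> m \<longrightarrow> \<not> lt m x"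
      proof (rule Finite_Set.bex_max_element[OF psubset.hyps(1) _ _ False])
        show "asymp_on N lt" using psubset.prems asym by (intro asymp_onI) blast
        show "transp_on N lt" using psubset.prems trans by (intro transp_onI) blast
      qed
      then obtain m where m': "m \<in> N" "\<forall>x\<in>N. x \<noteq> m \<longrightarrow> \<not> lt m x" by blast
      then have m: "m \<in> N" "\<not> lt m x" if "x \<in> N" for x
        using irr[of m] psubset.prems that by (cases "x = m"; auto)+
      let ?N = "N - {m}"
      note m = m'(1) m(2)
      have M: "m \<in> M" "\<And>x. x \<in> ?N \<Longrightarrow> x \<in> M" using m psubset.prems by auto
      have "?N \<subset> N" "?N \<subseteq> M" using m psubset.prems by auto
      then obtain d where d: "good ?N d" using psubset.IH by blast
      have dsim: "d x = d y" if "x \<in> ?N" "y \<in> ?N" "\<not> lt x y" "\<not> lt y x" for x y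
        using d that unfolding good_def by blast
      have dlt: "d x + int (c x) \<le> d y" "d y = d x + int (c x) \<longleftrightarrow> t x y" if "x \<in> ?N" "y \<in> ?N" "lt x y" for x y
        using d that unfolding good_def by blast+
      have ext: "\<exists>d. good N d" if a: "\<And>x. x \<in> ?N \<Longrightarrow> \<not> lt x m \<Longrightarrow> d x = a"
        "\<And>x. x \<in> ?N \<Longrightarrow> lt x m \<Longrightarrow> d x + int (c x) \<le> a \<and> (a = d x + int (c x) \<longleftrightarrow> t x m)" for a
      proof (intro exI[of _ "d(m := a)"])
        show "good N (d(m := a))"
          unfolding good_def
        proof (intro ballI)
          fix x y assume xy: "x \<in> N" "y \<in> N"
          consider "x = m" "y = m" | "x = m" "y \<in> ?N" | "y = m" "x \<in> ?N" | "x \<in> ?N" "y \<in> ?N"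
            using xy by blast
          then show "(\<not> lt x y \<and> \<not> lt y x \<longrightarrow> (d(m := a)) x = (d(m := a)) y) \<and>
            (lt x y \<longrightarrow> (d(m := a)) x + int (c x) \<le> (d(m := a)) y \<and>
              ((d(m := a)) y = (d(m := a)) x + int (c x) \<longleftrightarrow> t x y))"
          proof cases
            case 1
            then show ?thesis using m(2)[OF m(1)] by simp
          next
            case 2
            then show ?thesis using m(2)[of y] a(1)[of y] by auto
          next
            case 3
            then show ?thesis using m(2)[of x] a(1)[of x] a(2)[of x] by auto
          next
            case 4
            then show ?thesis using dsim[of x y] dlt[of x y] by auto
          qed
        qed
      qed
      show ?thesis
      proof (cases "\<exists>y\<in>?N. \<not> lt y m")
        case True
        \<comment> \<open>Such a \<open>y\<close> is incomparable to \<open>m\<close>, since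
          \<open>m\<close> is maximal, so \<open>m\<close> must and can take its offset.\<close>
        then obtain y where y: "y \<in> ?N" "\<not> lt y m" "\<not> lt m y" using m(2) by blast
        show ?thesis
        proof (rule ext[of "d y"])
          fix x assume x: "x \<in> ?N" "\<not> lt x m"
          have "\<not> lt x y" using lt_sim[of x y m] x y M by auto
          moreover have "\<not> lt y x" using sim_lt[of m y x] x y M m(2) by auto
          ultimately show "d x = d y" using dsim x y by blast
        next
          fix x assume x: "x \<in> ?N" "lt x m"
          then have xy: "lt x y" using lt_sim[of x m y] y M by auto
          have "t x y \<longleftrightarrow> t x m" using t_sim[of x y m] t_sim[of x m y] x y M by auto
          then show "d x + int (c x) \<le> d y \<and> (d y = d x + int (c x) \<longleftrightarrow> t x m)"
            using dlt[OF x(1) y(1) xy] by blast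
        qed
      next
        case False
        then have below: "\<And>y. y \<in> ?N \<Longrightarrow> lt y m" by blast
        \<comment> \<open>The earliest offset of \<open>m\<close> that respects \<open>y\<close>:
          the last label of \<open>y\<close> if they are to be tight, one more if they must not
          be.\<close>
        let ?f = "\<lambda>y. d y + int (c y) + (if t y m then 0 else 1)"
        have fin: "finite (?f ` ?N)" using psubset.hyps by simp
        show ?thesis
        proof (rule ext[of "Max (?f ` ?N)"])
          fix x assume x: "x \<in> ?N"
          have ge: "?f x \<le> Max (?f ` ?N)" using x fin by simp
          \<comment> \<open>A tight \<open>x\<close> demands equality, so no other bound may exceed
            its own. For \<open>y\<close> below \<open>x\<close> this comes from
            \<open>t_join\<close>, for \<open>y\<close> above \<open>x\<close> from
            \<open>t_split\<close>, and for incomparable \<open>y\<close> the bounds agree.\<close>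
          have "Max (?f ` ?N) \<le> d x + int (c x)" if tx: "t x m"
          proof -
            have "?f y \<le> d x + int (c x)" if y: "y \<in> ?N" for y
            proof -
              consider "lt y x" | "lt x y" | "\<not> lt x y" "\<not> lt y x" by blast
              then show ?thesis
              proof cases
                case 1
                then show ?thesis
                  using dlt[OF y x 1] t_join[of y x m] x y M tx by (cases "c x = 0") auto
              next
                case 2
                then have "t x y \<and> c y = 0 \<and> t y m" using t_split[of x y m] x y M tx below by blast
                then show ?thesis using dlt(2)[OF x y 2] by simp
              next
                case 3
                have "d y = d x" using dsim[OF y x 3(2,1)] .
                moreover have "c y = 0 \<and> t y m" if "y \<noteq> x"
                  using sim_c[of y x] sim_t[of y x m] M(1) M(2)[OF x] M(2)[OF y] tx that 3 by blast
                ultimately show ?thesis using tx by (cases "y = x") auto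
              qed
            qed
            then show ?thesis using fin x by (intro Max.boundedI) auto
          qed
          then show "d x + int (c x) \<le> Max (?f ` ?N) \<and> (Max (?f ` ?N) = d x + int (c x) \<longleftrightarrow> t x m)"
            using ge by (cases "t x m") auto
        qed (use below in blast)
      qed
    qed (simp add: good_def)
  qed
  from this[OF finite_M] show ?thesis unfolding good_def by blast
qed

end

section \<open>Forced facts and their consistency\<close>

definition sim :: "'a pair_pre_digraph \<Rightarrow> 'a \<Rightarrow> 'a \<Rightarrow> bool" where
  "sim D x y \<longleftrightarrow> x \<noteq> y \<and> (x, y) \<notin> parcs D \<and> (y, x) \<notin> parcs D"

definition adj :: "'a pair_pre_digraph \<Rightarrow> 'a \<Rightarrow> 'a \<Rightarrow> bool" where
  "adj D x y \<longleftrightarrow> (x, y) \<in> parcs D \<and> (y, x) \<in> parcs D"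

text \<open>An inclusion-minimal non-arc along the path from \<open>u\<close> to \<open>v\<close>,
  where \<open>a\<close> follows \<open>u\<close> and \<open>b\<close> precedes \<open>v\<close>:
  every proper stretch lies in one of the two stretches required to be arcs. The condition
  \<open>a \<noteq> b\<close> leaves out two-edge paths, which the order at the middle vertex
  governs.\<close>

definition bad :: "'a pair_pre_digraph \<Rightarrow> (nat \<times> 'a \<times> 'a \<times> 'a) set \<Rightarrow> 'a \<Rightarrow> 'a \<Rightarrow> 'a \<Rightarrow> 'a \<Rightarrow> bool" where
  "bad D X u a b v \<longleftrightarrow> (0, u, a, v) \<in> X \<and> (0, v, b, u) \<in> X \<and>
     (u, v) \<notin> parcs D \<and> (u, b) \<in> parcs D \<and> (a, v) \<in> parcs D \<and> a \<noteq> b"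

text \<open>The first-order form of \<open>on_path\<close>: the path from \<open>u\<close> to
  \<open>v\<close> traverses the edge from \<open>x\<close> to \<open>y\<close>.\<close>

definition on :: "(nat \<times> 'a \<times> 'a \<times> 'a) set \<Rightarrow> 'a \<Rightarrow> 'a \<Rightarrow> 'a \<Rightarrow> 'a \<Rightarrow> bool" where
  "on X x y u v \<longleftrightarrow> (0, x, y, v) \<in> X \<and> (0, y, x, u) \<in> X"

text \<open>
  Facts are tagged quadruples, padded to a common arity: \<open>(0, u, w, v)\<close> says that the path from \<open>u\<close> to \<open>v\<close>
  starts with \<open>uw\<close>; \<open>(1, x, y, _)\<close> that \<open>xy\<close> has one label; \<open>(2, x, y, _)\<close> that it has two;
  \<open>(3, x, y, z)\<close> that the last label of \<open>xy\<close> is the first of \<open>yz\<close>; \<open>(4, u, x, y)\<close> that every traversal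
  from \<open>u\<close> along a path ending with \<open>xy\<close> uses the last label of \<open>xy\<close>.
\<close>

definition derives :: "'a pair_pre_digraph \<Rightarrow> (nat \<times> 'a \<times> 'a \<times> 'a) set \<Rightarrow> nat \<Rightarrow> 'a \<Rightarrow> 'a \<Rightarrow> 'a \<Rightarrow> bool" where
  "derives D X k x y z \<longleftrightarrow> (let V = pverts D; A = (\<lambda>x y. (x, y) \<in> parcs D) in
     (k = 0 \<and> (y = z \<and> adj D x y \<or> (\<exists>p\<in>V. (0, x, y, p) \<in> X \<and> adj D p z \<and> z \<noteq> x))) \<or>
     (k = 1 \<and> ((1, y, x, x) \<in> X \<or>
        adj D x y \<and> (\<exists>w\<in>V. adj D y w \<and> sim D x w) \<or>
        (\<exists>b\<in>V. \<exists>v\<in>V. bad D X x y b v) \<or>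
        (\<exists>u\<in>V. \<exists>a\<in>V. bad D X u a y x) \<or>
        adj D x y \<and> (\<exists>p\<in>V. \<exists>q\<in>V. (3, p, y, q) \<in> X \<and> A p x \<and> A x q))) \<or>
     (k = 2 \<and> ((2, y, x, x) \<in> X \<or>
        (\<exists>u\<in>V. \<exists>a\<in>V. \<exists>b\<in>V. \<exists>v\<in>V. bad D X u a b v \<and> on X x y u v \<and> x \<noteq> u \<and> y \<noteq> v))) \<or>
     (k = 3 \<and> ((\<exists>u\<in>V. \<exists>a\<in>V. \<exists>b\<in>V. \<exists>v\<in>V. bad D X u a b v \<and> on X x y u v \<and> on X y z u v) \<or>
        adj D x y \<and> adj D y z \<and> (\<exists>w\<in>V.
          (3, x, y, w) \<in> X \<and> A x z \<and> A z w \<or>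
          (3, w, y, z) \<in> X \<and> A w x \<and> A x z \<or>
          (3, x, y, w) \<in> X \<and> (1, w, y, y) \<in> X \<and> (3, w, y, z) \<in> X \<or>
          (3, w, y, z) \<in> X \<and> sim D x w \<or>
          (3, x, y, w) \<in> X \<and> sim D z w))) \<or>
     (k = 4 \<and> (x = y \<and> (1, x, z, z) \<in> X \<or>
        (\<exists>w\<in>V. (4, x, w, y) \<in> X \<and> (3, w, y, z) \<in> X \<and> (2, y, z, z) \<in> X))))"

text \<open>\<open>X\<close> occurs only in premises and under negation, so consistency passes to
  subsets. The second group says that a traversal may be shortened by its first or its last edge;
  the last describes the dead end, a delayed traversal that meets a tight edge with one
  label.\<close>

definition consistent :: "'a pair_pre_digraph \<Rightarrow> (nat \<times> 'a \<times> 'a \<times> 'a) set \<Rightarrow> bool" where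
  "consistent D X \<longleftrightarrow> (let V = pverts D; A = (\<lambda>x y. (x, y) \<in> parcs D) in
     (\<forall>v\<in>V. \<forall>x\<in>V. \<forall>y\<in>V. \<forall>z\<in>V. adj D x v \<and> adj D y v \<and> adj D z v \<longrightarrow>
        (A x y \<and> A y z \<longrightarrow> A x z) \<and> (sim D x y \<and> A y z \<longrightarrow> A x z) \<and> (A x y \<and> sim D y z \<longrightarrow> A x z)) \<and>
     (\<forall>u\<in>V. \<forall>a\<in>V. \<forall>v\<in>V. (0, u, a, v) \<in> X \<longrightarrow>
        (A u v \<and> a \<noteq> v \<longrightarrow> A a v) \<and> (A v u \<and> a \<noteq> v \<longrightarrow> A v a)) \<and>
     (\<forall>x\<in>V. \<forall>y\<in>V. \<not> ((1, x, y, y) \<in> X \<and> (2, x, y, y) \<in> X)) \<and>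
     (\<forall>x\<in>V. \<forall>y\<in>V. \<forall>z\<in>V. (3, x, y, z) \<in> X \<longrightarrow> A x z) \<and>
     (\<forall>u\<in>V. \<forall>x\<in>V. \<forall>y\<in>V. \<forall>z\<in>V.
        (4, u, x, y) \<in> X \<and> (3, x, y, z) \<in> X \<and> (1, y, z, z) \<in> X \<longrightarrow> \<not> A u z))"

lemma consistent_antimono: "consistent D P \<Longrightarrow> X \<subseteq> P \<Longrightarrow> consistent D X"
  unfolding consistent_def Let_def by (intro conjI) (blast+)

lemma pair_digraph_arcD:
  assumes "pair_digraph D" "(x, y) \<in> parcs D"
  shows "x \<in> pverts D \<and> y \<in> pverts D \<and> x \<noteq> y"
proof -
  interpret pair_digraph D by fact
  show ?thesis using arc_fst_in_verts arc_snd_in_verts pair_no_loops assms(2) by fastforce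
qed

section \<open>Digraphs whose solid graph is a tree\<close>

locale solid_tree =
  fixes D :: "'a pair_pre_digraph"
  assumes dig: "pair_digraph D" and solid: "undirected_tree (pverts D) (solid_edges D)"
begin

sublocale utree "pverts D" "solid_edges D"
  by unfold_locales (rule solid)

abbreviation "V \<equiv> pverts D"
abbreviation arc :: "'a \<Rightarrow> 'a \<Rightarrow> bool" where "arc x y \<equiv> (x, y) \<in> parcs D"

lemma edge_iff: "{x, y} \<in> solid_edges D \<longleftrightarrow> adj D x y"
  by (auto simp: solid_edges_def adj_def doubleton_eq_iff)

lemma arcD: "arc x y \<Longrightarrow> x \<in> V \<and> y \<in> V \<and> x \<noteq> y"
  using pair_digraph_arcD[OF dig] .

lemma adjD: "adj D x y \<Longrightarrow> x \<in> V \<and> y \<in> V \<and> x \<noteq> y"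
  by (auto simp: adj_def dest: arcD)

lemma adj_sym: "adj D x y \<longleftrightarrow> adj D y x" by (auto simp: adj_def)

text \<open>Arcs both ways would make \<open>xy\<close> a solid edge and close a triangle with
  \<open>v\<close>.\<close>

lemma arc_asym: "adj D x v \<Longrightarrow> adj D y v \<Longrightarrow> arc x y \<Longrightarrow> \<not> arc y x"
  using no_triangle[of x v y] edge_iff by (auto simp: adj_def)

lemma path_adj: "path p \<Longrightarrow> Suc i < length p \<Longrightarrow> adj D (p ! i) (p ! Suc i)"
  using undirected_path_nth_edge edge_iff by metis

lemma path_nth_V: "path p \<Longrightarrow> i < length p \<Longrightarrow> p ! i \<in> V"
  by (auto simp: undirected_path_def)

lemma path_nth_eq: "path p \<Longrightarrow> i < length p \<Longrightarrow> j < length p \<Longrightarrow> p ! i = p ! j \<longleftrightarrow> i = j"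
  by (auto simp: undirected_path_def nth_eq_iff_index_eq)

text \<open>A labelled edge is traversable both ways and hence solid, so temporal paths stay in the
  solid tree. The tree path between adjacent vertices is their edge alone, so the arcs of a solid
  pair force a label on this edge.\<close>

lemma realizable_iff:
  "any_strict_realizable D \<longleftrightarrow> (\<exists>lab. (\<forall>e\<in>solid_edges D. finite (lab e) \<and> lab e \<noteq> {}) \<and>
     strict_reachability_graph V (solid_edges D) lab = D)"
proof
  assume "\<exists>lab. (\<forall>e\<in>solid_edges D. finite (lab e) \<and> lab e \<noteq> {}) \<and>
     strict_reachability_graph V (solid_edges D) lab = D"
  moreover have "simple_graph V (solid_edges D)" using solid by (simp add: undirected_tree_def)
  ultimately show "any_strict_realizable D"
    unfolding any_strict_realizable_def temporal_graph_def by blast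
next
  assume "any_strict_realizable D"
  then obtain E lab where sg: "simple_graph V E" and fin: "\<forall>e\<in>E. finite (lab e)"
    and eq: "strict_reachability_graph V E lab = D"
    by (auto simp: any_strict_realizable_def temporal_graph_def)
  have arc_iff: "arc u v \<longleftrightarrow> u \<in> V \<and> v \<in> V \<and> u \<noteq> v \<and> (\<exists>vs. undirected_path V E vs \<and> hd vs = u \<and>
      last vs = v \<and> increasing (\<lambda>i. lab {vs ! i, vs ! Suc i}) 0 (length vs - 1))" for u v
    by (subst eq[symmetric]) (simp add: strict_reachability_graph_def strict_temporal_path_iff)
  have one: "arc x y" if e: "{x, y} \<in> E" "lab {x, y} \<noteq> {}" for x y
  proof -
    have xy: "x \<noteq> y" "x \<in> V" "y \<in> V" using sg e by (auto simp: simple_graph_def)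
    obtain t where "t \<in> lab {x, y}" using e by blast
    then have "increasing (\<lambda>i. lab {[x, y] ! i, [x, y] ! Suc i}) 0 (length [x, y] - 1)"
      unfolding increasing_def by (intro exI[of _ "\<lambda>_. t"]) auto
    moreover have "undirected_path V E [x, y]"
      using e xy by (auto simp: undirected_path_def path_edges_Cons path_edges_single)
    ultimately show ?thesis unfolding arc_iff using xy by (metis last.simps list.sel(1) list.distinct(1))
  qed
  have lab_ne: "lab {vs ! k, vs ! Suc k} \<noteq> {}"
    if "increasing (\<lambda>i. lab {vs ! i, vs ! Suc i}) 0 (length vs - 1)" "Suc k < length vs" for vs k
    using that unfolding increasing_def by (metis Suc_eq_plus1 empty_iff less_diff_conv zero_le)
  have solid_path: "path vs"
    if vs: "undirected_path V E vs" "increasing (\<lambda>i. lab {vs ! i, vs ! Suc i}) 0 (length vs - 1)" for vs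
  proof -
    have "e \<in> solid_edges D" if e: "e \<in> set (path_edges vs)" for e
    proof -
      obtain k where "k < length (path_edges vs)" "path_edges vs ! k = e"
        using e unfolding in_set_conv_nth by blast
      then have k: "Suc k < length vs" "e = {vs ! k, vs ! Suc k}"
        using path_edges_nth[of k vs] by (simp_all add: length_path_edges)
      have "e \<in> E" using undirected_path_nth_edge[OF vs(1) k(1)] k by simp
      then show ?thesis using one[of "vs ! k" "vs ! Suc k"] one[of "vs ! Suc k" "vs ! k"]
          lab_ne[OF vs(2) k(1)] k edge_iff by (simp add: adj_def insert_commute)
    qed
    then show ?thesis using vs(1) by (auto simp: undirected_path_def)
  qed
  have solid_E: "{u, v} \<in> E \<and> lab {u, v} \<noteq> {}" if uv: "adj D u v" for u v
  proof -
    obtain vs where vs: "undirected_path V E vs" "hd vs = u" "last vs = v"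
        "increasing (\<lambda>i. lab {vs ! i, vs ! Suc i}) 0 (length vs - 1)"
      using uv arc_iff[of u v] unfolding adj_def by blast
    have "vs = [u, v]"
      by (rule path_unique[OF solid_path[OF vs(1,4)] path_two]) (use vs uv edge_iff in auto)
    then show ?thesis using lab_ne[OF vs(4), of 0] undirected_path_nth_edge[OF vs(1), of 0] by simp
  qed
  have sub: "e \<in> E \<and> lab e \<noteq> {}" if "e \<in> solid_edges D" for e
    using that solid_E unfolding solid_edges_def adj_def by blast
  have "parcs (strict_reachability_graph V (solid_edges D) lab) = parcs D"
  proof (intro set_eqI, clarify)
    fix u v
    have "(\<exists>vs. path vs \<and> hd vs = u \<and> last vs = v \<and> increasing (\<lambda>i. lab {vs ! i, vs ! Suc i}) 0 (length vs - 1))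
      \<longleftrightarrow> (\<exists>vs. undirected_path V E vs \<and> hd vs = u \<and> last vs = v \<and>
        increasing (\<lambda>i. lab {vs ! i, vs ! Suc i}) 0 (length vs - 1))"
    proof
      assume "\<exists>vs. path vs \<and> hd vs = u \<and> last vs = v \<and>
        increasing (\<lambda>i. lab {vs ! i, vs ! Suc i}) 0 (length vs - 1)"
      moreover have "path vs \<Longrightarrow> undirected_path V E vs" for vs
        using sub by (auto simp: undirected_path_def)
      ultimately show "\<exists>vs. undirected_path V E vs \<and> hd vs = u \<and> last vs = v \<and>
        increasing (\<lambda>i. lab {vs ! i, vs ! Suc i}) 0 (length vs - 1)" by blast
    qed (use solid_path in blast)
    then show "(u, v) \<in> parcs (strict_reachability_graph V (solid_edges D) lab) \<longleftrightarrow> (u, v) \<in> parcs D"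
      using arc_iff[of u v] by (simp add: strict_reachability_graph_def strict_temporal_path_iff)
  qed
  then have "strict_reachability_graph V (solid_edges D) lab = D"
    by (simp add: strict_reachability_graph_def)
  with sub fin show "\<exists>lab. (\<forall>e\<in>solid_edges D. finite (lab e) \<and> lab e \<noteq> {}) \<and>
     strict_reachability_graph V (solid_edges D) lab = D" by blast
qed


section \<open>From a consistent candidate to a labelling\<close>

text \<open>Leastness of \<open>X\<close> enters only through \<open>X0\<close>. The labelling makes
  tight exactly the pairs in \<open>X\<close>, along arcs between neighbours. Arcs are then
  traversable since a delay is recorded by tag 4 and cannot meet a dead end; a minimal non-arc is
  blocked since the rules for tags 1 to 3 recreate the pattern of
  \<open>tight_blocked\<close>.\<close>

lemma realizable_if_consistent:
  assumes closed: "\<And>k x y z. k < 5 \<Longrightarrow> x \<in> V \<Longrightarrow> y \<in> V \<Longrightarrow> z \<in> V \<Longrightarrow> derives D X k x y z \<Longrightarrow> (k, x, y, z) \<in> X"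
    and X0: "\<And>u w v. (0, u, w, v) \<in> X \<longleftrightarrow> side u w v"
    and cons: "consistent D X"
  shows "any_strict_realizable D"
proof -
  define S where "S x y \<longleftrightarrow> (1, x, y, y) \<in> X" for x y
  define Db where "Db x y \<longleftrightarrow> (2, x, y, y) \<in> X" for x y
  define T where "T x y z \<longleftrightarrow> (3, x, y, z) \<in> X" for x y z
  define Pat where "Pat u x y \<longleftrightarrow> (4, u, x, y) \<in> X" for u x y
  note defs = S_def Db_def T_def Pat_def
  have S_sym: "S x y \<longleftrightarrow> S y x" if "adj D x y" for x y
  proof -
    have "derives D X 1 a b b" if "S b a" for a b
      using that unfolding derives_def Let_def S_def by simp
    then show ?thesis using closed[of 1 x y y] closed[of 1 y x x] adjD[OF that] unfolding S_def by simp blast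
  qed
  have Db_sym: "Db x y \<longleftrightarrow> Db y x" if "adj D x y" for x y
  proof -
    have "derives D X 2 a b b" if "Db b a" for a b
      using that unfolding derives_def Let_def Db_def by simp
    then show ?thesis using closed[of 2 x y y] closed[of 2 y x x] adjD[OF that] unfolding Db_def by simp blast
  qed
  have S_sim: "S x v" if "adj D x v" "adj D y v" "sim D x y" for x y v
  proof -
    have "derives D X 1 x v v"
      unfolding derives_def Let_def using that adj_sym[of y v] adjD[OF that(2)] by auto
    then show ?thesis using closed[of 1 x v v] adjD[OF that(1)] by (simp add: S_def)
  qed
  have S_mid: "S y v" if "adj D x v" "adj D y v" "adj D z v" "arc x y" "arc y z" "T x v z" for x y z v
  proof -
    have "derives D X 1 y v v"
      unfolding derives_def Let_def using that adjD[OF that(1)] adjD[OF that(3)] unfolding T_def by auto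
    then show ?thesis using closed[of 1 y v v] adjD[OF that(2)] by (simp add: S_def)
  qed
  have T_rule: "T x v z" if "adj D x v" "adj D z v" "adj D w v"
      "T x v w \<and> arc x z \<and> arc z w \<or> T w v z \<and> arc w x \<and> arc x z \<or> T x v w \<and> S w v \<and> T w v z \<or>
       T w v z \<and> sim D x w \<or> T x v w \<and> sim D z w" for x v z w
  proof -
    have "derives D X 3 x v z"
      unfolding derives_def Let_def using that adjD[OF that(3)] adj_sym unfolding defs by simp blast
    then show ?thesis using closed[of 3 x v z] adjD[OF that(1)] adjD[OF that(2)] by (simp add: defs)
  qed
  have T_arc: "arc x z" if "adj D x v" "adj D z v" "T x v z" for x v z
    using cons adjD[OF that(1)] adjD[OF that(2)] that(3) unfolding consistent_def Let_def defs by blast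
  have SD: "\<not> (S x y \<and> Db x y)" if "adj D x y" for x y
    using cons adjD[OF that] unfolding consistent_def Let_def defs by blast
  have order: "(arc x y \<and> arc y z \<longrightarrow> arc x z) \<and> (sim D x y \<and> arc y z \<longrightarrow> arc x z) \<and> (arc x y \<and> sim D y z \<longrightarrow> arc x z)"
    if "adj D x v" "adj D y v" "adj D z v" for x y z v
    using cons adjD[OF that(1)] adjD[OF that(2)] adjD[OF that(3)] that unfolding consistent_def Let_def by blast

  \<comment> \<open>One less than the number of labels. An edge on which nothing is forced gets
    three labels, the default with the most slack.\<close>
  define c where "c x y = (if S x y then 0 else if Db x y then 1 else 2 :: nat)" for x y
  have c_sym: "c x y = c y x" if "adj D x y" for x y
    using S_sym[OF that] Db_sym[OF that] by (simp add: c_def)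
  have "\<exists>d :: 'a \<Rightarrow> int. \<forall>x\<in>{x. adj D x v}. \<forall>y\<in>{x. adj D x v}. (\<not> arc x y \<and> \<not> arc y x \<longrightarrow> d x = d y) \<and>
     (arc x y \<longrightarrow> d x + int (c x v) \<le> d y \<and> (d y = d x + int (c x v) \<longleftrightarrow> T x v y))" for v
  proof (rule local_order.offsets_exist, unfold_locales)
    show "finite {x. adj D x v}" by (rule finite_subset[OF _ finite_V]) (auto dest: adjD)
  next
    fix x y z assume "x \<in> {x. adj D x v}" "y \<in> {x. adj D x v}" "z \<in> {x. adj D x v}"
    then have a: "adj D x v" "adj D y v" "adj D z v" by auto
    show "arc x z" if "arc x y" "arc y z" using order[OF a] that by blast
    show "arc x z" if "x \<noteq> y" "\<not> arc x y" "\<not> arc y x" "arc y z"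
      using order[OF a] that by (simp add: sim_def)
    show "arc x z" if "arc x y" "y \<noteq> z" "\<not> arc y z" "\<not> arc z y"
      using order[OF a] that by (simp add: sim_def)
    show "T x v y \<and> c y v = 0 \<and> T y v z" if "arc x y" "arc y z" "T x v z"
      using T_rule[OF a(1,2,3)] T_rule[OF a(2,3,1)] S_mid[OF a] that by (simp add: c_def)
    show "T x v z" if "T x v y" "c y v = 0" "T y v z"
      using T_rule[OF a(1,3,2)] that by (simp add: c_def split: if_splits)
    show "T x v z" if "x \<noteq> y" "\<not> arc x y" "\<not> arc y x" "T y v z"
      using T_rule[OF a(1,3,2)] that by (simp add: sim_def)
    show "T x v z" if "T x v y" "y \<noteq> z" "\<not> arc y z" "\<not> arc z y"
      using T_rule[OF a(1,3,2)] that by (simp add: sim_def)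
  next
    fix x y assume "x \<in> {x. adj D x v}" "y \<in> {x. adj D x v}"
    then have a: "adj D x v" "adj D y v" by auto
    show "\<not> arc y x" if "arc x y" using arc_asym[OF a that] .
    show "c x v = 0" if "x \<noteq> y" "\<not> arc x y" "\<not> arc y x"
      using S_sim[OF a] that by (simp add: sim_def c_def)
  qed
  then obtain d :: "'a \<Rightarrow> 'a \<Rightarrow> int" where d: "\<And>v x y. adj D x v \<Longrightarrow> adj D y v \<Longrightarrow>
      (\<not> arc x y \<and> \<not> arc y x \<longrightarrow> d v x = d v y) \<and>
      (arc x y \<longrightarrow> d v x + int (c x v) \<le> d v y \<and> (d v y = d v x + int (c x v) \<longleftrightarrow> T x v y))"
    by (simp add: Ball_def) metis
  \<comment> \<open>The two ends of an edge have chosen offsets for it independently; shifting all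
    offsets at \<open>x\<close> by \<open>h x\<close> makes \<open>h x + d x y\<close> and
    \<open>h y + d y x\<close> agree.\<close>
  obtain h where h: "\<And>x y. adj D x y \<Longrightarrow> h y - h x = d x y - d y x"
    using potential_exists[of "\<lambda>x y. d x y - d y x"] edge_iff by auto
  \<comment> \<open>A bound on all absolute values, added because labels are natural
    numbers.\<close>
  define K where "K = (\<Sum>x\<in>V. \<Sum>y\<in>V. \<bar>h x + d x y\<bar>)"
  define B where "B x y = nat (h x + d x y + K)" for x y
  have pos: "0 \<le> h x + d x y + K" if "adj D x y" for x y
  proof -
    have "\<bar>h x + d x y\<bar> \<le> (\<Sum>y\<in>V. \<bar>h x + d x y\<bar>)"
      using adjD[OF that] finite_V by (intro member_le_sum) auto
    also have "\<dots> \<le> K" unfolding K_def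
      using adjD[OF that] finite_V by (intro member_le_sum) (auto intro: sum_nonneg)
    finally show ?thesis by linarith
  qed
  have B_sym: "B x y = B y x" if "adj D x y" for x y
    using h[OF that] by (simp add: B_def algebra_simps)
  have B_order: "arc x y \<Longrightarrow> B x v + c x v \<le> B v y \<and> (B v y = B x v + c x v \<longleftrightarrow> T x v y)"
    "\<not> arc x y \<Longrightarrow> \<not> arc y x \<Longrightarrow> B x v = B v y" if a: "adj D x v" "adj D y v" for x y v
  proof -
    have "B x v = nat (h v + d v x + K)" using B_sym[OF a(1)] by (simp add: B_def)
    moreover have "0 \<le> h v + d v x + K" "0 \<le> h v + d v y + K" using pos a adj_sym by blast+
    ultimately show "arc x y \<Longrightarrow> B x v + c x v \<le> B v y \<and> (B v y = B x v + c x v \<longleftrightarrow> T x v y)"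
      "\<not> arc x y \<Longrightarrow> \<not> arc y x \<Longrightarrow> B x v = B v y"
      using d[OF a] by (auto simp: B_def)
  qed

  \<comment> \<open>Labels belong to an unordered pair; symmetry of \<open>B\<close> and
    \<open>c\<close> makes the choice of the orientation immaterial.\<close>
  define lab where "lab e = (SOME s. \<exists>x y. e = {x, y} \<and> s = {B x y..B x y + c x y})" for e
  have lab: "lab {x, y} = {B x y..B x y + c x y}" if "adj D x y" for x y
    unfolding lab_def
  proof (rule some_equality)
    fix s assume "\<exists>x' y'. {x, y} = {x', y'} \<and> s = {B x' y'..B x' y' + c x' y'}"
    then show "s = {B x y..B x y + c x y}"
      using B_sym[OF that] c_sym[OF that] by (auto simp: doubleton_eq_iff)
  qed blast
  have lab_ok: "finite (lab e) \<and> lab e \<noteq> {}" if "e \<in> solid_edges D" for e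
    using that lab unfolding solid_edges_def adj_def by fastforce

  have main: "increasing (\<lambda>k. lab {p ! k, p ! Suc k}) 0 (length p - 1) \<longleftrightarrow> arc (hd p) (last p)"
    if p: "path p" and len: "2 \<le> length p" for p
  proof -
    define l where "l = length p - 1"
    have ll: "length p = Suc l" "0 < l" using len by (auto simp: l_def)
    define b where "b k = B (p ! k) (p ! Suc k)" for k
    define e where "e k = c (p ! k) (p ! Suc k)" for k
    have hl: "hd p = p ! 0" "last p = p ! l"
      using p by (auto simp: l_def hd_conv_nth last_conv_nth undirected_path_def)
    have inc: "increasing (\<lambda>k. lab {p ! k, p ! Suc k}) i j \<longleftrightarrow> increasing (\<lambda>k. {b k..b k + e k}) i j" if "j \<le> l" for i j
      by (rule increasing_cong) (use that ll lab path_adj[OF p] in \<open>auto simp: b_def e_def\<close>)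
    have V: "p ! k \<in> V" if "k \<le> l" for k using path_nth_V[OF p] that ll by auto
    have ad: "adj D (p ! k) (p ! Suc k)" "adj D (p ! Suc k) (p ! k)" if "k < l" for k
      using path_adj[OF p] that ll adj_sym by auto
    \<comment> \<open>The second group of consistency clauses, iterated: it drops leading vertices
      first and trailing ones afterwards.\<close>
    have sub: "arc (p ! i') (p ! j')" if "arc (p ! i) (p ! j)" "i \<le> i'" "i' < j'" "j' \<le> j" "j \<le> l" for i j i' j'
    proof -
      have 1: "arc (p ! i') (p ! j)" if "i \<le> i'" "i' < j" for i'
        using that
      proof (induction rule: dec_induct)
        case (step k)
        have "(0, p ! k, p ! Suc k, p ! j) \<in> X" using X0 side_nth[OF p, of k j] step \<open>j \<le> l\<close> ll by auto
        moreover have "p ! Suc k \<noteq> p ! j" using path_nth_eq[OF p, of "Suc k" j] step \<open>j \<le> l\<close> ll by auto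
        ultimately show ?case
          using step V[of k] V[of "Suc k"] V[of j] \<open>j \<le> l\<close> cons unfolding consistent_def Let_def by auto
      qed (use \<open>arc (p ! i) (p ! j)\<close> in simp)
      have "arc (p ! i') (p ! j')" if "j' \<le> j" "i' < j'" for j'
        using that
      proof (induction rule: inc_induct)
        case (step k)
        have "(0, p ! Suc k, p ! k, p ! i') \<in> X" using X0 side_nth_rev[OF p, of i' k] step \<open>j \<le> l\<close> ll by auto
        moreover have "p ! k \<noteq> p ! i'" using path_nth_eq[OF p, of k i'] step \<open>j \<le> l\<close> ll by auto
        ultimately show ?case
          using step V[of k] V[of "Suc k"] V[of i'] \<open>j \<le> l\<close> cons unfolding consistent_def Let_def by auto
      qed (use 1 that \<open>i \<le> i'\<close> in simp)
      then show ?thesis using that by blast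
    qed
    show ?thesis
    proof
      assume a: "arc (hd p) (last p)"
      have two: "arc (p ! k) (p ! Suc (Suc k))" if "Suc k < l" for k
        using sub[of 0 l k "Suc (Suc k)"] a that hl by simp
      have loc: "b k + e k \<le> b (Suc k)" "b (Suc k) = b k + e k \<longleftrightarrow> T (p ! k) (p ! Suc k) (p ! Suc (Suc k))"
        if "Suc k < l" for k
        using B_order(1)[of "p ! k" "p ! Suc k" "p ! Suc (Suc k)"] two[OF that] ad that by (auto simp: b_def e_def)
      \<comment> \<open>The delay must remember the vertex \<open>p ! m\<close> where it began,
        since the dead-end clause speaks of the arc that starts there.\<close>
      define dl where "dl k \<longleftrightarrow> (\<exists>m\<le>k. Pat (p ! m) (p ! k) (p ! Suc k))" for k
      have "increasing (\<lambda>k. {b k..b k + e k}) 0 l"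
      proof (rule greedy_traversal[where dl = dl])
        fix k assume k: "Suc k < l"
        show "b k + e k \<le> b (Suc k)" using loc k by blast
        assume dk: "dl k" and bk: "b (Suc k) = b k + e k"
        then obtain m where m: "m \<le> k" "Pat (p ! m) (p ! k) (p ! Suc k)" by (auto simp: dl_def)
        have t: "T (p ! k) (p ! Suc k) (p ! Suc (Suc k))" using loc(2)[OF k] bk by blast
        have v: "p ! m \<in> V" "p ! k \<in> V" "p ! Suc k \<in> V" "p ! Suc (Suc k) \<in> V" using V k m by auto
        show "dl (Suc k)" if "e (Suc k) = 1"
        proof -
          have "Db (p ! Suc k) (p ! Suc (Suc k))" using that by (auto simp: e_def c_def split: if_splits)
          then have "derives D X 4 (p ! m) (p ! Suc k) (p ! Suc (Suc k))"
            using m t v by (auto simp: derives_def defs)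
          then have "Pat (p ! m) (p ! Suc k) (p ! Suc (Suc k))" using closed[of 4] v by (simp add: Pat_def)
          then show ?thesis using m(1) unfolding dl_def by (intro exI[of _ m]) simp
        qed
        show "e (Suc k) \<noteq> 0"
        proof
          assume "e (Suc k) = 0"
          then have "S (p ! Suc k) (p ! Suc (Suc k))" by (auto simp: e_def c_def split: if_splits)
          then have "\<not> arc (p ! m) (p ! Suc (Suc k))"
            using cons m t v unfolding consistent_def Let_def defs by blast
          moreover have "arc (p ! m) (p ! Suc (Suc k))" using sub[of 0 l m "Suc (Suc k)"] a k m(1) hl by simp
          ultimately show False by blast
        qed
      next
        fix k assume k: "k < l"
        show "e k \<le> 2" by (simp add: e_def c_def)
        assume "e k = 0"
        then have "S (p ! k) (p ! Suc k)" by (auto simp: e_def c_def split: if_splits)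
        then have "derives D X 4 (p ! k) (p ! k) (p ! Suc k)" by (simp add: derives_def defs)
        then have "Pat (p ! k) (p ! k) (p ! Suc k)" using closed[of 4] V k by (simp add: Pat_def)
        then show "dl k" unfolding dl_def by blast
      qed
      then show "increasing (\<lambda>k. lab {p ! k, p ! Suc k}) 0 (length p - 1)"
        using inc[of l 0] by (simp add: l_def)
    next
      assume i: "increasing (\<lambda>k. lab {p ! k, p ! Suc k}) 0 (length p - 1)"
      show "arc (hd p) (last p)"
      proof (rule ccontr)
        assume na: "\<not> arc (hd p) (last p)"
        \<comment> \<open>A shortest non-arc on the path: its two stretches that are one edge
          shorter are arcs, which is what \<open>bad\<close> asks for.\<close>
        define Q where "Q n \<longleftrightarrow> (\<exists>i. i + n \<le> l \<and> 0 < n \<and> \<not> arc (p ! i) (p ! (i + n)))" for n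
        have "Q l" unfolding Q_def using na hl ll by (intro exI[of _ 0]) simp
        then have ex: "\<exists>n. Q n" by blast
        define n where "n = (LEAST n. Q n)"
        have Qn: "Q n" unfolding n_def using ex by (rule LeastI_ex)
        have least: "\<not> Q n'" if "n' < n" for n' using that not_less_Least unfolding n_def by blast
        obtain i where i: "i + n \<le> l" "0 < n" "\<not> arc (p ! i) (p ! (i + n))" using Qn by (auto simp: Q_def)
        have n2: "2 \<le> n"
        proof (rule ccontr)
          assume "\<not> 2 \<le> n"
          then have "n = 1" using i by simp
          then show False using i ad(1)[of i] by (simp add: adj_def)
        qed
        have fwd: "arc (p ! i) (p ! (i + (n - 1)))" using least[of "n - 1"] i n2 unfolding Q_def by auto
        have bwd: "arc (p ! Suc i) (p ! (i + n))"
        proof -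
          have "Suc i + (n - 1) = i + n" using n2 by simp
          moreover have "\<not> (Suc i + (n - 1) \<le> l \<and> 0 < n - 1 \<and> \<not> arc (p ! Suc i) (p ! (Suc i + (n - 1))))"
            using least[of "n - 1"] n2 unfolding Q_def not_ex by (metis One_nat_def diff_less i(2) zero_less_one)
          ultimately show ?thesis using i n2 by simp
        qed
        have "\<not> increasing (\<lambda>k. {b k..b k + e k}) i (i + n)"
        proof (cases "n = 2")
          case True
          have a: "adj D (p ! i) (p ! Suc i)" "adj D (p ! Suc (Suc i)) (p ! Suc i)" using ad i True by auto
          have a': "adj D (p ! Suc i) (p ! Suc (Suc i))" "adj D (p ! Suc i) (p ! i)" using a adj_sym by blast+
          \<comment> \<open>No label of the second edge exceeds the first label of the first edge:
            either the reverse arc orders them so, or both edges carry the same single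
            label.\<close>
          have "b (Suc i) + e (Suc i) \<le> b i"
          proof (cases "arc (p ! Suc (Suc i)) (p ! i)")
            case True
            then show ?thesis using B_order(1)[OF a(2,1) True] B_sym[OF a(1)] B_sym[OF a(2)] c_sym[OF a(2)]
              by (simp add: b_def e_def)
          next
            case False
            have na: "\<not> arc (p ! i) (p ! Suc (Suc i))" using i \<open>n = 2\<close> by simp
            have "p ! i \<noteq> p ! Suc (Suc i)" using path_nth_eq[OF p, of i "Suc (Suc i)"] i \<open>n = 2\<close> ll by auto
            then have "sim D (p ! Suc (Suc i)) (p ! i)" using False na by (auto simp: sim_def)
            then have "c (p ! Suc (Suc i)) (p ! Suc i) = 0" using S_sim[OF a(2,1)] by (simp add: c_def)
            then show ?thesis using B_order(2)[OF a na False] c_sym[OF a(2)] by (simp add: b_def e_def)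
          qed
          then show ?thesis unfolding True increasing_two by fastforce
        next
          case False
          then have n3: "3 \<le> n" using n2 by simp
          let ?u = "p ! i" and ?a = "p ! Suc i" and ?b = "p ! (i + (n - 1))" and ?v = "p ! (i + n)"
          have sn: "Suc (i + (n - 1)) = i + n" using n2 by simp
          have bd: "bad D X ?u ?a ?b ?v"
            unfolding bad_def
          proof (intro conjI)
            show "(0, ?u, ?a, ?v) \<in> X" using X0 side_nth[OF p, of i "i + n"] i ll by simp
            show "(0, ?v, ?b, ?u) \<in> X" using X0 side_nth_rev[OF p, of i "i + (n - 1)"] i ll sn by simp
            show "?a \<noteq> ?b" using path_nth_eq[OF p, of "Suc i" "i + (n - 1)"] i ll n3 by auto
          qed (use i fwd bwd in auto)
          have v: "?u \<in> V" "?a \<in> V" "?b \<in> V" "?v \<in> V" using V i n2 by auto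
          have on: "on X (p ! k) (p ! Suc k) ?u ?v" if "i \<le> k" "k < i + n" for k
            unfolding on_def using X0 side_nth[OF p, of k "i + n"] side_nth_rev[OF p, of i k] that i ll by auto
          have "derives D X 1 ?u ?a ?a" using bd v unfolding derives_def Let_def by auto
          then have s1: "S ?u ?a" using closed v by (simp add: S_def)
          have "derives D X 1 ?v ?b ?b" using bd v unfolding derives_def Let_def by auto
          then have "S ?v ?b" using closed v by (simp add: S_def)
          then have s2: "S ?b ?v" using S_sym[of ?b ?v] ad(1)[of "i + (n - 1)"] i sn by simp
          have s3: "Db (p ! k) (p ! Suc k)" if k: "i < k" "Suc k < i + n" for k
          proof -
            have "p ! k \<noteq> ?u" "p ! Suc k \<noteq> ?v" using path_nth_eq[OF p] k i ll by auto
            then have "derives D X 2 (p ! k) (p ! Suc k) (p ! Suc k)"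
              using bd v on[of k] k unfolding derives_def Let_def by auto
            then show ?thesis using closed[of 2] V k i by (simp add: Db_def)
          qed
          have s4: "T (p ! k) (p ! Suc k) (p ! Suc (Suc k))" if k: "i \<le> k" "Suc k < i + n" for k
          proof -
            have "derives D X 3 (p ! k) (p ! Suc k) (p ! Suc (Suc k))"
              using bd v on[of k] on[of "Suc k"] k unfolding derives_def Let_def by auto
            then show ?thesis using closed[of 3] V k i by (simp add: T_def)
          qed
          \<comment> \<open>\<open>s1\<close> to \<open>s4\<close> are the forced facts of this
            minimal non-arc. Consistency turns them into actual counts and actual tightness, through
            \<open>SD\<close> and \<open>T_arc\<close>.\<close>
          have "\<not> increasing (\<lambda>k. {b (i + k)..b (i + k) + e (i + k)}) 0 n"
          proof (rule tight_blocked[OF n2])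
            fix k assume k: "Suc k < n"
            then have t: "T (p ! (i + k)) (p ! Suc (i + k)) (p ! Suc (Suc (i + k)))" using s4[of "i + k"] by simp
            have a: "adj D (p ! (i + k)) (p ! Suc (i + k))" "adj D (p ! Suc (Suc (i + k))) (p ! Suc (i + k))"
              using ad k i by auto
            show "b (i + Suc k) = b (i + k) + e (i + k)"
              using B_order(1)[OF a T_arc[OF a t]] t by (simp add: b_def e_def)
          next
            show "e (i + 0) = 0" using s1 by (simp add: e_def c_def)
            show "e (i + (n - 1)) = 0" using s2 sn by (simp add: e_def c_def)
            fix k assume k: "0 < k" "Suc k < n"
            have "Db (p ! (i + k)) (p ! Suc (i + k))" using s3[of "i + k"] k by simp
            then show "e (i + k) = 1" using SD[OF ad(1)[of "i + k"]] k i by (simp add: e_def c_def)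
          qed
          then show ?thesis using increasing_shift[of "\<lambda>k. {b k..b k + e k}" i n] by simp
        qed
        moreover have "increasing (\<lambda>k. {b k..b k + e k}) i (i + n)"
          by (rule increasing_sub[of _ 0 l]) (use \<open>increasing (\<lambda>k. lab {p ! k, p ! Suc k}) 0 (length p - 1)\<close> inc[of l 0] i in \<open>simp_all add: l_def\<close>)
        ultimately show False by blast
      qed
    qed
  qed
  have "parcs (strict_reachability_graph V (solid_edges D) lab) = parcs D"
  proof (intro set_eqI, clarify)
    fix u v
    show "(u, v) \<in> parcs (strict_reachability_graph V (solid_edges D) lab) \<longleftrightarrow> (u, v) \<in> parcs D"
    proof (cases "u \<in> V \<and> v \<in> V \<and> u \<noteq> v")
      case True
      then obtain p where p: "path p" "hd p = u" "last p = v" using path_exists by blast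
      have "2 \<le> length p"
        using p True by (cases p; cases "tl p") (auto simp: undirected_path_def)
      then show ?thesis
        using main[OF p(1)] reach_iff[OF p(1), of 0 "length p - 1"] p
        by (simp add: hd_conv_nth last_conv_nth undirected_path_def)
    next
      case False
      then show ?thesis using arcD[of u v] by (auto simp: strict_reachability_graph_def)
    qed
  qed
  then have "strict_reachability_graph V (solid_edges D) lab = D"
    by (simp add: strict_reachability_graph_def)
  then show ?thesis unfolding realizable_iff using lab_ok by blast
qed

end

lemma bad_mono: "Z \<subseteq> P \<Longrightarrow> bad D Z u a b v \<Longrightarrow> bad D P u a b v"
  by (auto simp: bad_def)

lemma on_mono: "Z \<subseteq> P \<Longrightarrow> on Z x y u v \<Longrightarrow> on P x y u v"
  by (auto simp: on_def)

text \<open>Candidate facts occur only positively in the rules; the negated conditions concern arcs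
  and equality of vertices.\<close>

lemma derives_mono: "Z \<subseteq> P \<Longrightarrow> derives D Z k x y z \<Longrightarrow> derives D P k x y z"
  unfolding derives_def Let_def Bex_def
  by (elim disj_forward conj_forward ex_forward;
      (assumption | erule (1) bad_mono | erule (1) on_mono | erule (1) subsetD))

section \<open>From a realization to a consistent candidate\<close>

context solid_tree
begin

text \<open>\<open>P\<close> collects all facts true in the given realization, forced or accidental.
  It is closed because every rule is sound for actual labels; a least closed set then lies below
  it.\<close>

lemma consistent_if_realizable:
  assumes "any_strict_realizable D"
  obtains P where "consistent D P" "\<And>u w v. (0, u, w, v) \<in> P \<longleftrightarrow> side u w v"
    "\<And>k x y z. x \<in> V \<Longrightarrow> y \<in> V \<Longrightarrow> z \<in> V \<Longrightarrow> derives D P k x y z \<Longrightarrow> (k, x, y, z) \<in> P"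
proof -
  obtain lab where fin0: "\<forall>e\<in>solid_edges D. finite (lab e) \<and> lab e \<noteq> {}"
    and eq: "strict_reachability_graph V (solid_edges D) lab = D"
    using assms unfolding realizable_iff by blast
  have fin: "finite (lab {x, y}) \<and> lab {x, y} \<noteq> {}" if "adj D x y" for x y
    using fin0 that by (simp add: edge_iff)
  have arc_iff: "arc (p ! i) (p ! j) \<longleftrightarrow> increasing (\<lambda>k. lab {p ! k, p ! Suc k}) i j"
    if "path p" "i < j" "j < length p" for p i j
    using reach_iff[OF that, of lab] unfolding eq .
  let ?lo = "\<lambda>x y. Min (lab {x, y})" and ?hi = "\<lambda>x y. Max (lab {x, y})"
  have comm: "lab {x, y} = lab {y, x}" for x y by (simp add: insert_commute)
  have lohi: "?lo x y \<le> ?hi x y" if "adj D x y" for x y using fin[OF that] by simp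
  have arc2: "arc x z \<longleftrightarrow> ?lo x v < ?hi v z" if "adj D x v" "adj D z v" "x \<noteq> z" for x z v
  proof -
    have a: "adj D v z" using that adj_sym by blast
    have p: "path [x, v, z]" by (rule path_three) (use that a edge_iff in auto)
    have "arc x z \<longleftrightarrow> increasing (\<lambda>k. lab {[x, v, z] ! k, [x, v, z] ! Suc k}) 0 (0 + 2)"
      using arc_iff[OF p, of 0 "0 + 2"] by (simp add: numeral_2_eq_2)
    also have "\<dots> \<longleftrightarrow> ?lo x v < ?hi v z"
      unfolding increasing_two using Min_less_Max_iff[of "lab {x, v}" "lab {v, z}"] fin[OF that(1)] fin[OF a] by simp
    finally show ?thesis .
  qed
  \<comment> \<open>The reverse arc is absent by \<open>arc_asym\<close>, so no label of
    \<open>vz\<close> is smaller than a label of \<open>xv\<close>.\<close>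
  have le: "?hi x v \<le> ?lo v z" if "adj D x v" "adj D z v" "arc x z" for x z v
  proof -
    have "\<not> arc z x" "x \<noteq> z" using arc_asym[OF that] arcD[OF that(3)] by auto
    then show ?thesis using arc2[OF that(2,1)] comm[of z v] comm[of v x] by auto
  qed
  \<comment> \<open>With neither direction traversable, no label of one edge is below a label of the
    other, so all these labels coincide.\<close>
  have simD: "card (lab {x, v}) = 1 \<and> lab {v, z} = lab {x, v}" if "adj D x v" "adj D z v" "sim D x z" for x z v
  proof -
    have n: "x \<noteq> z" "\<not> arc x z" "\<not> arc z x" using that(3) by (auto simp: sim_def)
    have a: "adj D v z" using that adj_sym by blast
    have "?hi v z \<le> ?lo x v" "?hi x v \<le> ?lo v z"
      using arc2[OF that(1,2)] arc2[OF that(2,1)] n comm[of z v] comm[of v x] by auto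
    then have eqs: "?lo x v = ?hi x v" "?lo v z = ?hi v z" "?lo x v = ?lo v z"
      using lohi[OF that(1)] lohi[OF a] by auto
    have "s = {Min s}" if "finite s" "s \<noteq> {}" "Min s = Max s" for s :: "nat set"
    proof -
      have "t = Min s" if "t \<in> s" for t
        using that \<open>finite s\<close> \<open>Min s = Max s\<close> by (metis Max_ge Min_le le_antisym)
      then show ?thesis using \<open>s \<noteq> {}\<close> by blast
    qed
    then have l: "lab {x, v} = {?lo x v}" "lab {v, z} = {?lo x v}"
      using fin[OF that(1)] fin[OF a] eqs by metis+
    then have "card (lab {x, v}) = 1" by (metis is_singletonI is_singleton_altdef)
    then show ?thesis using l by metis
  qed
  have single: "?lo x y = ?hi x y" if "card (lab {x, y}) = 1" for x y
    using that by (auto simp: card_1_singleton_iff)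
  have pair: "t = ?hi x y" if "card (lab {x, y}) = 2" "t \<in> lab {x, y}" "?lo x y < t" for x y t
    using that by (auto simp: card_2_iff min_def max_def split: if_splits)

  \<comment> \<open>\<open>l\<close> is the index of the last edge; the bound holds vacuously when
    the path has no traversal.\<close>
  define late where "late u x y \<longleftrightarrow> (\<exists>p l. path p \<and> hd p = u \<and> length p = Suc (Suc l) \<and> p ! l = x \<and> last p = y \<and>
    (\<forall>\<tau>. (\<forall>k\<le>l. \<tau> k \<in> lab {p ! k, p ! Suc k}) \<longrightarrow> (\<forall>k<l. \<tau> k < \<tau> (Suc k)) \<longrightarrow> ?hi x y \<le> \<tau> l))" for u x y
  define tight where "tight x y z \<longleftrightarrow> adj D x y \<and> adj D y z \<and> arc x z \<and> ?hi x y = ?lo y z" for x y z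
  define P where "P = {(k, x, y, z). (k = 0 \<and> side x y z) \<or> (k = 1 \<and> adj D x y \<and> card (lab {x, y}) = 1) \<or>
    (k = 2 \<and> adj D x y \<and> card (lab {x, y}) = 2) \<or> (k = 3 \<and> tight x y z) \<or> (k = (4::nat) \<and> late x y z)}"
  have P: "(0, x, y, z) \<in> P \<longleftrightarrow> side x y z"
    "(1, x, y, z) \<in> P \<longleftrightarrow> adj D x y \<and> card (lab {x, y}) = 1"
    "(2, x, y, z) \<in> P \<longleftrightarrow> adj D x y \<and> card (lab {x, y}) = 2"
    "(3, x, y, z) \<in> P \<longleftrightarrow> tight x y z"
    "(4, x, y, z) \<in> P \<longleftrightarrow> late x y z" for x y z by (auto simp: P_def)

  \<comment> \<open>Tightness rewrites the bound \<open>?hi x y\<close> as \<open>?lo y z\<close>,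
    and the arc from \<open>x\<close> to \<open>z\<close> gives \<open>x \<noteq> z\<close>, so
    prolonging by \<open>z\<close> does not backtrack.\<close>
  have extend: "\<exists>p l. path (p @ [z]) \<and> path p \<and> hd p = u \<and> length p = Suc (Suc l) \<and> p ! l = x \<and> p ! Suc l = y \<and>
    (\<forall>\<tau>. (\<forall>k\<le>l. \<tau> k \<in> lab {p ! k, p ! Suc k}) \<longrightarrow> (\<forall>k<l. \<tau> k < \<tau> (Suc k)) \<longrightarrow> ?lo y z \<le> \<tau> l)"
    if h: "late u x y" "tight x y z" for u x y z
  proof -
    obtain p l where p: "path p" "hd p = u" "length p = Suc (Suc l)" "p ! l = x" "last p = y"
      "\<forall>\<tau>. (\<forall>k\<le>l. \<tau> k \<in> lab {p ! k, p ! Suc k}) \<longrightarrow> (\<forall>k<l. \<tau> k < \<tau> (Suc k)) \<longrightarrow> ?hi x y \<le> \<tau> l"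
      using h(1) unfolding late_def by blast
    have y: "p ! Suc l = y" using p(3,5) by (metis diff_Suc_1 last_conv_nth length_0_conv nat.distinct(1))
    have e: "adj D y z" "x \<noteq> z" "?hi x y = ?lo y z" using h(2) arcD by (auto simp: tight_def)
    obtain q where q: "p = q @ [x, y]"
    proof -
      have "p = take l p @ [p ! l, p ! Suc l]"
        using p(3) by (metis Cons_nth_drop_Suc append_take_drop_id drop_eq_Nil le_refl lessI less_SucI)
      then show thesis using that p(4) y by metis
    qed
    have "nb_walk (solid_edges D) (q @ x # y # [z])"
      unfolding nb_walk_overlap[of _ q x y "[z]"]
      using p(1) q e edge_iff nb_walk_append[of _ q "[x, y]"] by (auto simp: path_iff)
    moreover have "hd (q @ [x, y, z]) = hd p" using q by (cases q) auto
    ultimately have "path (p @ [z])" using p(1) q by (auto simp: path_iff)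
    then show ?thesis using p y e by auto
  qed

  \<comment> \<open>\<open>minimal_blocked\<close> on the path from \<open>u\<close> to
    \<open>v\<close>; the two arcs of \<open>bad\<close> are its traversals that omit one
    end.\<close>
  have forced: "\<exists>p. path p \<and> hd p = u \<and> last p = v \<and> 4 \<le> length p \<and> p ! 1 = a \<and> p ! (length p - 2) = b \<and>
      (\<forall>k. Suc (Suc k) < length p \<longrightarrow> tight (p ! k) (p ! Suc k) (p ! Suc (Suc k))) \<and>
      card (lab {u, a}) = 1 \<and> card (lab {b, v}) = 1 \<and>
      (\<forall>k. 0 < k \<longrightarrow> Suc (Suc k) < length p \<longrightarrow> card (lab {p ! k, p ! Suc k}) = 2)"
    if bd: "bad D P u a b v" for u a b v
  proof -
    have s: "side u a v" "side v b u" and arcs: "\<not> arc u v" "arc u b" "arc a v" "a \<noteq> b"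
      using bd P by (auto simp: bad_def)
    obtain p where p: "path p" "hd p = u" "last p = v"
      using path_exists[of u v] side_edgeD[OF s(1)] side_edgeD[OF s(2)] by blast
    have f1: "2 \<le> length p" "p ! 1 = a" using side_first[OF s(1) p] by auto
    have f2: "rev p ! 1 = b"
      using side_first[OF s(2) path_rev[OF p(1)]] p by (simp add: hd_rev last_rev)
    define l where "l = length p - 1"
    have len: "length p = Suc l" using f1 by (simp add: l_def)
    have b: "p ! (l - 1) = b" using f2 f1 by (simp add: rev_nth l_def numeral_2_eq_2)
    have u: "p ! 0 = u" and v: "p ! l = v"
      using p f1 by (auto simp: l_def hd_conv_nth last_conv_nth undirected_path_def)
    have l3: "3 \<le> l"
    proof (rule ccontr)
      assume "\<not> 3 \<le> l"
      then consider "l = 1" | "l = 2" using f1 len by linarith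
      then show False
      proof cases
        case 1
        then show False using f1 v arcs(3) arcD by auto
      next
        case 2
        then show False using f1 b arcs(4) by simp
      qed
    qed
    let ?L = "\<lambda>k. lab {p ! k, p ! Suc k}"
    have ad: "adj D (p ! k) (p ! Suc k)" "adj D (p ! Suc k) (p ! k)" if "k < l" for k
      using path_adj[OF p(1)] that len adj_sym by auto
    have fwd: "increasing ?L 0 (l - 1)" using arc_iff[OF p(1), of 0 "l - 1"] arcs(2) u b l3 len by simp
    have bwd: "increasing ?L 1 l" using arc_iff[OF p(1), of 1 l] arcs(3) f1(2) v l3 len by simp
    have blocked: "\<not> increasing ?L 0 l" using arc_iff[OF p(1), of 0 l] arcs(1) u v l3 len by simp
    have arc3: "arc (p ! k) (p ! Suc (Suc k))" if k: "Suc k < l" for k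
    proof -
      have "increasing ?L k (Suc (Suc k))"
      proof (cases "k = 0")
        case True
        then show ?thesis using increasing_sub[OF fwd, of k "Suc (Suc k)"] l3 by simp
      next
        case False
        then show ?thesis using increasing_sub[OF bwd, of k "Suc (Suc k)"] k by simp
      qed
      then show ?thesis using arc_iff[OF p(1), of k "Suc (Suc k)"] k len by simp
    qed
    have fin': "finite (?L k) \<and> ?L k \<noteq> {}" if "k < l" for k using fin ad(1)[OF that] by blast
    have mono: "Max (?L k) \<le> Min (?L (Suc k))" if k: "Suc k < l" for k
      using le[OF ad(1)[of k] ad(2)[of "Suc k"] arc3[OF k]] k by simp
    have l2: "2 \<le> l" using l3 by simp
    note forced = minimal_blocked[where L = ?L, OF fin' l2 mono fwd bwd blocked]
    have "Suc (l - 1) = l" using l3 by simp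
    then have ends: "card (lab {u, a}) = 1" "card (lab {b, v}) = 1"
      using forced(2,3) u f1(2) b v by simp_all
    have "tight (p ! k) (p ! Suc k) (p ! Suc (Suc k))" if "Suc (Suc k) < length p" for k
      unfolding tight_def using ad[of k] ad[of "Suc k"] arc3[of k] forced(1)[of k] that len by simp
    moreover have "card (lab {p ! k, p ! Suc k}) = 2" if "0 < k" "Suc (Suc k) < length p" for k
      using forced(4)[of k] that len by simp
    moreover have "p ! (length p - 2) = b" using b len by (simp add: numeral_2_eq_2)
    ultimately show ?thesis using p f1 l3 len ends by (intro exI[of _ p]) auto
  qed

  have arcs0: "(0, u, a, v) \<in> P \<Longrightarrow> (arc u v \<and> a \<noteq> v \<longrightarrow> arc a v) \<and> (arc v u \<and> a \<noteq> v \<longrightarrow> arc v a)" for u a v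
  proof -
    assume "(0, u, a, v) \<in> P"
    then have s: "side u a v" using P by blast
    obtain p where p: "path p" "hd p = u" "last p = v"
      using path_exists[of u v] side_edgeD[OF s] edgeD by blast
    have f1: "2 \<le> length p" "p ! 1 = a" using side_first[OF s p] by auto
    define l where "l = length p - 1"
    have len: "length p = Suc l" using f1 by (simp add: l_def)
    have u: "p ! 0 = u" and v: "p ! l = v"
      using p f1 by (auto simp: l_def hd_conv_nth last_conv_nth undirected_path_def)
    \<comment> \<open>Arcs towards \<open>u\<close> are traversals of the reversed path, on which
      \<open>a\<close> is the last vertex but one.\<close>
    have q: "path (rev p)" "rev p ! 0 = v" "rev p ! l = u" "rev p ! (l - 1) = a" "length (rev p) = Suc l"
      using path_rev[OF p(1)] u v f1 len by (auto simp: rev_nth)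
    have l: "1 < l" if "a \<noteq> v"
    proof (rule ccontr)
      assume "\<not> 1 < l"
      then have "l = 1" using f1 len by simp
      then show False using v f1 that by simp
    qed
    show ?thesis
    proof (intro conjI impI)
      assume "arc u v \<and> a \<noteq> v"
      then have "increasing (\<lambda>k. lab {p ! k, p ! Suc k}) 1 l"
        using arc_iff[OF p(1), of 0 l] u v l len by (auto intro: increasing_sub)
      then show "arc a v" using arc_iff[OF p(1), of 1 l] f1(2) v l len \<open>arc u v \<and> a \<noteq> v\<close> by simp
    next
      assume "arc v u \<and> a \<noteq> v"
      then have "increasing (\<lambda>k. lab {rev p ! k, rev p ! Suc k}) 0 l"
        using arc_iff[OF q(1), of 0 l] q l by simp
      then have "increasing (\<lambda>k. lab {rev p ! k, rev p ! Suc k}) 0 (l - 1)"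
        by (rule increasing_sub) auto
      then show "arc v a" using arc_iff[OF q(1), of 0 "l - 1"] q l \<open>arc v u \<and> a \<noteq> v\<close> by simp
    qed
  qed

  show thesis
  proof
    show "consistent D P"
      unfolding consistent_def Let_def
    proof (intro conjI ballI impI)
      fix v x y z assume a: "adj D x v \<and> adj D y v \<and> adj D z v"
      then have a': "adj D v y" "adj D v z" using adj_sym by blast+
      show "arc x z" if h: "arc x y \<and> arc y z"
      proof -
        have n: "x \<noteq> z" using arc_asym[of x v y] a h by blast
        have "?lo x v < ?hi v y" "?hi y v \<le> ?lo v z"
          using arc2[of x v y] le[of y v z] a h arcD by blast+
        then show ?thesis using arc2[of x v z] a n comm[of y v] lohi[OF a'(2)] by simp
      qed
      show "arc x z" if h: "sim D x y \<and> arc y z"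
      proof -
        have n: "x \<noteq> z" "y \<noteq> z" using h arcD by (auto simp: sim_def)
        show ?thesis using simD[of x v y] arc2[of x v z] arc2[of y v z] a h n comm[of y v] by simp
      qed
      show "arc x z" if h: "arc x y \<and> sim D y z"
      proof -
        have n: "x \<noteq> z" "x \<noteq> y" using h arcD by (auto simp: sim_def)
        show ?thesis using simD[of y v z] arc2[of x v z] arc2[of x v y] a h n comm[of y v] by simp
      qed
    next
      fix u a v assume "(0, u, a, v) \<in> P" "arc u v \<and> a \<noteq> v"
      then show "arc a v" using arcs0 by blast
    next
      fix u a v assume "(0, u, a, v) \<in> P" "arc v u \<and> a \<noteq> v"
      then show "arc v a" using arcs0 by blast
    next
      fix x y show "\<not> ((1, x, y, y) \<in> P \<and> (2, x, y, y) \<in> P)" using P(2,3)[of x y y] by simp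
    next
      fix x y z assume "(3, x, y, z) \<in> P"
      then show "arc x z" using P(4) by (simp add: tight_def)
    next
      fix u x y z assume "(4, u, x, y) \<in> P \<and> (3, x, y, z) \<in> P \<and> (1, y, z, z) \<in> P"
      then have h: "late u x y" "tight x y z" "card (lab {y, z}) = 1" "adj D y z" using P by auto
      from extend[OF h(1,2)] obtain p l where p: "path (p @ [z])" "path p" "hd p = u" "length p = Suc (Suc l)"
        "p ! l = x" "p ! Suc l = y"
        "\<And>\<tau>. (\<forall>k\<le>l. \<tau> k \<in> lab {p ! k, p ! Suc k}) \<Longrightarrow> (\<forall>k<l. \<tau> k < \<tau> (Suc k)) \<Longrightarrow> ?lo y z \<le> \<tau> l"
        by blast
      have u: "p ! 0 = u" using p(2,3) by (auto simp: hd_conv_nth undirected_path_def)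
      show "\<not> arc u z"
      proof
        assume "arc u z"
        then have "increasing (\<lambda>k. lab {(p @ [z]) ! k, (p @ [z]) ! Suc k}) 0 (Suc (Suc l))"
          using arc_iff[OF p(1), of 0 "Suc (Suc l)"] u p(4) by (simp add: nth_append)
        then obtain t where t: "\<forall>k<Suc (Suc l). t k \<in> lab {(p @ [z]) ! k, (p @ [z]) ! Suc k}"
          "\<forall>k. Suc k < Suc (Suc l) \<longrightarrow> t k < t (Suc k)" by (auto simp: increasing_def)
        have "?lo y z \<le> t l"
        proof (rule p(7))
          show "\<forall>k\<le>l. t k \<in> lab {p ! k, p ! Suc k}"
          proof (intro allI impI)
            fix k assume "k \<le> l"
            then show "t k \<in> lab {p ! k, p ! Suc k}" using t(1)[rule_format, of k] p(4) by (simp add: nth_append)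
          qed
          show "\<forall>k<l. t k < t (Suc k)" using t(2) by simp
        qed
        moreover have "t (Suc l) \<in> lab {y, z}"
          using t(1)[rule_format, of "Suc l"] p(4,6) by (simp add: nth_append)
        then have "t (Suc l) \<le> ?hi y z" using fin[OF h(4)] by simp
        moreover have "t l < t (Suc l)" using t(2) by simp
        \<comment> \<open>The time before the last edge is already its only label, which leaves no
          later one.\<close>
        ultimately show False using single[OF h(3)] by simp
      qed
    qed
    show "\<And>u w v. (0, u, w, v) \<in> P \<longleftrightarrow> side u w v" using P(1) .
    fix k x y z assume V: "x \<in> V" "y \<in> V" "z \<in> V" and der: "derives D P k x y z"
    \<comment> \<open>Squeezing: the labels of \<open>wv\<close> lie between the last label of
      \<open>pv\<close> and the first of \<open>vq\<close>, and tightness makes these two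
      equal.\<close>
    have mid: "card (lab {w, v}) = 1 \<and> tight p v w \<and> tight w v q"
      if "tight p v q" "adj D w v" "arc p w" "arc w q" for p v q w
    proof -
      have a: "adj D p v" "adj D v q" "adj D q v" "adj D v w" "?hi p v = ?lo v q"
        using that adj_sym by (auto simp: tight_def)
      have "?hi p v \<le> ?lo w v" "?hi w v \<le> ?lo v q"
        using le[OF a(1) that(2,3)] le[OF that(2) a(3) that(4)] comm[of v w] by auto
      then have e: "?lo w v = ?hi w v" "?hi p v = ?lo w v" "?hi w v = ?lo v q" using lohi[OF that(2)] a(5) by auto
      have "lab {w, v} = {?lo w v}"
      proof -
        have "t = ?lo w v" if "t \<in> lab {w, v}" for t
          using that fin[OF \<open>adj D w v\<close>] e(1) by (metis Max_ge Min_le le_antisym)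
        then show ?thesis using fin[OF that(2)] by blast
      qed
      then have "card (lab {w, v}) = 1" by (metis One_nat_def card.empty card.insert empty_iff finite.emptyI)
      then show ?thesis using that a e comm[of v w] by (auto simp: tight_def)
    qed
    have on_edge: "\<exists>i. Suc i < length p \<and> x = p ! i \<and> y = p ! Suc i"
      if "on P x y (hd p) (last p)" "path p" for p x y
      using on_path[OF that(2), of x y] that(1) P(1) unfolding on_def by blast
    from der consider "k = 0" | "k = 1" | "k = 2" | "k = 3" | "k = 4" unfolding derives_def Let_def by blast
    then show "(k, x, y, z) \<in> P"
    proof cases
      case 1
      then have "y = z \<and> adj D x y \<or> (\<exists>p\<in>V. side x y p \<and> adj D p z \<and> z \<noteq> x)"
        using der P(1) by (simp add: derives_def Let_def)
      then show ?thesis using 1 P(1) side_edge side_step edge_iff by blast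
    next
      case 2
      then consider "(1, y, x, x) \<in> P" | w where "adj D x y" "adj D y w" "sim D x w" | b v where "bad D P x y b v" |
          u a where "bad D P u a y x" | p q where "adj D x y" "(3, p, y, q) \<in> P" "arc p x" "arc x q"
        using der unfolding derives_def Let_def by auto
      then have "adj D x y \<and> card (lab {x, y}) = 1"
      proof cases
        case 1
        then show ?thesis using P(2) comm adj_sym by metis
      next
        case 2
        then show ?thesis using simD[of x y w] adj_sym by blast
      next
        case 3
        then have "side x y v" using P(1) by (simp add: bad_def)
        then show ?thesis using forced[OF 3] side_edgeD edge_iff by blast
      next
        case 4
        then have "side x y u" using P(1) by (simp add: bad_def)
        then show ?thesis using forced[OF 4] side_edgeD edge_iff comm by metis
      next
        case 5
        then show ?thesis using mid[of p y q x] P(4) by blast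
      qed
      then show ?thesis using 2 P(2) by blast
    next
      case 3
      then consider "(2, y, x, x) \<in> P" | u a b v where "bad D P u a b v" "on P x y u v" "x \<noteq> u" "y \<noteq> v"
        using der unfolding derives_def Let_def by auto
      then have "adj D x y \<and> card (lab {x, y}) = 2"
      proof cases
        case 1
        then show ?thesis using P(3) comm adj_sym by metis
      next
        case 2
        obtain p where p: "path p" "hd p = u" "last p = v"
          "\<forall>k. 0 < k \<longrightarrow> Suc (Suc k) < length p \<longrightarrow> card (lab {p ! k, p ! Suc k}) = 2"
          using forced[OF 2(1)] by blast
        obtain i where i: "Suc i < length p" "x = p ! i" "y = p ! Suc i" using on_edge[of x y p] 2(2) p by blast
        have "i \<noteq> 0" using i 2(3) p(1,2) by (cases i) (auto simp: hd_conv_nth undirected_path_def)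
        moreover have "Suc (Suc i) \<noteq> length p"
        proof
          assume "Suc (Suc i) = length p"
          then have "last p = p ! Suc i" using p(1) by (metis diff_Suc_1 last_conv_nth undirected_path_def)
          then show False using i 2(4) p by simp
        qed
        ultimately show ?thesis using i p(4) path_adj[OF p(1) i(1)] by simp
      qed
      then show ?thesis using 3 P(3) by blast
    next
      case 4
      then consider u a b v where "bad D P u a b v" "on P x y u v" "on P y z u v" |
          w where "adj D x y" "adj D y z" "tight x y w" "arc x z" "arc z w" |
          w where "adj D x y" "adj D y z" "tight w y z" "arc w x" "arc x z" |
          w where "adj D x y" "adj D y z" "tight x y w" "card (lab {w, y}) = 1" "tight w y z" |
          w where "adj D x y" "adj D y z" "tight w y z" "sim D x w" |
          w where "adj D x y" "adj D y z" "tight x y w" "sim D z w"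
        using der P(2,4) unfolding derives_def Let_def by auto
      then have "tight x y z"
      proof cases
        case 1
        obtain p where p: "path p" "hd p = u" "last p = v"
          "\<forall>k. Suc (Suc k) < length p \<longrightarrow> tight (p ! k) (p ! Suc k) (p ! Suc (Suc k))"
          using forced[OF 1(1)] by blast
        obtain i where i: "Suc i < length p" "x = p ! i" "y = p ! Suc i" using on_edge[of x y p] 1(2) p by blast
        obtain j where j: "Suc j < length p" "y = p ! j" "z = p ! Suc j" using on_edge[of y z p] 1(3) p by blast
        have "j = Suc i" using path_nth_eq[OF p(1), of j "Suc i"] i j by simp
        then show ?thesis using p(4) i j by blast
      next
        case 2
        then show ?thesis using mid[of x y w z] adj_sym by blast
      next
        case 3
        then show ?thesis using mid[of w y z x] by blast
      next
        case 4
        have e: "adj D w y" "adj D y w" using 4 adj_sym by (auto simp: tight_def)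
        have "?lo x y < ?hi y w" "?lo y w = ?hi y w" "?hi x y = ?lo y w" "?hi w y = ?lo y z"
          using arc2[of x y w] 4 e single[OF 4(4)] comm[of y w] arcD by (auto simp: tight_def)
        moreover have "x \<noteq> z" using arc_asym[of x y w] 4 e by (auto simp: tight_def)
        ultimately show ?thesis
          using arc2[of x y z] 4 adj_sym lohi[OF 4(2)] comm[of y w] by (auto simp: tight_def)
      next
        case 5
        have e: "adj D w y" "adj D z y" using 5 adj_sym by (auto simp: tight_def)
        have "lab {x, y} = lab {w, y}" using simD[OF 5(1) e(1) 5(4)] comm[of y w] by simp
        moreover have "x \<noteq> z" using 5 by (auto simp: tight_def sim_def)
        moreover have "w \<noteq> z" using 5 arcD by (auto simp: tight_def)
        ultimately show ?thesis using arc2[OF 5(1) e(2)] arc2[OF e] 5 by (auto simp: tight_def)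
      next
        case 6
        have e: "adj D w y" "adj D z y" "adj D y w" using 6 adj_sym by (auto simp: tight_def)
        have "lab {y, z} = lab {y, w}" using simD[OF e(2,1) 6(4)] comm[of y z] by simp
        moreover have "x \<noteq> z" using 6 by (auto simp: tight_def sim_def)
        moreover have "x \<noteq> w" using 6 arcD by (auto simp: tight_def)
        ultimately show ?thesis using arc2[OF 6(1) e(2)] arc2[OF 6(1) e(1)] 6 by (auto simp: tight_def)
      qed
      then show ?thesis using 4 P(4) by blast
    next
      case 5
      then consider "x = y" "adj D x z" "card (lab {x, z}) = 1" |
          w where "late x w y" "tight w y z" "adj D y z" "card (lab {y, z}) = 2"
        using der P(2,3,4,5) unfolding derives_def Let_def by auto
      then have "late x y z"
      proof cases
        case 1
        have "path [x, z]" using path_two 1 edge_iff by blast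
        moreover have "?hi y z \<le> t" if "t \<in> lab {x, z}" for t
          using that 1 by (auto simp: card_1_singleton_iff)
        ultimately show ?thesis
          unfolding late_def using 1 by (intro exI[of _ "[x, z]"] exI[of _ 0]) auto
      next
        case 2
        from extend[OF 2(1,2)] obtain p l where p: "path (p @ [z])" "path p" "hd p = x" "length p = Suc (Suc l)"
          "p ! l = w" "p ! Suc l = y"
          "\<And>\<tau>. (\<forall>k\<le>l. \<tau> k \<in> lab {p ! k, p ! Suc k}) \<Longrightarrow> (\<forall>k<l. \<tau> k < \<tau> (Suc k)) \<Longrightarrow> ?lo y z \<le> \<tau> l"
          by blast
        have "?hi y z \<le> t (Suc l)" if t: "\<forall>k\<le>Suc l. t k \<in> lab {(p @ [z]) ! k, (p @ [z]) ! Suc k}"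
          "\<forall>k<Suc l. t k < t (Suc k)" for t
        proof -
          have "?lo y z \<le> t l"
          proof (rule p(7))
            show "\<forall>k\<le>l. t k \<in> lab {p ! k, p ! Suc k}"
            proof (intro allI impI)
              fix k assume "k \<le> l"
              then show "t k \<in> lab {p ! k, p ! Suc k}" using t(1)[rule_format, of k] p(4) by (simp add: nth_append)
            qed
            show "\<forall>k<l. t k < t (Suc k)" using t(2) by simp
          qed
          also have "t l < t (Suc l)" using t(2) by simp
          finally have "?lo y z < t (Suc l)" .
          moreover have "t (Suc l) \<in> lab {y, z}"
            using t(1)[rule_format, of "Suc l"] p(4,6) by (simp add: nth_append)
          \<comment> \<open>Strictly above the smaller of two labels only the larger one
            remains.\<close>
          ultimately show ?thesis using pair[OF 2(4)] by simp
        qed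
        moreover have "hd (p @ [z]) = x" "(p @ [z]) ! Suc l = y" using p(3,4,6) by (auto simp: nth_append hd_append)
        ultimately show ?thesis
          unfolding late_def using p(1,4) by (intro exI[of _ "p @ [z]"] exI[of _ "Suc l"]) auto
      qed
      then show ?thesis using 5 P(5) by blast
    qed
  qed
qed

end

section \<open>The candidate as a fixed point\<close>

definition Disj :: "fm \<Rightarrow> fm \<Rightarrow> fm" where "Disj f g = Neg (Conj (Neg f) (Neg g))"

definition Adj_fm :: "nat \<Rightarrow> nat \<Rightarrow> fm" where "Adj_fm i j = Conj (Arc i j) (Arc j i)"

definition Sim_fm :: "nat \<Rightarrow> nat \<Rightarrow> fm" where
  "Sim_fm i j = Conj (Neg (Eq i j)) (Conj (Neg (Arc i j)) (Neg (Arc j i)))"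

definition Bad_fm :: "nat \<Rightarrow> nat \<Rightarrow> nat \<Rightarrow> nat \<Rightarrow> fm" where
  "Bad_fm u a b v = Conj (Rel 0 u a v) (Conj (Rel 0 v b u)
     (Conj (Neg (Arc u v)) (Conj (Arc u b) (Conj (Arc a v) (Neg (Eq a b))))))"

definition On_fm :: "nat \<Rightarrow> nat \<Rightarrow> nat \<Rightarrow> nat \<Rightarrow> fm" where
  "On_fm x y u v = Conj (Rel 0 x y v) (Rel 0 y x u)"

definition Exists4 :: "nat \<Rightarrow> nat \<Rightarrow> nat \<Rightarrow> nat \<Rightarrow> fm \<Rightarrow> fm" where
  "Exists4 i j k l f = Exists i (Exists j (Exists k (Exists l f)))"

text \<open>Entry \<open>k\<close> is the rule for tag \<open>k\<close>; variables 0, 1, 2 stand for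
  \<open>x\<close>, \<open>y\<close>, \<open>z\<close> and 3 to 6 are bound, seven in all. For tags
  1 and 2 the last argument is padding: the conclusions hold for every value of it, and premises
  repeat a vertex there.\<close>

definition rule_fms :: "fm list" where
  "rule_fms =
    [Disj (Conj (Eq 1 2) (Adj_fm 0 1))
       (Exists 3 (Conj (Rel 0 0 1 3) (Conj (Adj_fm 3 2) (Neg (Eq 2 0))))),
     Disj (Rel 1 1 0 0)
       (Disj (Conj (Adj_fm 0 1) (Exists 3 (Conj (Adj_fm 1 3) (Sim_fm 0 3))))
       (Disj (Exists 3 (Exists 4 (Bad_fm 0 1 3 4)))
       (Disj (Exists 3 (Exists 4 (Bad_fm 3 4 1 0)))
         (Conj (Adj_fm 0 1) (Exists 3 (Exists 4 (Conj (Rel 3 3 1 4) (Conj (Arc 3 0) (Arc 0 4))))))))),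
     Disj (Rel 2 1 0 0)
       (Exists4 3 4 5 6 (Conj (Bad_fm 3 4 5 6) (Conj (On_fm 0 1 3 6) (Conj (Neg (Eq 0 3)) (Neg (Eq 1 6)))))),
     Disj (Exists4 3 4 5 6 (Conj (Bad_fm 3 4 5 6) (Conj (On_fm 0 1 3 6) (On_fm 1 2 3 6))))
       (Conj (Adj_fm 0 1) (Conj (Adj_fm 1 2) (Exists 3
         (Disj (Conj (Rel 3 0 1 3) (Conj (Arc 0 2) (Arc 2 3)))
         (Disj (Conj (Rel 3 3 1 2) (Conj (Arc 3 0) (Arc 0 2)))
         (Disj (Conj (Rel 3 0 1 3) (Conj (Rel 1 3 1 1) (Rel 3 3 1 2)))
         (Disj (Conj (Rel 3 3 1 2) (Sim_fm 0 3))
           (Conj (Rel 3 0 1 3) (Sim_fm 2 3))))))))),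
     Disj (Conj (Eq 0 1) (Rel 1 0 2 2))
       (Exists 3 (Conj (Rel 4 0 3 1) (Conj (Rel 3 3 1 2) (Rel 2 1 2 2))))]"

text \<open>Quantifiers are existential only, so this is the negation of the list of possible
  violations.\<close>

definition consistent_fm :: fm where
  "consistent_fm = Neg
    (Disj (Exists4 0 1 2 3 (Conj (Conj (Adj_fm 1 0) (Conj (Adj_fm 2 0) (Adj_fm 3 0)))
       (Conj (Neg (Arc 1 3)) (Disj (Conj (Arc 1 2) (Arc 2 3))
         (Disj (Conj (Sim_fm 1 2) (Arc 2 3)) (Conj (Arc 1 2) (Sim_fm 2 3)))))))
    (Disj (Exists 0 (Exists 1 (Exists 2 (Conj (Rel 0 0 1 2) (Conj (Neg (Eq 1 2))
       (Disj (Conj (Arc 0 2) (Neg (Arc 1 2))) (Conj (Arc 2 0) (Neg (Arc 2 1)))))))))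
    (Disj (Exists 0 (Exists 1 (Conj (Rel 1 0 1 1) (Rel 2 0 1 1))))
    (Disj (Exists 0 (Exists 1 (Exists 2 (Conj (Rel 3 0 1 2) (Neg (Arc 0 2))))))
      (Exists4 0 1 2 3 (Conj (Rel 4 0 1 2) (Conj (Rel 3 1 2 3) (Conj (Rel 1 2 3 3) (Arc 0 3)))))))))"

lemmas fm_defs = Disj_def Adj_fm_def Sim_fm_def Bad_fm_def On_fm_def Exists4_def

lemma sat_abbrevs:
  "sat n A X (Disj f g) e \<longleftrightarrow> sat n A X f e \<or> sat n A X g e"
  "sat n A X (Exists4 i j k l f) e \<longleftrightarrow>
     (\<exists>a<n. \<exists>b<n. \<exists>c<n. \<exists>d<n. sat n A X f (e(i := a, j := b, k := c, l := d)))"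
  "sat n (\<lambda>a b. (a, b) \<in> parcs D) X (Adj_fm i j) e \<longleftrightarrow> adj D (e i) (e j)"
  "sat n (\<lambda>a b. (a, b) \<in> parcs D) X (Sim_fm i j) e \<longleftrightarrow> sim D (e i) (e j)"
  "sat n (\<lambda>a b. (a, b) \<in> parcs D) X (Bad_fm i j k l) e \<longleftrightarrow> bad D X (e i) (e j) (e k) (e l)"
  "sat n A X (On_fm i j k l) e \<longleftrightarrow> on X (e i) (e j) (e k) (e l)"
  by (simp_all add: fm_defs adj_def sim_def bad_def on_def)

lemma wf_rule_fms:
  "f \<in> set rule_fms \<Longrightarrow> wf_fm (length rule_fms) 7 f \<and> fv f \<subseteq> {0, 1, 2} \<and> bv f \<inter> {0, 1, 2} = {}"
  unfolding rule_fms_def fm_defs by (elim set_ConsD[elim_format] disjE) auto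

lemma wf_consistent_fm: "wf_fm (length rule_fms) 7 consistent_fm" "fv consistent_fm = {}"
  by (auto simp: rule_fms_def consistent_fm_def fm_defs)

lemma bex_interval: "(\<exists>a\<in>{0..<n}. P a) \<longleftrightarrow> (\<exists>a<n. P (a :: nat))"
  "(\<forall>a\<in>{0..<n}. P a) \<longleftrightarrow> (\<forall>a<n. P (a :: nat))"
  by auto

lemma holds_iff_derives:
  assumes "pverts D = {0..<n}" "k < 5"
  shows "holds n (\<lambda>a b. (a, b) \<in> parcs D) rule_fms X (k, x, y, z) \<longleftrightarrow> derives D X k x y z"
proof -
  have "k = 0 \<or> k = 1 \<or> k = 2 \<or> k = 3 \<or> k = 4" using assms(2) by auto
  then show ?thesis
    unfolding holds_def derives_def Let_def rule_fms_def assms(1) bex_interval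
    by (elim disjE) (simp_all add: sat_abbrevs)
qed

lemma sat_consistent_fm:
  assumes "pverts D = {0..<n}"
  shows "sat n (\<lambda>a b. (a, b) \<in> parcs D) X consistent_fm e \<longleftrightarrow> consistent D X"
  unfolding consistent_fm_def consistent_def Let_def assms bex_interval sat.simps sat_abbrevs de_Morgan_disj
  by (intro arg_cong2[where f = "(\<and>)"]; simp; blast)

theorem theorem23:
  shows "polynomial_time_solvable_on
           {D \<in> input_digraphs. undirected_tree (pverts D) (solid_edges D)}
           encode_digraph
           any_strict_realizable"
proof (rule fixpoint_definable_polynomial_time[OF _ _ wf_rule_fms wf_consistent_fm])
  fix D :: "nat pair_pre_digraph" and n :: nat and X :: "(nat \<times> nat \<times> nat \<times> nat) set"
  let ?A = "\<lambda>a b. (a, b) \<in> parcs D" and ?m = "length rule_fms"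
  assume D: "D \<in> {D \<in> input_digraphs. undirected_tree (pverts D) (solid_edges D)}"
    and n: "pverts D = {0..<n}" and sub: "X \<subseteq> tuples ?m n" and closed: "closed_under n ?A rule_fms X"
    and least: "\<And>P. (\<And>Z u. Z \<subseteq> P \<Longrightarrow> u \<in> tuples ?m n \<Longrightarrow> holds n ?A rule_fms Z u \<Longrightarrow> u \<in> P) \<Longrightarrow> X \<subseteq> P"
  interpret solid_tree D
    by (rule solid_tree.intro) (use D in \<open>simp_all add: input_digraphs_def\<close>)
  have m: "?m = 5" by (simp add: rule_fms_def)
  have V: "x \<in> V \<longleftrightarrow> x < n" for x using n by simp
  have tup: "(k, x, y, z) \<in> tuples ?m n \<longleftrightarrow> k < 5 \<and> x \<in> V \<and> y \<in> V \<and> z \<in> V" for k x y z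
    using V by (simp add: tuples_def m)
  \<comment> \<open>Monotonicity of the rules reduces the condition on all subsets \<open>Z\<close>
    of \<open>P\<close> to closedness of \<open>P\<close> itself.\<close>
  have least': "X \<subseteq> P" if "\<And>k x y z. k < 5 \<Longrightarrow> x \<in> V \<Longrightarrow> y \<in> V \<Longrightarrow> z \<in> V \<Longrightarrow> derives D P k x y z \<Longrightarrow> (k, x, y, z) \<in> P" for P
  proof (rule least)
    fix Z u assume Z: "Z \<subseteq> P" and u: "u \<in> tuples ?m n" "holds n ?A rule_fms Z u"
    obtain k x y z where e: "u = (k, x, y, z)" by (cases u)
    then have k: "k < 5" "x \<in> V" "y \<in> V" "z \<in> V" using u(1) tup by auto
    then have "derives D P k x y z" using u(2) derives_mono[OF Z] holds_iff_derives[OF n k(1)] e by blast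
    then show "u \<in> P" using that k e by blast
  qed
  have closed': "(k, x, y, z) \<in> X" if "k < 5" "x \<in> V" "y \<in> V" "z \<in> V" "derives D X k x y z" for k x y z
    using closed that tup holds_iff_derives[OF n that(1)] unfolding closed_under_def by blast
  have "(0, u, w, v) \<in> X \<longleftrightarrow> side u w v" for u w v
  proof
    assume s: "side u w v"
    then have uw: "u \<in> V" "w \<in> V" "adj D u w" using side_edgeD edgeD edge_iff by blast+
    from s show "(0, u, w, v) \<in> X"
    proof (rule side_induct)
      have "derives D X 0 u w w" using uw by (simp add: derives_def Let_def)
      then show "(0, u, w, w) \<in> X" using closed'[of 0] uw by simp
    next
      fix v v' assume v: "(0, u, w, v) \<in> X" "side u w v" "side u w v'" "{v, v'} \<in> solid_edges D" "v' \<noteq> u"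
      then have "v \<in> V" "v' \<in> V" "adj D v v'" using side_edgeD edge_iff by blast+
      moreover from this have "derives D X 0 u w v'" using v by (auto simp: derives_def Let_def)
      ultimately show "(0, u, w, v') \<in> X" using closed'[of 0] uw by simp
    qed
  next
    let ?P = "{(k, u, w, v). k = 0 \<longrightarrow> side u w v}"
    have "X \<subseteq> ?P"
    proof (rule least')
      fix k x y z assume "derives D ?P k x y z"
      then have "k = 0 \<longrightarrow> y = z \<and> adj D x y \<or> (\<exists>p\<in>V. side x y p \<and> adj D p z \<and> z \<noteq> x)"
        by (auto simp: derives_def Let_def)
      then have "k = 0 \<longrightarrow> side x y z" using side_edge side_step edge_iff by blast
      then show "(k, x, y, z) \<in> ?P" by simp
    qed
    then show "(0, u, w, v) \<in> X \<Longrightarrow> side u w v" by auto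
  qed
  note side = this
  have "consistent D X \<longleftrightarrow> any_strict_realizable D"
  proof
    show "consistent D X \<Longrightarrow> any_strict_realizable D"
      using realizable_if_consistent[OF closed' side] by blast
    assume "any_strict_realizable D"
    then show "consistent D X"
    proof (rule consistent_if_realizable)
      fix P
      assume P: "consistent D P" "\<And>k x y z. x \<in> V \<Longrightarrow> y \<in> V \<Longrightarrow> z \<in> V \<Longrightarrow> derives D P k x y z \<Longrightarrow> (k, x, y, z) \<in> P"
      have "X \<subseteq> P" by (rule least') (rule P(2))
      then show "consistent D X" using consistent_antimono P(1) by blast
    qed
  qed
  then show "sat n ?A X consistent_fm (\<lambda>_. 0) \<longleftrightarrow> any_strict_realizable D"
    using sat_consistent_fm[OF n] by blast
qed auto

end
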